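(* Let $X$ and $X_k$ ($k\ge1$) be non-degenerate $n$-connected domains in $\widehat{\mathbb{C}}$ containing $\infty$, with $X_k\to X$ in the sense of Carathéodory. Let $f_k$ and $f$ be the Ahlfors functions on $X_k$ and $X$ respectively. Then $f_k\to f$ locally uniformly on $X$.
   Context: Non-degenerate $n$-connected: the complement has exactly $n$ components, none a point. Carathéodory convergence: $\ker\{X_k\}$ is the largest domain $X\ni\infty$ such that every compact subset of $X$ lies in $X_k$ for all large $k$; $X_k\to X$ means $X$ is the kernel of every subsequence. For $g$ holomorphic near $\infty$, $g'(\infty):=\lim_{z\to\infty}z(g(z)-g(\infty))$. Analytic capacity: $\gamma(\widehat{\mathbb{C}}\setminus X)=\sup\{|g'(\infty)|: g:X\to\overline{\mathbb{D}}\text{ holomorphic}\}$; the Ahlfors function on $X$ is the unique holomorphic $f:X\to\mathbb{D}$ with $f'(\infty)=\gamma(\widehat{\mathbb{C}}\setminus X)$ (positive for such $X$). *)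

theory Defs
  imports "HOL-Analysis.Analysis"
begin

text \<open>A domain X in the Riemann sphere containing \<infinity> is represented by its finite
part U = X - {\<infinity>} \<subseteq> \<complex>: U is open, connected, and has bounded complement
(so that U \<union> {\<infinity>} is an open neighbourhood of \<infinity>). The complement of X in the
sphere is then exactly - U.\<close>

definition infty_domain :: "complex set \<Rightarrow> bool" where
  "infty_domain U \<longleftrightarrow> open U \<and> connected U \<and> bounded (- U)"

definition nondeg_nconn :: "nat \<Rightarrow> complex set \<Rightarrow> bool" where
  "nondeg_nconn n U \<longleftrightarrow> infty_domain U \<and> finite (components (- U))
     \<and> card (components (- U)) = n \<and> (\<forall>C\<in>components (- U). \<not> (\<exists>z. C = {z}))"

text \<open>A function on X is a function g on U together with its value at \<infinity>.
g is holomorphic on X iff it is holomorphic on U and w \<mapsto> g(1/w) extends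
holomorphically to a neighbourhood of 0.\<close>
definition holo_on_X :: "complex set \<Rightarrow> (complex \<Rightarrow> complex) \<Rightarrow> bool" where
  "holo_on_X U g \<longleftrightarrow> g holomorphic_on U \<and>
     (\<exists>c r. r > 0 \<and> (\<lambda>w. if w = 0 then c else g (1 / w)) holomorphic_on ball 0 r)"

definition val_infty :: "(complex \<Rightarrow> complex) \<Rightarrow> complex" where
  "val_infty g = Lim at_infinity g"

definition deriv_infty :: "(complex \<Rightarrow> complex) \<Rightarrow> complex" where
  "deriv_infty g = Lim at_infinity (\<lambda>z. z * (g z - val_infty g))"

definition anal_cap :: "complex set \<Rightarrow> real" where
  "anal_cap U = Sup {norm (deriv_infty g) | g. holo_on_X U g \<and>
      (\<forall>z\<in>U. norm (g z) \<le> 1) \<and> norm (val_infty g) \<le> 1}"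

definition is_ahlfors :: "complex set \<Rightarrow> (complex \<Rightarrow> complex) \<Rightarrow> bool" where
  "is_ahlfors U f \<longleftrightarrow> holo_on_X U f \<and> (\<forall>z\<in>U. norm (f z) < 1)
     \<and> norm (val_infty f) < 1 \<and> deriv_infty f = complex_of_real (anal_cap U)"

text \<open>Compact subsets of X are (contained in) sets K \<union> {\<infinity>} with K closed in \<complex>, K \<subseteq> U.
V is an admissible kernel candidate for the sequence Us.\<close>
definition kernel_cand :: "(nat \<Rightarrow> complex set) \<Rightarrow> complex set \<Rightarrow> bool" where
  "kernel_cand Us V \<longleftrightarrow> infty_domain V \<and>
     (\<forall>K. closed K \<and> K \<subseteq> V \<longrightarrow> (\<forall>\<^sub>F k in sequentially. K \<subseteq> Us k))"

definition is_kernel :: "(nat \<Rightarrow> complex set) \<Rightarrow> complex set \<Rightarrow> bool" where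
  "is_kernel Us U \<longleftrightarrow> kernel_cand Us U \<and> (\<forall>V. kernel_cand Us V \<longrightarrow> V \<subseteq> U)"

definition cara_conv :: "(nat \<Rightarrow> complex set) \<Rightarrow> complex set \<Rightarrow> bool" where
  "cara_conv Us U \<longleftrightarrow> (\<forall>r. strict_mono r \<longrightarrow> is_kernel (Us \<circ> r) U)"

text \<open>Locally uniform convergence on X (including at \<infinity>): uniform convergence on
every closed K \<subseteq> U (i.e. on the compact set K \<union> {\<infinity>} of X) together with
convergence of the values at \<infinity>.\<close>
definition locunif_conv_X ::
  "complex set \<Rightarrow> (nat \<Rightarrow> complex \<Rightarrow> complex) \<Rightarrow> (complex \<Rightarrow> complex) \<Rightarrow> bool" where
  "locunif_conv_X U fs f \<longleftrightarrow>
     (\<forall>K. closed K \<and> K \<subseteq> U \<longrightarrow> uniform_limit K fs f sequentially) \<and>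
     (\<lambda>k. val_infty (fs k)) \<longlonglongrightarrow> val_infty f"

end

theory Submission
  imports Defs "HOL-Complex_Analysis.Complex_Analysis"
begin

text \<open>By Montel's theorem every subsequence of the \<open>f_k\<close> has a further subsequence converging locally
uniformly on \<open>X\<close> to some \<open>g\<close> bounded by 1, with \<open>g'(\<infinity>) = lim \<gamma>_k\<close>. By uniqueness of the Ahlfors
function (Fisher's argument) it suffices that \<open>g\<close> is extremal, that is, \<open>\<gamma> \<le> liminf \<gamma>_k\<close>.

For this, \<open>f\<close> is transplanted to \<open>X_k\<close>. The components \<open>C_k\<close> of the complement of \<open>X_k\<close> converge in the
sense of Caratheodory to the components \<open>C\<close> of the complement of \<open>X\<close>, because their number is constant.
Hence the exterior Riemann maps converge, and the conformal map from the exterior of \<open>C_k\<close> to the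
exterior of \<open>C\<close> is close to the identity on an annulus around \<open>C\<close>. Near \<open>C_k\<close> one composes \<open>f\<close> with this
map, elsewhere one keeps \<open>f\<close>; the small discrepancy on the annuli is removed by Cauchy integrals over
level curves of the Riemann map of \<open>C\<close>. The result is bounded by \<open>1 + \<epsilon>\<close> on \<open>X_k\<close> and its derivative at
\<open>\<infinity>\<close> is close to \<open>f'(\<infinity>)\<close>.\<close>

section \<open>Functions near infinity and uniqueness of the Ahlfors function\<close>

text \<open>Normal families give only one inequality, since a limit of competitors on
  \<open>Us k\<close> is a competitor on \<open>U\<close>. The other one fails for Caratheodory
  convergence alone: the exterior of a disc is the limit of domains that omit finitely many tiny
  discs becoming dense in it, with capacities tending to 0. A constant number of components excludes
  this, because each component of \<open>- U\<close> is then the limit of one single continuum, to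
  which Riemann maps apply. The obstacle to transplanting \<open>f\<close> is that
  \<open>Us k\<close> need not lie in \<open>U\<close>, so \<open>f\<close> is not defined near the
  boundary of \<open>Us k\<close>. Composing with a conformal map repairs this at one component
  only; the local repairs disagree with \<open>f\<close> and must be reconciled at a cost that tends
  to 0. The cuts are therefore made along level curves that belong to \<open>C\<close> and not to
  \<open>Cs k\<close>: the constant of the splitting is fixed before \<open>k\<close>, and only the
  error on these curves has to become small.\<close>

lemma val_infty_eq: "(g \<longlongrightarrow> c) at_infinity \<Longrightarrow> val_infty g = c"
  unfolding val_infty_def by (rule tendsto_Lim[OF trivial_limit_at_infinity])

lemma deriv_infty_eq:
  assumes "(g \<longlongrightarrow> c) at_infinity" "((\<lambda>z. z * (g z - c)) \<longlongrightarrow> d) at_infinity"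
  shows "deriv_infty g = d"
  unfolding deriv_infty_def val_infty_eq[OF assms(1)]
  using assms(2) by (rule tendsto_Lim[OF trivial_limit_at_infinity])

lemma tendsto_at_infinity_inverse:
  fixes g :: "complex \<Rightarrow> complex"
  shows "(g \<longlongrightarrow> l) at_infinity \<longleftrightarrow> ((\<lambda>w. g (1 / w)) \<longlongrightarrow> l) (at 0)"
  by (simp add: lim_at_infinity_0 comp_def field_simps)

text \<open>\<open>Lim\<close> is informative only when the limit exists. In the coordinate w = 1/z
  the function is differentiable at 0; its value and its derivative there are the two
  limits.\<close>

lemma holo_on_X_limits:
  assumes "holo_on_X U g"
  shows "(g \<longlongrightarrow> val_infty g) at_infinity"
    and "((\<lambda>z. z * (g z - val_infty g)) \<longlongrightarrow> deriv_infty g) at_infinity"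
proof -
  obtain c r where r: "r > 0" and hol: "(\<lambda>w. if w = 0 then c else g (1 / w)) holomorphic_on ball 0 r"
    using assms unfolding holo_on_X_def by blast
  define h where "h = (\<lambda>w. if w = 0 then c else g (1 / w))"
  have "h field_differentiable at 0"
    using hol r unfolding h_def[symmetric] by (simp add: holomorphic_on_imp_differentiable_at)
  then obtain d where d: "(h has_field_derivative d) (at 0)"
    unfolding field_differentiable_def by blast
  have "isCont h 0" using d DERIV_isCont by blast
  then have "(h \<longlongrightarrow> c) (at 0)" by (simp add: isCont_def h_def)
  then have "((\<lambda>w. g (1 / w)) \<longlongrightarrow> c) (at 0)"
    by (rule Lim_transform_eventually) (auto simp: h_def eventually_at_filter)
  then have 1: "(g \<longlongrightarrow> c) at_infinity" by (simp add: tendsto_at_infinity_inverse)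
  have "((\<lambda>w. (h w - h 0) / (w - 0)) \<longlongrightarrow> d) (at 0)"
    using d by (simp add: has_field_derivative_iff)
  then have "((\<lambda>w. (1/w) * (g (1 / w) - c)) \<longlongrightarrow> d) (at 0)"
    by (rule Lim_transform_eventually) (auto simp: h_def eventually_at_filter)
  then have 2: "((\<lambda>z. z * (g z - c)) \<longlongrightarrow> d) at_infinity"
    by (subst tendsto_at_infinity_inverse)
  show "(g \<longlongrightarrow> val_infty g) at_infinity" using 1 val_infty_eq by metis
  show "((\<lambda>z. z * (g z - val_infty g)) \<longlongrightarrow> deriv_infty g) at_infinity"
    using 1 2 val_infty_eq deriv_infty_eq by metis
qed

text \<open>Riemann's removable singularity theorem at infinity.\<close>

lemma holo_on_X_if_bounded:
  assumes "g holomorphic_on U" "- ball 0 R \<subseteq> U" "\<And>z. norm z > R \<Longrightarrow> norm (g z) \<le> B"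
  shows "holo_on_X U g"
proof -
  \<comment> \<open>\<open>R\<close> may have any sign, hence the absolute value and the added
    1.\<close>
  define r where "r = 1 / (\<bar>R\<bar> + 1)"
  have r: "r > 0" by (simp add: r_def)
  have big: "norm (1 / w) > R" if "w \<in> ball 0 r - {0}" for w :: complex
  proof -
    have "norm w > 0" "norm w < 1 / (\<bar>R\<bar> + 1)" using that by (auto simp: r_def)
    then have "\<bar>R\<bar> + 1 < 1 / norm w" by (simp add: field_simps)
    then show ?thesis by (simp add: norm_divide)
  qed
  have hol: "(\<lambda>w. g (1 / w)) holomorphic_on ball 0 r - {0}"
  proof -
    have "(g \<circ> (\<lambda>w. 1 / w)) holomorphic_on ball 0 r - {0}"
      by (rule holomorphic_on_compose_gen[OF _ assms(1)])
         (use big assms(2) in \<open>force intro!: holomorphic_intros\<close>)+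
    then show ?thesis by (simp add: comp_def)
  qed
  have "\<forall>\<^sub>F w in at 0. norm (g (1 / w)) \<le> B"
    unfolding eventually_at using r big assms(3) by (intro exI[of _ r]) (auto simp: dist_norm)
  then obtain h where h: "h holomorphic_on ball 0 r" "\<forall>w\<in>ball 0 r - {0}. h w = g (1 / w)"
    using holomorphic_on_extend_bounded[OF hol] r by (auto simp: interior_open)
  have "(\<lambda>w. if w = 0 then h 0 else g (1 / w)) holomorphic_on ball 0 r"
    using h(1) by (rule holomorphic_transform) (use h(2) in auto)
  then show ?thesis using r assms(1) unfolding holo_on_X_def by blast
qed

text \<open>The exterior of the circle is a disc about infinity in the coordinate w = 1/z, so a
  bound on one circle controls everything up to infinity.\<close>

lemma maximum_modulus_infinity:
  assumes hol: "g holomorphic_on U" and U: "- ball 0 R \<subseteq> U" "open U" and R: "R > 0"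
    and lim: "(g \<longlongrightarrow> l) at_infinity"
    and B: "\<And>z. norm z = R \<Longrightarrow> norm (g z) \<le> B" and z: "norm z \<ge> R"
  shows "norm (g z) \<le> B"
proof -
  define h where "h = (\<lambda>w. if w = 0 then l else g (1 / w))"
  define S where "S = cball (0::complex) (1 / R)"
  have big: "norm (1 / w) \<ge> R" if "w \<in> S" "w \<noteq> 0" for w :: complex
    using that R by (simp add: S_def norm_divide field_simps)
  have "(g \<circ> (\<lambda>w. 1 / w)) holomorphic_on ball 0 (1/R) - {0}"
    by (rule holomorphic_on_compose_gen[OF _ hol])
       (use big U in \<open>force simp: S_def intro!: holomorphic_intros\<close>)+
  then have hol1: "h holomorphic_on ball 0 (1/R) - {0}"
    by (rule holomorphic_transform) (auto simp: h_def)
  have cg: "continuous_on (S - {0}) (\<lambda>w. g (1 / w))"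
    by (rule continuous_on_compose2[OF holomorphic_on_imp_continuous_on[OF hol]])
       (use big U in \<open>force intro!: continuous_intros\<close>)+
  have h0: "isCont h 0"
  proof -
    have "((\<lambda>w. g (1 / w)) \<longlongrightarrow> l) (at 0)" using lim by (simp add: tendsto_at_infinity_inverse)
    then have "(h \<longlongrightarrow> l) (at 0)"
      by (rule Lim_transform_eventually) (auto simp: h_def eventually_at_filter)
    then show ?thesis by (simp add: isCont_def h_def)
  qed
  have cont: "continuous_on S h"
    unfolding continuous_on_eq_continuous_within
  proof
    fix w assume w: "w \<in> S"
    show "continuous (at w within S) h"
    proof (cases "w = 0")
      case True then show ?thesis using h0 continuous_at_imp_continuous_at_within by blast
    next
      case False
      have "continuous_on (S - {0}) h"
        using cg by (rule continuous_on_eq) (auto simp: h_def)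
      then have "continuous (at w within S - {0}) h"
        using w False by (simp add: continuous_on_eq_continuous_within)
      moreover have "at w within S - {0} = at w within S"
        using False by (intro at_within_nhd[where S = "- {0}"]) auto
      ultimately show ?thesis by simp
    qed
  qed
  have hol2: "h holomorphic_on ball 0 (1/R)"
    by (rule no_isolated_singularity[OF _ hol1]) (use cont in \<open>auto simp: S_def intro: continuous_on_subset\<close>)
  define w where "w = 1 / z"
  have "z \<noteq> 0" using z R by auto
  then have w: "w \<in> S" "w \<noteq> 0" "h w = g z"
    using z R by (auto simp: w_def S_def h_def norm_divide field_simps)
  have "norm (h w) \<le> B"
  proof (rule maximum_modulus_frontier[where f = h and S = S])
    show "h holomorphic_on interior S" using hol2 by (simp add: S_def)
    show "continuous_on (closure S) h" using cont by (simp add: S_def)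
    show "bounded S" by (simp add: S_def)
    show "w \<in> S" by fact
    fix x assume "x \<in> frontier S"
    then have x: "norm x = 1 / R" using R by (simp add: S_def)
    then have "norm (1 / x) = R" using R by (simp add: norm_divide)
    moreover have "h x = g (1 / x)" using x R by (auto simp: h_def)
    ultimately show "norm (h x) \<le> B" using B by simp
  qed
  then show ?thesis using w by simp
qed

lemma norm_limit_at_infinity_le:
  fixes g :: "complex \<Rightarrow> complex"
  assumes "(g \<longlongrightarrow> l) at_infinity" "\<And>z. norm z \<ge> R \<Longrightarrow> norm (g z) \<le> B"
  shows "norm l \<le> B"
  by (rule tendsto_upperbound[OF tendsto_norm[OF assms(1)]])
     (use assms(2) trivial_limit_at_infinity in \<open>auto simp: eventually_at_infinity trivial_limit_def\<close>)

text \<open>Maximum principle for \<open>z * (g z - val_infty g)\<close>, which has a finite limit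
  at infinity and norm at most \<open>R * (2 * B)\<close> on the circle.\<close>

lemma deriv_infty_bound:
  assumes g: "holo_on_X U g" and U: "- ball 0 R \<subseteq> U" "open U" and R: "R > 0"
    and B: "\<And>z. norm z = R \<Longrightarrow> norm (g z) \<le> B"
  shows "norm (deriv_infty g) \<le> 2 * R * B"
proof -
  have hol: "g holomorphic_on U" using g by (simp add: holo_on_X_def)
  note lim = holo_on_X_limits[OF g]
  have v: "norm (val_infty g) \<le> B"
    using norm_limit_at_infinity_le[OF lim(1)] maximum_modulus_infinity[OF hol U R lim(1) B] by blast
  have "norm (z * (g z - val_infty g)) \<le> 2 * R * B" if "norm z \<ge> R" for z
  proof (rule maximum_modulus_infinity[OF _ U R lim(2) _ that])
    show "(\<lambda>z. z * (g z - val_infty g)) holomorphic_on U" using hol by (intro holomorphic_intros)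
    fix z :: complex assume z: "norm z = R"
    have "norm (g z - val_infty g) \<le> 2 * B"
      using B[OF z] v norm_triangle_ineq4[of "g z" "val_infty g"] by linarith
    then show "norm (z * (g z - val_infty g)) \<le> 2 * R * B"
      using R z by (simp add: norm_mult)
  qed
  then show ?thesis using norm_limit_at_infinity_le[OF lim(2)] by blast
qed

lemma infty_domain_radius:
  assumes "infty_domain U"
  obtains R where "R > 0" "- ball 0 R \<subseteq> U"
proof -
  have "bounded (- U)" using assms by (simp add: infty_domain_def)
  then obtain R where R: "R > 0" "\<forall>x\<in>-U. norm x < R" by (auto simp: bounded_pos_less)
  then have "- ball 0 R \<subseteq> U" by force
  then show ?thesis using R that by blast
qed

section \<open>Analytic capacity and the value of the Ahlfors function at infinity\<close>

text \<open>The supremum in \<open>anal_cap\<close> is an upper bound only if the set is bounded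
  above; \<open>2 * R\<close> bounds all competitors at once.\<close>

lemma deriv_infty_le_anal_cap:
  assumes U: "infty_domain U" and g: "holo_on_X U g" and b: "\<And>z. z \<in> U \<Longrightarrow> norm (g z) \<le> 1"
  shows "norm (deriv_infty g) \<le> anal_cap U"
proof -
  obtain R where R: "R > 0" "- ball 0 R \<subseteq> U" using infty_domain_radius[OF U] .
  have op: "open U" using U by (simp add: infty_domain_def)
  have in_U: "z \<in> U" if "norm z \<ge> R" for z using that R by auto
  have "norm (val_infty g) \<le> 1"
    using norm_limit_at_infinity_le[OF holo_on_X_limits(1)[OF g]] b in_U by blast
  moreover have "bdd_above {norm (deriv_infty g) | g. holo_on_X U g \<and>
      (\<forall>z\<in>U. norm (g z) \<le> 1) \<and> norm (val_infty g) \<le> 1}"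
    using deriv_infty_bound[OF _ R(2) op R(1), where B = 1] in_U by (intro bdd_aboveI[of _ "2 * R * 1"]) auto
  ultimately show ?thesis unfolding anal_cap_def using g b by (intro cSup_upper) auto
qed

lemma deriv_infty_le_anal_cap_scaled:
  assumes U: "infty_domain U" and g: "holo_on_X U g" and M: "M > 0"
    and b: "\<And>z. z \<in> U \<Longrightarrow> norm (g z) \<le> M"
  shows "norm (deriv_infty g) \<le> M * anal_cap U"
proof -
  obtain R where R: "R > 0" "- ball 0 R \<subseteq> U" using infty_domain_radius[OF U] .
  define h where "h = (\<lambda>z. g z / of_real M)"
  have b': "norm (h z) \<le> 1" if "z \<in> U" for z using b[OF that] M by (simp add: h_def norm_divide)
  have "h holomorphic_on U" using g M by (auto simp: h_def holo_on_X_def intro!: holomorphic_intros)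
  then have "holo_on_X U h"
    by (rule holo_on_X_if_bounded[OF _ R(2), where B = 1]) (use b' subsetD[OF R(2)] in auto)
  then have "norm (deriv_infty h) \<le> anal_cap U" using deriv_infty_le_anal_cap[OF U] b' by blast
  moreover have "deriv_infty h = deriv_infty g / of_real M"
  proof (rule deriv_infty_eq)
    note lim = holo_on_X_limits[OF g]
    show "(h \<longlongrightarrow> val_infty g / of_real M) at_infinity"
      unfolding h_def using lim(1) M by (intro tendsto_intros) auto
    have "((\<lambda>z. z * (g z - val_infty g) / of_real M) \<longlongrightarrow> deriv_infty g / of_real M) at_infinity"
      using lim(2) M by (intro tendsto_intros) auto
    then show "((\<lambda>z. z * (h z - val_infty g / of_real M)) \<longlongrightarrow> deriv_infty g / of_real M) at_infinity"
      by (simp add: h_def diff_divide_distrib right_diff_distrib)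
  qed
  ultimately show ?thesis using M by (simp add: norm_divide field_simps)
qed

text \<open>Following \<open>f\<close> by the disc automorphism that moves
  \<open>a = val_infty f\<close> to 0 gives a competitor whose derivative is larger by the factor 1
  / (1 - |a|^2). With positive capacity this contradicts extremality unless a = 0.\<close>

lemma ahlfors_val_infty:
  assumes U: "infty_domain U" and f: "is_ahlfors U f" and pos: "anal_cap U > 0"
  shows "val_infty f = 0"
proof -
  obtain R where R: "R > 0" "- ball 0 R \<subseteq> U" using infty_domain_radius[OF U] .
  define a where "a = val_infty f"
  have hX: "holo_on_X U f" and lt: "\<And>z. z \<in> U \<Longrightarrow> norm (f z) < 1" and a: "norm a < 1"
    and d: "deriv_infty f = complex_of_real (anal_cap U)"
    using f by (auto simp: is_ahlfors_def a_def)
  note lim = holo_on_X_limits[OF hX, folded a_def]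
  define T where "T = (\<lambda>z. Moebius_function 0 a (f z))"
  have T: "T z = (f z - a) / (1 - cnj a * f z)" for z
    by (simp add: T_def Moebius_function_def)
  have b: "norm (T z) \<le> 1" if "z \<in> U" for z
    unfolding T_def using Moebius_function_norm_lt_1[OF a lt[OF that]] by (simp add: less_imp_le)
  have "(Moebius_function 0 a \<circ> f) holomorphic_on U"
    by (rule holomorphic_on_compose_gen[OF _ Moebius_function_holomorphic[OF a]])
       (use hX lt in \<open>auto simp: holo_on_X_def\<close>)
  then have "T holomorphic_on U" by (simp add: T_def comp_def)
  then have "holo_on_X U T" by (rule holo_on_X_if_bounded[OF _ R(2), where B = 1]) (use b subsetD[OF R(2)] in auto)
  then have le: "norm (deriv_infty T) \<le> anal_cap U" using deriv_infty_le_anal_cap[OF U] b by blast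
  have na: "1 - cnj a * a = of_real (1 - (norm a)\<^sup>2)"
    using complex_norm_square[of a] by (simp add: mult.commute)
  have pa: "(norm a)\<^sup>2 < 1" using a by (simp add: power_less_one_iff abs_square_less_1)
  then have nz: "1 - cnj a * a \<noteq> 0" unfolding na by (simp del: of_real_diff)
  have "deriv_infty T = deriv_infty f / (1 - cnj a * a)"
  proof (rule deriv_infty_eq)
    have "(T \<longlongrightarrow> (a - a) / (1 - cnj a * a)) at_infinity"
      unfolding T using lim(1) nz by (intro tendsto_intros) auto
    then show "(T \<longlongrightarrow> 0) at_infinity" by simp
    have "((\<lambda>z. z * (f z - a) / (1 - cnj a * f z)) \<longlongrightarrow> deriv_infty f / (1 - cnj a * a)) at_infinity"
      using lim nz by (intro tendsto_intros) auto
    then show "((\<lambda>z. z * (T z - 0)) \<longlongrightarrow> deriv_infty f / (1 - cnj a * a)) at_infinity"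
      by (simp add: T)
  qed
  then have "norm (deriv_infty T) = anal_cap U / (1 - (norm a)\<^sup>2)"
    unfolding na d using pos pa by (simp add: norm_divide del: of_real_diff)
  then have "anal_cap U / (1 - (norm a)\<^sup>2) \<le> anal_cap U" using le by simp
  then have "anal_cap U \<le> anal_cap U * (1 - (norm a)\<^sup>2)" using pa by (simp add: pos_divide_le_eq)
  then have "(norm a)\<^sup>2 \<le> 0" using pos by (simp add: algebra_simps mult_le_0_iff)
  then show ?thesis by (simp add: a_def)
qed

section \<open>Fisher's uniqueness argument\<close>

text \<open>With h and k the norms of the half sum and the half difference, the parallelogram law
  gives h^2 + k^2 \<le> 1, and 2 h \<le> 1 + h^2 makes the bound linear in h.\<close>

lemma Fisher_inequality:
  fixes f g :: complex
  assumes "norm f \<le> 1" "norm g \<le> 1"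
  shows "norm ((f + g) / 2) + norm (((f - g) / 2)\<^sup>2 / 2) \<le> 1"
proof -
  define h k where "h = norm ((f + g) / 2)" and "k = norm ((f - g) / 2)"
  have p: "(norm (f + g))\<^sup>2 + (norm (f - g))\<^sup>2 = 2 * (norm f)\<^sup>2 + 2 * (norm g)\<^sup>2"
    unfolding cmod_power2 by (simp add: power2_eq_square algebra_simps)
  have "(norm f)\<^sup>2 \<le> 1" "(norm g)\<^sup>2 \<le> 1" using assms by (simp_all add: power_le_one)
  moreover have "h\<^sup>2 = (norm (f + g))\<^sup>2 / 4" "k\<^sup>2 = (norm (f - g))\<^sup>2 / 4"
    by (simp_all add: h_def k_def norm_divide power_divide)
  ultimately have "h\<^sup>2 + k\<^sup>2 \<le> 1" using p by linarith
  moreover have "(1 - h)\<^sup>2 \<ge> 0" by simp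
  ultimately have "h + k\<^sup>2 / 2 \<le> 1" by (simp add: power2_eq_square algebra_simps)
  then show ?thesis by (simp add: h_def k_def norm_divide norm_power)
qed

text \<open>By the identity theorem \<open>q\<close> cannot vanish near infinity, so its zero there
  has finite order. The order is written \<open>Suc m\<close> because \<open>z ^ m * q z\<close>
  then behaves like a / z, which is exactly what changes a derivative at infinity.\<close>

lemma order_at_infinity:
  assumes q: "holo_on_X U q" and U: "infty_domain U" and v: "val_infty q = 0"
    and z0: "z0 \<in> U" "q z0 \<noteq> 0"
  obtains a m where "a \<noteq> 0" "((\<lambda>z. z ^ Suc m * q z) \<longlongrightarrow> a) at_infinity"
proof -
  obtain R where R: "R > 0" "- ball 0 R \<subseteq> U" using infty_domain_radius[OF U] .
  have op: "open U" "connected U" using U by (auto simp: infty_domain_def)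
  obtain c r where r: "r > 0" and hol: "(\<lambda>w. if w = 0 then c else q (1 / w)) holomorphic_on ball 0 r"
    using q unfolding holo_on_X_def by blast
  define h where "h = (\<lambda>w. if w = 0 then c else q (1 / w))"
  have hol: "h holomorphic_on ball 0 r" using hol by (simp add: h_def)
  have "isCont h 0"
    using hol r holomorphic_on_imp_differentiable_at
    by (metis centre_in_ball field_differentiable_imp_continuous_at open_ball)
  then have "(h \<longlongrightarrow> c) (at 0)" by (simp add: isCont_def h_def)
  then have "((\<lambda>w. q (1 / w)) \<longlongrightarrow> c) (at 0)"
    by (rule Lim_transform_eventually) (auto simp: h_def eventually_at_filter)
  then have c0: "c = 0" using v val_infty_eq by (auto simp: tendsto_at_infinity_inverse)
  have nc: "\<not> h constant_on ball 0 r"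
  proof
    assume "h constant_on ball 0 r"
    then have z: "h w = 0" if "w \<in> ball 0 r" for w
      using that c0 r unfolding constant_on_def by (metis centre_in_ball h_def)
    define S where "S = - cball (0::complex) (max R (1 / r))"
    have "q z = 0" if "z \<in> S" for z
    proof -
      have "norm z > 1 / r" using that by (auto simp: S_def)
      moreover have "1 / r > 0" using r by simp
      ultimately have "norm z > 1 / r" "z \<noteq> 0" by auto
      then have "1 / z \<in> ball 0 r" using r by (simp add: norm_divide field_simps)
      then show ?thesis using z[of "1 / z"] \<open>z \<noteq> 0\<close> by (simp add: h_def)
    qed
    moreover have "S \<subseteq> U" using R by (auto simp: S_def)
    moreover have "of_real (max R (1/r) + 1) \<in> S"
      using R by (simp add: S_def del: of_real_add)
    moreover have "open S" unfolding S_def by (intro open_Compl closed_cball)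
    ultimately have "q z0 = 0"
      using analytic_continuation_open[of S U q "\<lambda>_. 0" z0] op q z0 by (auto simp: holo_on_X_def)
    then show False using z0 by simp
  qed
  obtain L s m where m: "0 < m" "0 < s" "ball 0 s \<subseteq> ball (0::complex) r" "L holomorphic_on ball 0 s"
      "\<And>w. w \<in> ball 0 s \<Longrightarrow> h w = (w - 0) ^ m * L w" "\<And>w. w \<in> ball 0 s \<Longrightarrow> L w \<noteq> 0"
    by (rule holomorphic_factor_zero_nonconstant[OF hol _ _ _ _ nc, of 0]) (use r c0 in \<open>auto simp: h_def\<close>)
  obtain m' where m': "m = Suc m'" using m(1) by (cases m) auto
  have "isCont L 0"
    using m holomorphic_on_imp_differentiable_at
    by (metis centre_in_ball field_differentiable_imp_continuous_at open_ball)
  then have "(L \<longlongrightarrow> L 0) (at 0)" by (simp add: isCont_def)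
  then have "((\<lambda>w. (1 / w) ^ Suc m' * q (1 / w)) \<longlongrightarrow> L 0) (at 0)"
  proof (rule Lim_transform_eventually)
    show "\<forall>\<^sub>F w in at 0. L w = (1 / w) ^ Suc m' * q (1 / w)"
      unfolding eventually_at
    proof (intro exI[of _ s] conjI ballI impI m(2))
      fix w :: complex assume "w \<noteq> 0 \<and> dist w 0 < s"
      then have "w \<noteq> 0" "w \<in> ball 0 s" by auto
      then have "q (1 / w) = w ^ Suc m' * L w" using m(5)[of w] by (simp add: h_def m')
      then show "L w = (1 / w) ^ Suc m' * q (1 / w)"
        using \<open>w \<noteq> 0\<close> by (simp add: field_simps)
    qed
  qed
  then have "((\<lambda>z. z ^ Suc m' * q z) \<longlongrightarrow> L 0) at_infinity"
    by (subst tendsto_at_infinity_inverse)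
  moreover have "L 0 \<noteq> 0" using m by auto
  ultimately show ?thesis using that by blast
qed

text \<open>The mean \<open>h\<close> of two extremal functions is again extremal, so a
  contradiction arises as soon as it can be improved.\<close>

theorem ahlfors_unique:
  assumes U: "infty_domain U" and f: "holo_on_X U f" and g: "holo_on_X U g"
    and fb: "\<And>z. z \<in> U \<Longrightarrow> norm (f z) \<le> 1" and gb: "\<And>z. z \<in> U \<Longrightarrow> norm (g z) \<le> 1"
    and v: "val_infty f = 0" "val_infty g = 0"
    and d: "deriv_infty f = of_real (anal_cap U)" "deriv_infty g = of_real (anal_cap U)"
    and z0: "z0 \<in> U"
  shows "f z0 = g z0"
proof (rule ccontr)
  assume ne: "f z0 \<noteq> g z0"
  obtain R where R: "R > 0" "- ball 0 R \<subseteq> U" using infty_domain_radius[OF U] .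
  have op: "open U" using U by (auto simp: infty_domain_def)
  have holf: "f holomorphic_on U" and holg: "g holomorphic_on U" using f g by (auto simp: holo_on_X_def)
  note limf = holo_on_X_limits[OF f, unfolded v d] and limg = holo_on_X_limits[OF g, unfolded v d]
  define q where "q = (\<lambda>z. ((f z - g z) / 2)\<^sup>2 / 2)"
  define h where "h = (\<lambda>z. (f z + g z) / 2)"
  have holq: "q holomorphic_on U" and holh: "h holomorphic_on U"
    unfolding q_def h_def using holf holg by (auto intro!: holomorphic_intros)
  have F: "norm (h z) + norm (q z) \<le> 1" if "z \<in> U" for z
    unfolding h_def q_def using Fisher_inequality[OF fb gb] that by blast
  have qb: "norm (q z) \<le> 1" if "z \<in> U" for z using F[OF that] norm_ge_zero[of "h z"] by linarith
  have qX: "holo_on_X U q" by (rule holo_on_X_if_bounded[OF holq R(2), where B = 1]) (use qb subsetD[OF R(2)] in auto)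
  have "(q \<longlongrightarrow> ((0 - 0) / 2)\<^sup>2 / 2) at_infinity"
    unfolding q_def using limf(1) limg(1) by (intro tendsto_intros) auto
  then have q0: "(q \<longlongrightarrow> 0) at_infinity" by simp
  have "q z0 \<noteq> 0" using ne by (simp add: q_def)
  then obtain a m where a: "a \<noteq> 0" "((\<lambda>z. z ^ Suc m * q z) \<longlongrightarrow> a) at_infinity"
    using order_at_infinity[OF qX U val_infty_eq[OF q0] z0] by blast
  \<comment> \<open>The slack \<open>1 - norm (h z) \<ge> norm (q z)\<close> permits adding a multiple of \<open>z ^ m * q z\<close>, which
     raises the derivative at \<open>\<infinity>\<close>.\<close>
  define e where "e = 1 / (norm a * R ^ m)"
  have e: "e > 0" using a R by (simp add: e_def)
  \<comment> \<open>The factor \<open>cnj a\<close> makes the added derivative the positive number e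
    * |a|^2; the value of \<open>e\<close> keeps the multiplier of \<open>q z\<close> at norm at
    most 1 where \<open>norm z \<le> R\<close>.\<close>
  define h1 where "h1 = (\<lambda>z. h z + of_real e * cnj a * z ^ m * q z)"
  have hol1: "h1 holomorphic_on U" unfolding h1_def using holh holq by (intro holomorphic_intros)
  have b1: "norm (h1 z) \<le> 1" if "z \<in> U" "norm z \<le> R" for z
  proof -
    have "norm (of_real e * cnj a * z ^ m) = e * norm a * norm z ^ m"
      using e by (simp add: norm_mult norm_power)
    also have "\<dots> \<le> e * norm a * R ^ m"
      using e that by (intro mult_left_mono power_mono) auto
    also have "\<dots> = 1" using a R by (simp add: e_def)
    finally have "norm (of_real e * cnj a * z ^ m * q z) \<le> 1 * norm (q z)"
      unfolding norm_mult[of _ "q z"] by (intro mult_right_mono) auto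
    then show ?thesis unfolding h1_def using F[OF that(1)]
        norm_triangle_ineq[of "h z" "of_real e * cnj a * z ^ m * q z"] by linarith
  qed
  have lim1: "((\<lambda>z. z * (h1 z - 0)) \<longlongrightarrow> of_real (anal_cap U) + of_real e * cnj a * a) at_infinity"
  proof -
    have "((\<lambda>z. (z * (f z - 0) + z * (g z - 0)) / 2 + of_real e * cnj a * (z ^ Suc m * q z))
       \<longlongrightarrow> (of_real (anal_cap U) + of_real (anal_cap U)) / 2 + of_real e * cnj a * a) at_infinity"
      using limf(2) limg(2) a(2) by (intro tendsto_intros) auto
    then show ?thesis by (simp add: h1_def h_def field_simps)
  qed
  have inv0: "((\<lambda>z::complex. 1 / z) \<longlongrightarrow> 0) at_infinity"
    using tendsto_inverse_0[where 'a = complex] unfolding inverse_eq_divide .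
  have "((\<lambda>z. (1 / z) * (z * (h1 z - 0))) \<longlongrightarrow> 0 * (of_real (anal_cap U) + of_real e * cnj a * a)) at_infinity"
    by (rule tendsto_mult[OF inv0 lim1])
  then have "((\<lambda>z. (1 / z) * (z * (h1 z - 0))) \<longlongrightarrow> 0) at_infinity" by simp
  then have lim0: "(h1 \<longlongrightarrow> 0) at_infinity"
  proof (rule Lim_transform_eventually)
    show "\<forall>\<^sub>F z in at_infinity. (1 / z) * (z * (h1 z - 0)) = h1 z"
      unfolding eventually_at_infinity by (intro exI[of _ 1]) auto
  qed
  \<comment> \<open>\<open>z ^ m\<close> may grow, so the slack need not cover large z; there the
    bound is carried over from the circle of radius \<open>R\<close>, as \<open>h1\<close> tends to
    0.\<close>
  have b2: "norm (h1 z) \<le> 1" if "z \<in> U" for z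
  proof (cases "norm z \<le> R")
    case False
    show ?thesis
      by (rule maximum_modulus_infinity[OF hol1 R(2) op R(1) lim0])
         (use False b1 R in auto)
  qed (use b1 that in auto)
  have "holo_on_X U h1" by (rule holo_on_X_if_bounded[OF hol1 R(2), where B = 1]) (use b2 subsetD[OF R(2)] in auto)
  then have "norm (deriv_infty h1) \<le> anal_cap U" using deriv_infty_le_anal_cap[OF U] b2 by blast
  moreover have "deriv_infty h1 = of_real (anal_cap U + e * (norm a)\<^sup>2)"
    unfolding deriv_infty_eq[OF lim0 lim1] using complex_norm_square[of a]
    by (simp add: mult.commute mult.left_commute)
  ultimately have "\<bar>anal_cap U + e * (norm a)\<^sup>2\<bar> \<le> anal_cap U"
    by (simp only: norm_of_real)
  moreover have "e * (norm a)\<^sup>2 > 0" using e a by simp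
  ultimately show False by linarith
qed

section \<open>Montel's theorem for varying domains\<close>

lemma tendsto_subseq_uniform_limit:
  assumes "uniform_limit K f g sequentially" "strict_mono (r :: nat \<Rightarrow> nat)"
  shows "uniform_limit K (f \<circ> r) g sequentially"
  using filterlim_compose[OF assms(1) filterlim_subseq[OF assms(2)]] by (simp add: comp_def)

lemma eventually_subseq_sequentially:
  assumes "eventually P sequentially" "strict_mono (r :: nat \<Rightarrow> nat)"
  shows "\<forall>\<^sub>F k in sequentially. P (r k)"
  using eventually_compose_filterlim[OF assms(1) filterlim_subseq[OF assms(2)]] .

lemma frequently_subseq:
  assumes "\<exists>\<^sub>F k in sequentially. P k"
  obtains r :: "nat \<Rightarrow> nat" where "strict_mono r" "\<And>k. P (r k)"
proof -
  have "infinite {k. P k}"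
    using assms by (simp add: frequently_cofinite flip: cofinite_eq_sequentially)
  then obtain r :: "nat \<Rightarrow> nat" where "strict_mono r" "\<forall>k. r k \<in> {k. P k}"
    using infinite_enumerate by blast
  then show ?thesis using that by auto
qed

text \<open>The domains vary, but each compact subset of \<open>S\<close> lies in all but finitely
  many. Montel's theorem applies on each member of an exhaustion after dropping finitely many
  functions; a diagonal sequence serves all members.\<close>

theorem Montel_exhausting:
  assumes S: "open S"
    and Sk: "\<And>K. compact K \<Longrightarrow> K \<subseteq> S \<Longrightarrow> \<forall>\<^sub>F k in sequentially. K \<subseteq> T k"
    and hol: "\<And>k. F k holomorphic_on T k"
    and bd: "\<And>k z. z \<in> T k \<Longrightarrow> norm (F k z) \<le> B"
  obtains g r where "g holomorphic_on S" "strict_mono (r :: nat \<Rightarrow> nat)"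
    "\<And>K. compact K \<Longrightarrow> K \<subseteq> S \<Longrightarrow> uniform_limit K (F \<circ> r) g sequentially"
proof -
  obtain C where C: "\<And>n. compact (C n)" "\<And>n::nat. C n \<subseteq> S" "\<And>n. C n \<subseteq> interior (C (Suc n))"
      "\<Union>(range C) = S" "\<And>K. compact K \<Longrightarrow> K \<subseteq> S \<Longrightarrow> \<exists>N. \<forall>n\<ge>N. K \<subseteq> C n"
    using open_Union_compact_subsets[OF S] by metis
  define P where "P = (\<lambda>i (q :: nat \<Rightarrow> nat). \<exists>g. uniform_limit (C i) (F \<circ> q) g sequentially)"
  have sub_top: "\<exists>k. strict_mono (k :: nat \<Rightarrow> nat) \<and> P i (q \<circ> k)" if q: "filterlim q sequentially sequentially" for i q
  proof -
    have "\<forall>\<^sub>F k in sequentially. C (Suc i) \<subseteq> T (q k)"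
      using Sk[OF C(1) C(2)] q by (rule eventually_compose_filterlim)
    then obtain N where N: "\<And>k. k \<ge> N \<Longrightarrow> C (Suc i) \<subseteq> T (q k)"
      unfolding eventually_sequentially by blast
    define G where "G = (\<lambda>k. F (q (k + N)))"
    have inT: "interior (C (Suc i)) \<subseteq> T (q (k + N))" for k
      using N[of "k + N"] interior_subset by fastforce
    obtain g r where gr: "g holomorphic_on interior (C (Suc i))" "strict_mono (r :: nat \<Rightarrow> nat)"
        "\<And>K. compact K \<Longrightarrow> K \<subseteq> interior (C (Suc i)) \<Longrightarrow> uniform_limit K (G \<circ> r) g sequentially"
    proof (rule Montel[of "interior (C (Suc i))" "range G" G])
      show "h holomorphic_on interior (C (Suc i))" if "h \<in> range G" for h
        using that hol inT unfolding G_def by (auto intro: holomorphic_on_subset)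
      show "\<exists>B. \<forall>h\<in>range G. \<forall>z\<in>K. norm (h z) \<le> B" if "K \<subseteq> interior (C (Suc i))" for K
        using bd inT that unfolding G_def by blast
    qed auto
    have "uniform_limit (C i) (G \<circ> r) g sequentially" by (rule gr(3)[OF C(1) C(3)])
    moreover have "F \<circ> (q \<circ> (\<lambda>k. r k + N)) = G \<circ> r" by (auto simp: G_def)
    moreover have "strict_mono (\<lambda>k. r k + N)" using gr(2) by (simp add: strict_mono_def)
    ultimately show ?thesis unfolding P_def by metis
  qed
  \<comment> \<open>Diagonalization asks for a subsequence of an arbitrary index sequence
    \<open>q\<close>. If \<open>q\<close> does not tend to infinity, it takes some value infinitely
    often, and the constant subsequence converges.\<close>
  have sub: "\<exists>k. strict_mono (k :: nat \<Rightarrow> nat) \<and> P i (q \<circ> k)" for i q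
  proof (cases "filterlim q sequentially sequentially")
    case False
    then obtain N where "\<exists>\<^sub>F k in sequentially. q k < N"
      by (auto simp: filterlim_at_top frequently_def not_less)
    then have "\<exists>\<^sub>F k in sequentially. \<exists>v\<in>{..<N}. q k = v" by simp
    then obtain v where "\<exists>\<^sub>F k in sequentially. q k = v"
      by (subst (asm) frequently_bex_finite_distrib) auto
    then obtain k where k: "strict_mono (k :: nat \<Rightarrow> nat)" "\<And>j. q (k j) = v"
      using frequently_subseq by blast
    have "F \<circ> (q \<circ> k) = (\<lambda>_. F v)" using k by auto
    then have "uniform_limit (C i) (F \<circ> (q \<circ> k)) (F v) sequentially"
      by (simp add: uniform_limit_const)
    then show ?thesis using k(1) unfolding P_def by blast
  qed (use sub_top in auto)
  obtain k where "strict_mono (k :: nat \<Rightarrow> nat)" "\<And>i. P i (id \<circ> k)"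
  proof (rule subsequence_diagonalization_lemma[of P id, OF sub])
    fix i and q k1 k2 :: "nat \<Rightarrow> nat" and N
    assume "P i (q \<circ> k1)" and tail: "\<And>j. N \<le> j \<Longrightarrow> \<exists>j'. j \<le> j' \<and> k2 j = k1 j'"
    then obtain g where g: "uniform_limit (C i) (F \<circ> (q \<circ> k1)) g sequentially"
      unfolding P_def by blast
    have "uniform_limit (C i) (F \<circ> (q \<circ> k2)) g sequentially"
      unfolding uniform_limit_iff
    proof (intro allI impI)
      fix e :: real assume "e > 0"
      then obtain M where M: "\<And>j. j \<ge> M \<Longrightarrow> \<forall>x\<in>C i. dist ((F \<circ> (q \<circ> k1)) j x) (g x) < e"
        using g unfolding uniform_limit_iff eventually_sequentially by blast
      show "\<forall>\<^sub>F j in sequentially. \<forall>x\<in>C i. dist ((F \<circ> (q \<circ> k2)) j x) (g x) < e"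
        unfolding eventually_sequentially
      proof (intro exI[of _ "max M N"] allI impI)
        fix j assume "max M N \<le> j"
        then obtain j' where "j' \<ge> M" "k2 j = k1 j'" using tail[of j] by (metis max.bounded_iff order_trans)
        then show "\<forall>x\<in>C i. dist ((F \<circ> (q \<circ> k2)) j x) (g x) < e" using M[of j'] by simp
      qed
    qed
    then show "P i (q \<circ> k2)" unfolding P_def by blast
  qed (use that in blast)
  then have k: "strict_mono k" "\<And>i. \<exists>g. uniform_limit (C i) (F \<circ> k) g sequentially"
    by (auto simp: P_def)
  \<comment> \<open>One function for all \<open>C i\<close>: the limits found on the single sets are
    its restrictions.\<close>
  define g where "g = (\<lambda>z. lim (\<lambda>n. F (k n) z))"
  have ulC: "uniform_limit (C i) (F \<circ> k) g sequentially" for i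
  proof -
    obtain h where h: "uniform_limit (C i) (F \<circ> k) h sequentially" using k(2) by blast
    have "h z = g z" if "z \<in> C i" for z
      using tendsto_uniform_limitI[OF h that] unfolding g_def by (simp add: limI comp_def)
    then show ?thesis using h uniform_limit_cong'[of "C i" "F \<circ> k" "F \<circ> k" h g] by auto
  qed
  have ul: "uniform_limit K (F \<circ> k) g sequentially" if K: "compact K" "K \<subseteq> S" for K
    using C(5)[OF K] ulC uniform_limit_on_subset by blast
  have "g holomorphic_on interior (C i)" for i
  proof -
    have "\<forall>\<^sub>F j in sequentially. C i \<subseteq> T (k j)"
      by (rule eventually_subseq_sequentially[OF Sk[OF C(1) C(2)] k(1)])
    then obtain N where N: "\<And>j. j \<ge> N \<Longrightarrow> C i \<subseteq> T (k j)"
      unfolding eventually_sequentially by blast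
    show ?thesis
    proof (rule holomorphic_uniform_sequence[of _ "\<lambda>j. F (k (j + N))"])
      show "F (k (j + N)) holomorphic_on interior (C i)" for j
        using N[of "j + N"] interior_subset hol by (meson holomorphic_on_subset le_add2 subset_trans)
      fix x assume "x \<in> interior (C i)"
      then obtain d where d: "d > 0" "cball x d \<subseteq> interior (C i)"
        by (meson open_contains_cball open_interior)
      have "uniform_limit (cball x d) ((F \<circ> k) \<circ> (\<lambda>j. j + N)) g sequentially"
        by (rule tendsto_subseq_uniform_limit[OF uniform_limit_on_subset[OF ulC[of i]]])
           (use d interior_subset in \<open>auto simp: strict_mono_def\<close>)
      then show "\<exists>d>0. cball x d \<subseteq> interior (C i) \<and>
          uniform_limit (cball x d) (\<lambda>j. F (k (j + N))) g sequentially"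
        using d by (auto simp: comp_def)
    qed auto
  qed
  then have "g holomorphic_on (\<Union>i. interior (C i))"
    by (intro holomorphic_on_UN_open) auto
  moreover have "S \<subseteq> (\<Union>i. interior (C i))" using C(3,4) by blast
  ultimately have "g holomorphic_on S" by (rule holomorphic_on_subset)
  then show ?thesis using that k(1) ul by blast
qed

section \<open>Exterior Riemann maps\<close>

text \<open>The two connectedness conditions together make the exterior in the sphere a simply
  connected domain. Single points are excluded because their exterior is conformally a plane and has
  no Riemann map onto the disc.\<close>

definition full_continuum :: "complex set \<Rightarrow> bool" where
  "full_continuum C \<longleftrightarrow> compact C \<and> connected C \<and> connected (- C) \<and> C \<noteq> {} \<and> (\<forall>a. C \<noteq> {a})"

text \<open>\<open>F\<close> is the Riemann map from the exterior of \<open>C\<close> onto the disc with \<open>F(\<infinity>) = 0\<close>. Its inverse is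
\<open>w \<mapsto> H w / w\<close>; the factor \<open>w\<close> removes the pole, so that normal families arguments for the inverse
can be carried out on the whole disc.\<close>

definition exterior_map :: "complex set \<Rightarrow> (complex \<Rightarrow> complex) \<Rightarrow> (complex \<Rightarrow> complex) \<Rightarrow> bool" where
  "exterior_map C F H \<longleftrightarrow>
     F holomorphic_on - C \<and> H holomorphic_on ball 0 1 \<and>
     (\<forall>z\<in>- C. F z \<noteq> 0 \<and> norm (F z) < 1 \<and> H (F z) = z * F z) \<and>
     (\<forall>w. w \<noteq> 0 \<longrightarrow> norm w < 1 \<longrightarrow> H w / w \<in> - C \<and> F (H w / w) = w) \<and>
     (\<exists>c>0. H 0 = complex_of_real c)"

text \<open>\<open>S\<close> is the exterior of \<open>C\<close> in the coordinate w = 1 / (z - a).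
  Centring at a point of \<open>C\<close> brings the whole exterior into the finite plane, with
  infinity at 0.\<close>

lemma simply_connected_inversion_compl:
  assumes C: "full_continuum C" and a: "a \<in> C"
  defines "S \<equiv> {w. w \<noteq> 0 \<longrightarrow> a + 1 / w \<in> - C}"
  shows "open S" "simply_connected S" "S \<noteq> UNIV"
proof -
  have C': "compact C" "connected C" "connected (- C)" "\<And>a. C \<noteq> {a}"
    using C by (auto simp: full_continuum_def)
  have opC: "open (- C)" using C'(1) by (simp add: compact_imp_closed open_Compl)
  obtain R where R: "R > 0" "\<And>x. x \<in> C \<Longrightarrow> norm (x - a) < R"
  proof -
    have "bounded C" using C'(1) compact_imp_bounded by blast
    then obtain B where B: "B > 0" "\<forall>x\<in>C. norm x \<le> B" using bounded_pos by blast
    have "norm (x - a) < B + B + 1" if "x \<in> C" for x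
    proof -
      have "norm x \<le> B" "norm a \<le> B" using B that a by auto
      then show ?thesis using norm_triangle_ineq4[of x a] by linarith
    qed
    then show ?thesis using that[of "B + B + 1"] B(1) by auto
  qed
  have bS: "ball 0 (1 / R) \<subseteq> S"
  proof
    fix w :: complex assume w: "w \<in> ball 0 (1 / R)"
    show "w \<in> S"
    proof (cases "w = 0")
      case False
      then have "norm ((a + 1 / w) - a) > R" using w R by (simp add: norm_divide field_simps)
      then show ?thesis using R(2)[of "a + 1 / w"] by (auto simp: S_def)
    qed (auto simp: S_def)
  qed
  have S_eq: "S - {0} = (\<lambda>w. a + 1 / w) -` (- C) \<inter> - {0}" by (auto simp: S_def)
  have op0: "open (S - {0})"
    unfolding S_eq Int_commute[of "_ -` _"]
    by (rule continuous_open_preimage[OF _ _ opC]) (auto intro!: continuous_intros)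
  have "S = (S - {0}) \<union> ball 0 (1 / R)" using bS R(1) by auto
  then show opS: "open S" using op0 by (metis open_Un open_ball)
  have im: "S - {0} = (\<lambda>z. 1 / (z - a)) ` (- C)"
  proof (intro set_eqI iffI)
    fix w assume "w \<in> S - {0}"
    then have "a + 1 / w \<in> - C" "w = 1 / ((a + 1 / w) - a)" by (auto simp: S_def)
    then show "w \<in> (\<lambda>z. 1 / (z - a)) ` (- C)" by blast
  qed (use a in \<open>auto simp: S_def\<close>)
  have "connected (S - {0})"
    unfolding im by (rule connected_continuous_image[OF _ C'(3)]) (use a in \<open>auto intro!: continuous_intros\<close>)
  moreover have "S \<subseteq> closure (S - {0})"
  proof -
    have "0 islimpt S" using interior_limit_point[of 0 S] opS by (simp add: interior_open S_def)
    then have "0 \<in> closure (S - {0})" by (simp add: islimpt_in_closure)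
    then show ?thesis using closure_subset[of "S - {0}"] by auto
  qed
  ultimately have conS: "connected S"
    using connected_intermediate_closure[of "S - {0}" S] by auto
  \<comment> \<open>By the Sura-Bura theorem a bounded component would lie in a compact, relatively
    open subset \<open>L\<close> of \<open>- S\<close>. Back in the z-plane \<open>L\<close> becomes
    a clopen subset of the connected \<open>C\<close> that misses \<open>a\<close>, hence is
    empty.\<close>
  have "\<not> bounded K" if K: "K \<in> components (- S)" for K
  proof
    assume "bounded K"
    have clT: "closed (- S)" using opS by (simp add: closed_Compl)
    then have "compact K" using K \<open>bounded K\<close> closed_components compact_eq_bounded_closed by blast
    moreover have "locally compact (- S)" using clT closed_imp_locally_compact by blast
    ultimately obtain L where L: "openin (top_of_set (- S)) L" "compact L" "K \<subseteq> L"
      using Sura_Bura_clopen_subset[OF _ K, of UNIV] by auto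
    have LS: "L \<subseteq> - S" using L(1) openin_imp_subset by blast
    obtain V where V: "open V" "L = - S \<inter> V" using L(1) by (auto simp: openin_open)
    define D where "D = (\<lambda>w. a + 1 / w) ` L"
    have L0: "w \<noteq> 0" "a + 1 / w \<in> C" if "w \<in> L" for w using that LS by (auto simp: S_def)
    have "compact D" unfolding D_def
      by (rule compact_continuous_image[OF _ L(2)]) (use L0 in \<open>auto intro!: continuous_intros\<close>)
    have "D \<subseteq> C" using L0 by (auto simp: D_def)
    have D_eq: "D = C \<inter> ((\<lambda>z. 1 / (z - a)) -` V \<inter> - {a})"
    proof (intro set_eqI iffI)
      fix z assume "z \<in> D"
      then obtain w where w: "w \<in> L" "z = a + 1 / w" unfolding D_def by blast
      then have "z \<in> C" "z \<noteq> a" "1 / (z - a) = w" "w \<in> V" using L0[OF w(1)] V(2) by auto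
      then show "z \<in> C \<inter> ((\<lambda>z. 1 / (z - a)) -` V \<inter> - {a})" by simp
    next
      fix z assume z: "z \<in> C \<inter> ((\<lambda>z. 1 / (z - a)) -` V \<inter> - {a})"
      define w where "w = 1 / (z - a)"
      have "w \<noteq> 0" "z = a + 1 / w" using z by (auto simp: w_def)
      moreover have "w \<in> V" using z by (simp add: w_def)
      moreover have "w \<notin> S" using \<open>w \<noteq> 0\<close> z unfolding S_def \<open>z = a + 1 / w\<close> by simp
      ultimately have "w \<in> L" "z = a + 1 / w" unfolding V(2) by auto
      then show "z \<in> D" unfolding D_def by blast
    qed
    have "open ((\<lambda>z. 1 / (z - a)) -` V \<inter> - {a})"
      unfolding Int_commute[of "_ -` _"]
      by (rule continuous_open_preimage[OF _ _ V(1)]) (auto intro!: continuous_intros)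
    then have "openin (top_of_set C) D" unfolding D_eq by (simp add: openin_open_Int)
    moreover have "closedin (top_of_set C) D"
      using \<open>compact D\<close> \<open>D \<subseteq> C\<close> by (simp add: closed_subset compact_imp_closed)
    ultimately have "D = {} \<or> D = C" using C'(2) connected_clopen by blast
    moreover have "a \<notin> D" using D_eq by auto
    ultimately have "L = {}" using a by (auto simp: D_def)
    then show False using L(3) K in_components_nonempty by blast
  qed
  then show "simply_connected S"
    using simply_connected_eq_unbounded_complement_components[OF opS] conS by blast
  obtain b where b: "b \<in> C" "b \<noteq> a" using a C'(4) by blast
  then have "1 / (b - a) \<notin> S" by (simp add: S_def)
  then show "S \<noteq> UNIV" by blast
qed

text \<open>The Riemann map of the inverted domain is corrected by a disc automorphism, so that
  infinity goes to 0, and by a rotation, so that \<open>H 0\<close> is positive. This normalisation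
  determines the map, which later identifies limits.\<close>

theorem exterior_map_exists:
  assumes C: "full_continuum C"
  obtains F H where "exterior_map C F H"
proof -
  obtain a where a: "a \<in> C" using C by (auto simp: full_continuum_def)
  define S where "S = {w. w \<noteq> 0 \<longrightarrow> a + 1 / w \<in> - C}"
  note S = simply_connected_inversion_compl[OF C a, folded S_def]
  have S0: "0 \<in> S" by (simp add: S_def)
  obtain p q where pq: "p holomorphic_on S" "q holomorphic_on ball 0 1"
     "\<And>z. z \<in> S \<Longrightarrow> p z \<in> ball 0 1" "\<And>z. z \<in> S \<Longrightarrow> q (p z) = z"
     "\<And>z. z \<in> ball 0 1 \<Longrightarrow> q z \<in> S" "\<And>z. z \<in> ball 0 1 \<Longrightarrow> p (q z) = z"
  proof -
    have "S = {} \<or> S = UNIV \<or> (\<exists>f g. f holomorphic_on S \<and> g holomorphic_on ball 0 1 \<and>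
        (\<forall>z \<in> S. f z \<in> ball 0 1 \<and> g (f z) = z) \<and> (\<forall>z \<in> ball 0 1. g z \<in> S \<and> f (g z) = z))"
      using Riemann_mapping_theorem[of S] S(1,2) by blast
    then show ?thesis using that S(3) S0 by blast
  qed
  obtain f g where fg: "f (p 0) = 0" "f holomorphic_on ball 0 1" "f ` ball 0 1 \<subseteq> ball 0 1"
      "g holomorphic_on ball 0 1" "g ` ball 0 1 \<subseteq> ball 0 1"
      "\<And>z. z \<in> ball 0 1 \<Longrightarrow> f (g z) = z" "\<And>z. z \<in> ball 0 1 \<Longrightarrow> g (f z) = z"
    using ball_biholomorphism_exists[OF pq(3)[OF S0]] by blast
  have hol1: "(\<lambda>w. q (g w)) holomorphic_on ball 0 1"
    using holomorphic_on_compose_gen[OF fg(4) pq(2)] fg(5) by (auto simp: comp_def)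
  have inj1: "inj_on (\<lambda>w. q (g w)) (ball 0 1)"
    by (rule inj_on_inverseI[where g = "\<lambda>z. f (p z)"]) (use fg pq in \<open>auto simp: image_subset_iff\<close>)
  have g0: "g 0 = p 0" using fg(1,7) pq(3)[OF S0] by metis
  have "deriv (\<lambda>w. q (g w)) 0 \<noteq> 0"
    by (rule holomorphic_injective_imp_regular[OF hol1 open_ball inj1]) auto
  \<comment> \<open>The rotation that turns the derivative at 0 into its absolute value.\<close>
  define u where "u = cnj (deriv (\<lambda>w. q (g w)) 0) / norm (deriv (\<lambda>w. q (g w)) 0)"
  have u: "norm u = 1" using \<open>deriv (\<lambda>w. q (g w)) 0 \<noteq> 0\<close> by (simp add: u_def norm_divide)
  then have u0: "u \<noteq> 0" by auto
  define Q where "Q = (\<lambda>w. q (g (u * w)))"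
  define P where "P = (\<lambda>z. f (p z) / u)"
  have ball_u: "u * w \<in> ball 0 1 \<longleftrightarrow> w \<in> ball 0 1" for w using u by (simp add: norm_mult)
  have holQ: "Q holomorphic_on ball 0 1"
    unfolding Q_def
    using holomorphic_on_compose_gen[of "\<lambda>w. u * w" "ball 0 1" "\<lambda>w. q (g w)" "ball 0 1"] hol1 u
    by (auto simp: comp_def norm_mult image_subset_iff intro!: holomorphic_intros)
  have holP: "P holomorphic_on S"
    unfolding P_def using holomorphic_on_compose_gen[OF pq(1) fg(2)] pq(3) u0
    by (intro holomorphic_intros) (auto simp: comp_def image_subset_iff)
  have PS: "P z \<in> ball 0 1" if "z \<in> S" for z
    using fg(3) pq(3)[OF that] u by (auto simp: P_def norm_divide image_subset_iff)
  have QP: "Q (P z) = z" if "z \<in> S" for z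
    using fg(7)[OF pq(3)[OF that]] pq(4)[OF that] u0 by (simp add: Q_def P_def)
  have QS: "Q w \<in> S" if "w \<in> ball 0 1" for w
    using fg(5) pq(5) that ball_u[of w] by (auto simp: Q_def image_subset_iff)
  have PQ: "P (Q w) = w" if "w \<in> ball 0 1" for w
    using fg(5,6) pq(6) that ball_u[of w] u0 by (auto simp: Q_def P_def image_subset_iff)
  have Q0: "Q 0 = 0" using g0 pq(4)[OF S0] by (simp add: Q_def)
  have Qnz: "Q w \<noteq> 0" if "w \<in> ball 0 1" "w \<noteq> 0" for w
    using PQ[OF that(1)] PQ[of 0] Q0 that by auto
  have "deriv Q 0 = u * deriv (\<lambda>w. q (g w)) 0"
  proof -
    have "((\<lambda>w. q (g w)) has_field_derivative deriv (\<lambda>w. q (g w)) 0) (at (u * 0))"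
      using hol1 by (simp add: holomorphic_derivI)
    from DERIV_chain2[where g = "\<lambda>w. u * w" and x = 0 and Db = u and s = UNIV, OF this] have "(Q has_field_derivative deriv (\<lambda>w. q (g w)) 0 * u) (at 0)"
      unfolding Q_def using DERIV_cmult_Id[of u] by blast
    then show ?thesis by (simp add: DERIV_imp_deriv mult.commute)
  qed
  define d where "d = norm (deriv (\<lambda>w. q (g w)) 0)"
  have d: "d > 0" using \<open>deriv (\<lambda>w. q (g w)) 0 \<noteq> 0\<close> by (simp add: d_def)
  have dQ: "deriv Q 0 = of_real d"
    unfolding \<open>deriv Q 0 = _\<close> u_def d_def
    using complex_norm_square[of "deriv (\<lambda>w. q (g w)) 0"] d unfolding d_def
    by (simp add: power2_eq_square field_simps)
  define h where "h = (\<lambda>w. if w = 0 then deriv Q 0 else (Q w - Q 0) / (w - 0))"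
  have holh: "h holomorphic_on ball 0 1" unfolding h_def by (rule pole_lemma_open[OF holQ open_ball])
  have hnz: "h w \<noteq> 0" if "w \<in> ball 0 1" for w
    using Qnz[OF that] d Q0 dQ by (auto simp: h_def)
  \<comment> \<open>As \<open>Q w = w * h w\<close>, the inverse map \<open>a + 1 / Q w\<close>
    equals \<open>H w / w\<close>, and \<open>H\<close> is free of the pole.\<close>
  define H where "H = (\<lambda>w. a * w + 1 / h w)"
  have H_eq: "H w / w = a + 1 / Q w" if "w \<in> ball 0 1" "w \<noteq> 0" for w
    using that Q0 Qnz[OF that] by (simp add: H_def h_def field_simps)
  define F where "F = (\<lambda>z. P (1 / (z - a)))"
  have inS: "1 / (z - a) \<in> S" if "z \<in> - C" for z using that by (auto simp: S_def)
  have Fnz: "F z \<noteq> 0" if "z \<in> - C" for z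
  proof
    assume "F z = 0"
    then have "1 / (z - a) = 0" using QP[OF inS[OF that]] Q0 by (simp add: F_def)
    then show False using that a by auto
  qed
  have "exterior_map C F H"
    unfolding exterior_map_def
  proof (intro conjI ballI allI impI)
    have "(P \<circ> (\<lambda>z. 1 / (z - a))) holomorphic_on - C"
      by (rule holomorphic_on_compose_gen[OF _ holP]) (use a inS in \<open>auto intro!: holomorphic_intros\<close>)
    then show "F holomorphic_on - C" by (simp add: F_def comp_def)
    show "H holomorphic_on ball 0 1" unfolding H_def
      using holh hnz by (intro holomorphic_intros) auto
    show "F z \<noteq> 0" if "z \<in> - C" for z using Fnz[OF that] .
    show "norm (F z) < 1" if "z \<in> - C" for z using PS[OF inS[OF that]] by (simp add: F_def)
    show "H (F z) = z * F z" if "z \<in> - C" for z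
    proof -
      have "F z \<in> ball 0 1" using PS[OF inS[OF that]] by (simp add: F_def)
      then have "H (F z) / F z = a + 1 / (1 / (z - a))"
        using H_eq[of "F z"] Fnz[OF that] QP[OF inS[OF that]] by (simp add: F_def)
      then show ?thesis using Fnz[OF that] by (simp add: field_simps)
    qed
    show "H w / w \<in> - C" if "w \<noteq> 0" "norm w < 1" for w
      using H_eq[of w] QS[of w] Qnz[of w] that by (auto simp: S_def)
    show "F (H w / w) = w" if "w \<noteq> 0" "norm w < 1" for w
      using H_eq[of w] PQ[of w] Qnz[of w] that by (auto simp: F_def)
    show "\<exists>c>0. H 0 = complex_of_real c"
      using d dQ by (intro exI[of _ "1 / d"]) (auto simp: H_def h_def)
  qed
  then show ?thesis using that by blast
qed

text \<open>Open mapping theorem at 0 for the reciprocal \<open>w / h w\<close>: a neighbourhood of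
  0 covered by it is a neighbourhood of infinity covered by \<open>h w / w\<close>.\<close>

lemma image_near_infinity:
  assumes h: "h holomorphic_on ball 0 1" "h 0 \<noteq> 0" and d: "d > 0"
  shows "\<exists>M>0. \<forall>z::complex. norm z > M \<longrightarrow> (\<exists>w. w \<noteq> 0 \<and> norm w < d \<and> norm w < 1 \<and> h w / w = z)"
proof -
  have "isCont h 0"
    using h holomorphic_on_imp_differentiable_at
    by (metis centre_in_ball field_differentiable_imp_continuous_at open_ball zero_less_one)
  then have "\<forall>\<^sub>F w in nhds 0. h w \<noteq> 0"
    using h(2) by (simp add: isCont_def tendsto_imp_eventually_ne eventually_nhds_conv_at)
  then obtain e where e: "e > 0" "\<And>w. norm w < e \<Longrightarrow> h w \<noteq> 0"
    by (auto simp: eventually_nhds_metric dist_norm)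
  define r where "r = min (min d e) 1"
  have r: "r > 0" "r \<le> d" "r \<le> e" "r \<le> 1" using d e by (auto simp: r_def)
  define k where "k = (\<lambda>w. w / h w)"
  have hol: "k holomorphic_on ball 0 r"
    unfolding k_def using e r holomorphic_on_subset[OF h(1)]
    by (intro holomorphic_intros) (auto simp: subset_iff)
  have nc: "\<not> k constant_on ball 0 r"
  proof
    assume "k constant_on ball 0 r"
    moreover have "of_real (r / 2) \<in> ball (0::complex) r" using r(1) by (simp del: of_real_divide)
    moreover have "0 \<in> ball (0::complex) r" using r(1) by simp
    ultimately have "k (of_real (r / 2)) = k 0"
      unfolding constant_on_def by metis
    moreover have "norm (complex_of_real (r / 2)) < e" using r by (simp del: of_real_divide)
    ultimately show False using e(2)[of "of_real (r / 2)"] r(1) by (auto simp: k_def)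
  qed
  have "open (k ` ball 0 r)"
    by (rule open_mapping_thm[OF hol _ _ _ _ nc]) auto
  moreover have "0 \<in> k ` ball 0 r" using r(1) by (auto simp: k_def intro!: image_eqI[of _ _ 0])
  ultimately obtain t where t: "t > 0" "ball 0 t \<subseteq> k ` ball 0 r"
    using open_contains_ball by blast
  show ?thesis
  proof (intro exI[of _ "1 / t"] conjI allI impI)
    fix z :: complex assume z: "norm z > 1 / t"
    moreover have "1 / t > 0" using t by simp
    ultimately have z0: "norm z > 0" by linarith
    then have "norm (1 / z) < t" using z t by (simp add: norm_divide field_simps)
    then obtain w where w: "norm w < r" "1 / z = k w" using t(2) by (force simp: subset_iff)
    moreover have "w \<noteq> 0" using w z0 by (auto simp: k_def)
    moreover have "h w / w = z" using w(2) z0 \<open>w \<noteq> 0\<close> e(2)[of w] w(1) r by (auto simp: k_def field_simps)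
    ultimately show "\<exists>w. w \<noteq> 0 \<and> norm w < d \<and> norm w < 1 \<and> h w / w = z" using r by auto
  qed (use t in auto)
qed

section \<open>Behaviour at infinity, level sets and Schwarz's lemma for exterior maps\<close>

lemma exterior_mapD:
  assumes "exterior_map C F H"
  shows "F holomorphic_on - C" "H holomorphic_on ball 0 1"
    "\<And>z. z \<notin> C \<Longrightarrow> F z \<noteq> 0" "\<And>z. z \<notin> C \<Longrightarrow> norm (F z) < 1" "\<And>z. z \<notin> C \<Longrightarrow> H (F z) = z * F z"
    "\<And>w. w \<noteq> 0 \<Longrightarrow> norm w < 1 \<Longrightarrow> H w / w \<notin> C"
    "\<And>w. w \<noteq> 0 \<Longrightarrow> norm w < 1 \<Longrightarrow> F (H w / w) = w"
    "H 0 \<noteq> 0"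
  using assms by (auto simp: exterior_map_def)

text \<open>No limit at infinity is part of \<open>exterior_map\<close>; it is recovered from the
  inverse, since points near infinity are images \<open>H w / w\<close> of small w.\<close>

lemma exterior_map_small_near_infinity:
  assumes E: "exterior_map C F H" and d: "d > 0"
  obtains M where "M > 0" "\<And>z. norm z > M \<Longrightarrow> z \<notin> C \<and> norm (F z) < d"
proof -
  from image_near_infinity[OF exterior_mapD(2,8)[OF E] d] obtain M
    where M: "M > 0" "\<forall>z. norm z > M \<longrightarrow> (\<exists>w. w \<noteq> 0 \<and> norm w < d \<and> norm w < 1 \<and> H w / w = z)"
    by (elim exE conjE) (rule that; assumption)
  show ?thesis
  proof (rule that[OF M(1)])
    fix z :: complex assume "norm z > M"
    then obtain w where w: "w \<noteq> 0" "norm w < d" "norm w < 1" "H w / w = z" using M(2) by force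
    then show "z \<notin> C \<and> norm (F z) < d" using exterior_mapD(6,7)[OF E w(1,3)] by simp
  qed
qed

text \<open>\<open>K\<close> may be unbounded, but \<open>F\<close> is small near infinity and the
  rest of \<open>K\<close> is compact.\<close>

lemma exterior_map_bound_closed:
  assumes E: "exterior_map C F H" and K: "closed K" "K \<inter> C = {}"
  obtains s where "0 < s" "s < 1" "\<And>z. z \<in> K \<Longrightarrow> norm (F z) \<le> s"
proof -
  obtain M where M: "\<And>z. norm z > M \<Longrightarrow> z \<notin> C \<and> norm (F z) < 1 / 2"
    using exterior_map_small_near_infinity[OF E, of "1/2"] by auto
  have com: "compact (K \<inter> cball 0 M)" using K(1) by (simp add: closed_Int_compact)
  have cont: "continuous_on (K \<inter> cball 0 M) (\<lambda>z. norm (F z))"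
    by (intro continuous_on_norm holomorphic_on_imp_continuous_on holomorphic_on_subset[OF exterior_mapD(1)[OF E]])
       (use K in auto)
  show ?thesis
  proof (cases "K \<inter> cball 0 M = {}")
    case True
    then have "norm (F z) \<le> 1 / 2" if "z \<in> K" for z using M[of z] that by (force simp: not_le)
    then show ?thesis using that[of "1/2"] by auto
  next
    case False
    obtain x where x: "x \<in> K \<inter> cball 0 M" "\<And>y. y \<in> K \<inter> cball 0 M \<Longrightarrow> norm (F y) \<le> norm (F x)"
      using continuous_attains_sup[OF com False cont] by blast
    show ?thesis
    proof (rule that[of "max (1/2) (norm (F x))"])
      show "max (1/2) (norm (F x)) < 1" using exterior_mapD(4)[OF E, of x] x K by auto
      fix z assume "z \<in> K"
      then show "norm (F z) \<le> max (1/2) (norm (F x))"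
        using M[of z] x(2)[of z] by (cases "norm z > M") auto
    qed auto
  qed
qed

text \<open>Off the ball \<open>F\<close> stays away from the unit circle, so \<open>H v / v\<close>
  lies in the ball when \<open>norm v\<close> is near 1. This bounds \<open>H\<close> on circles
  near the unit circle, and the maximum principle does the rest. Dependence on \<open>R\<close>
  alone makes the maps of varying continua a normal family.\<close>

lemma exterior_map_bound:
  assumes E: "exterior_map C F H" and R: "C \<subseteq> ball 0 R" and w: "norm w < 1"
  shows "norm (H w) \<le> R"
proof -
  obtain s where s: "0 < s" "s < 1" "\<And>z. z \<in> - ball 0 R \<Longrightarrow> norm (F z) \<le> s"
    using exterior_map_bound_closed[OF E, of "- ball 0 R"] R by (auto simp: closed_Compl)
  have le: "norm (H v) \<le> R" if v: "norm v > s" "norm v < 1" for v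
  proof -
    have v0: "v \<noteq> 0" using v s by auto
    have "H v / v \<in> ball 0 R"
      using s(3)[of "H v / v"] exterior_mapD(7)[OF E v0 v(2)] v by fastforce
    then have "norm (H v) < R * norm v" using v0 by (simp add: norm_divide divide_less_eq)
    also have "\<dots> \<le> R * 1"
    proof (rule mult_left_mono)
      show "0 \<le> R" using \<open>H v / v \<in> ball 0 R\<close> norm_ge_zero[of "H v / v"] unfolding mem_ball_0 by linarith
    qed (use v in auto)
    finally show ?thesis by simp
  qed
  obtain t where t: "max s (norm w) < t" "t < 1" using s w dense[of "max s (norm w)" 1] by auto
  show ?thesis
  proof (rule maximum_modulus_frontier[of H "cball 0 t"])
    show "H holomorphic_on interior (cball 0 t)"
      by (rule holomorphic_on_subset[OF exterior_mapD(2)[OF E]]) (use t in auto)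
    show "continuous_on (closure (cball 0 t)) H"
      by (rule continuous_on_subset[OF holomorphic_on_imp_continuous_on[OF exterior_mapD(2)[OF E]]]) (use t in auto)
    fix z assume "z \<in> frontier (cball (0::complex) t)"
    then show "norm (H z) \<le> R" using le t s by auto
  qed (use t in auto)
qed

text \<open>Closed in the plane and not only in \<open>- C\<close>: points of \<open>C\<close> are
  not approached. The set is the projection of the closed relation \<open>z * w = H w\<close> along
  a compact disc, where w = 0 is excluded by \<open>H 0 \<noteq> 0\<close>.\<close>

lemma closed_level_set:
  assumes E: "exterior_map C F H" and s: "s < 1"
  shows "closed {z. z \<notin> C \<and> norm (F z) \<le> s}"
proof -
  have eq: "{z. z \<notin> C \<and> norm (F z) \<le> s} = {z. \<exists>w. w \<in> cball 0 s \<and> (w, z) \<in> {x \<in> cball 0 s \<times> UNIV. snd x * fst x = H (fst x)}}"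
  proof (intro set_eqI iffI)
    fix z assume "z \<in> {z. z \<notin> C \<and> norm (F z) \<le> s}"
    then show "z \<in> {z. \<exists>w. w \<in> cball 0 s \<and> (w, z) \<in> {x \<in> cball 0 s \<times> UNIV. snd x * fst x = H (fst x)}}"
      using exterior_mapD(5)[OF E, of z] by auto
  next
    fix z assume "z \<in> {z. \<exists>w. w \<in> cball 0 s \<and> (w, z) \<in> {x \<in> cball 0 s \<times> UNIV. snd x * fst x = H (fst x)}}"
    then obtain w where w: "norm w \<le> s" "z * w = H w" by auto
    then have "w \<noteq> 0" using exterior_mapD(8)[OF E] by auto
    then have "z = H w / w" using w by (simp add: field_simps)
    then show "z \<in> {z. z \<notin> C \<and> norm (F z) \<le> s}"
      using exterior_mapD(6,7)[OF E \<open>w \<noteq> 0\<close>] w s by auto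
  qed
  have "closed {x \<in> cball 0 s \<times> UNIV. snd x * fst x = H (fst x)}"
  proof -
    have "continuous_on (cball 0 s) H"
      by (rule continuous_on_subset[OF holomorphic_on_imp_continuous_on[OF exterior_mapD(2)[OF E]]]) (use s in auto)
    then have "continuous_on (cball 0 s \<times> (UNIV :: complex set)) (\<lambda>x. H (fst x))"
      by (rule continuous_on_compose2) (auto intro: continuous_on_fst continuous_on_id)
    then have "continuous_on (cball 0 s \<times> UNIV) (\<lambda>x. snd x * fst x - H (fst x))"
      by (intro continuous_on_diff continuous_on_mult continuous_on_fst continuous_on_snd continuous_on_id)
    then have "closed {x \<in> cball 0 s \<times> UNIV. snd x * fst x - H (fst x) = 0}"
      by (rule continuous_closed_preimage_constant) (auto intro: closed_Times)
    then show ?thesis by simp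
  qed
  from closed_compact_projection[OF compact_cball this] show ?thesis unfolding eq .
qed

lemma open_level_set:
  assumes E: "exterior_map C F H" and C: "closed C"
  shows "open {z. z \<notin> C \<and> norm (F z) < s}"
proof -
  have "{z. z \<notin> C \<and> norm (F z) < s} = - C \<inter> (\<lambda>z. norm (F z)) -` {..<s}" by auto
  moreover have "open (- C \<inter> (\<lambda>z. norm (F z)) -` {..<s})"
    by (rule continuous_open_preimage)
       (use C in \<open>auto intro!: continuous_on_norm holomorphic_on_imp_continuous_on exterior_mapD(1)[OF E]\<close>)
  ultimately show ?thesis by simp
qed

text \<open>\<open>h w / w\<close> has a pole at 0 and \<open>F\<close> tends to 0 at infinity, so
  the singularity of \<open>T\<close> is removable. The derivative comes from
  \<open>T w / w = H (T w) / h w\<close>.\<close>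

lemma exterior_map_compose:
  assumes E: "exterior_map C F H" and C: "closed C"
    and h: "h holomorphic_on ball 0 r" "h 0 \<noteq> 0" and r: "r > 0"
    and avoid: "\<And>w. w \<noteq> 0 \<Longrightarrow> norm w < r \<Longrightarrow> h w / w \<notin> C"
  defines "T \<equiv> \<lambda>w. if w = 0 then 0 else F (h w / w)"
  shows "T holomorphic_on ball 0 r" "(T has_field_derivative H 0 / h 0) (at 0)"
    "\<And>w. norm w < r \<Longrightarrow> norm (T w) < 1"
proof -
  have "(F \<circ> (\<lambda>w. h w / w)) holomorphic_on ball 0 r - {0}"
    by (rule holomorphic_on_compose_gen[OF _ exterior_mapD(1)[OF E]])
       (use avoid in \<open>auto intro!: holomorphic_intros holomorphic_on_subset[OF h(1)]\<close>)
  then have hol0: "T holomorphic_on ball 0 r - {0}"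
    by (rule holomorphic_transform) (auto simp: T_def)
  show lt: "norm (T w) < 1" if "norm w < r" for w
    using exterior_mapD(4)[OF E] avoid that by (auto simp: T_def)
  have hcont: "isCont h 0"
    using h r holomorphic_on_imp_differentiable_at
    by (metis centre_in_ball field_differentiable_imp_continuous_at open_ball)
  have "filterlim (\<lambda>w. h w / w) at_infinity (at 0)"
    using hcont h(2) by (intro filterlim_divide_at_infinity[of _ "h 0"]) (auto simp: isCont_def filterlim_ident)
  then have "filterlim (\<lambda>w. norm (h w / w)) at_top (at 0)"
    by (rule filterlim_compose[OF filterlim_norm_at_top])
  then have big: "\<forall>\<^sub>F w in at 0. norm (h w / w) > M" for M
    by (simp add: filterlim_at_top_dense)
  have T0: "(T \<longlongrightarrow> 0) (at 0)"
  proof (rule tendstoI)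
    fix e :: real assume "e > 0"
    then obtain M where M: "\<And>z. norm z > M \<Longrightarrow> z \<notin> C \<and> norm (F z) < e"
      using exterior_map_small_near_infinity[OF E] by blast
    show "\<forall>\<^sub>F w in at 0. dist (T w) 0 < e"
      using big[of M] by eventually_elim (use M \<open>e > 0\<close> in \<open>auto simp: T_def\<close>)
  qed
  have Tcont: "isCont T 0" using T0 by (simp add: isCont_def T_def)
  have contT: "continuous_on (ball 0 r) T"
  proof -
    have "isCont T w" if "w \<in> ball 0 r" for w
    proof (cases "w = 0")
      case False
      then show ?thesis
        using hol0 that holomorphic_on_imp_continuous_on[OF hol0]
        by (simp add: continuous_on_eq_continuous_at open_delete)
    qed (use Tcont in auto)
    then show ?thesis by (simp add: continuous_on_eq_continuous_at)
  qed
  show "T holomorphic_on ball 0 r"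
    by (rule no_isolated_singularity[OF contT hol0]) auto
  have "isCont H 0"
    using exterior_mapD(2)[OF E] holomorphic_on_imp_differentiable_at
    by (metis centre_in_ball field_differentiable_imp_continuous_at open_ball zero_less_one)
  then have "((\<lambda>w. H (T w)) \<longlongrightarrow> H 0) (at 0)" using T0 by (rule isCont_tendsto_compose)
  then have "((\<lambda>w. H (T w) / h w) \<longlongrightarrow> H 0 / h 0) (at 0)"
    using hcont h(2) by (intro tendsto_intros) (auto simp: isCont_def)
  then have "((\<lambda>w. (T w - T 0) / (w - 0)) \<longlongrightarrow> H 0 / h 0) (at 0)"
  proof (rule Lim_transform_eventually)
    have "\<forall>\<^sub>F w in at (0::complex). norm w < r \<and> w \<noteq> 0"
      using r by (auto simp: eventually_at dist_norm)
    moreover have "\<forall>\<^sub>F w in at 0. h w \<noteq> 0"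
      using hcont h(2) by (simp add: isCont_def tendsto_imp_eventually_ne)
    ultimately show "\<forall>\<^sub>F w in at 0. H (T w) / h w = (T w - T 0) / (w - 0)"
    proof eventually_elim
      case (elim w)
      have "H (T w) = (h w / w) * T w"
        using exterior_mapD(5)[OF E avoid[of w]] elim by (simp add: T_def)
      then show ?case using elim by (simp add: T_def)
    qed
  qed
  then show "(T has_field_derivative H 0 / h 0) (at 0)" by (simp add: has_field_derivative_iff)
qed

text \<open>Schwarz's lemma for \<open>T (r * w)\<close> on the unit disc. The first claim compares
  leading coefficients; the second is the subordination principle for the levels of
  \<open>F\<close>.\<close>

lemma exterior_map_Schwarz:
  assumes E: "exterior_map C F H" and C: "closed C"
    and h: "h holomorphic_on ball 0 r" "h 0 \<noteq> 0" and r: "r > 0"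
    and avoid: "\<And>w. w \<noteq> 0 \<Longrightarrow> norm w < r \<Longrightarrow> h w / w \<notin> C"
  shows "r * norm (H 0) \<le> norm (h 0)"
    and "\<And>w. w \<noteq> 0 \<Longrightarrow> norm w < r \<Longrightarrow> norm (F (h w / w)) \<le> norm w / r"
proof -
  define T where "T = (\<lambda>w. if w = 0 then 0 else F (h w / w))"
  note T = exterior_map_compose[OF assms, folded T_def]
  have Tlt: "norm (T v) < 1" if "norm v < r" for v
    using exterior_map_compose(3)[OF assms that] by (simp add: T_def)
  define S where "S = (\<lambda>w. T (of_real r * w))"
  have "S holomorphic_on ball 0 1"
    unfolding S_def using holomorphic_on_compose_gen[of "\<lambda>w. of_real r * w" "ball 0 1" T "ball 0 r"] T(1) r
    by (auto simp: comp_def norm_mult image_subset_iff intro!: holomorphic_intros)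
  moreover have "S 0 = 0" by (simp add: S_def T_def)
  moreover have "norm (S w) < 1" if "norm w < 1" for w
  proof -
    have "norm (of_real r * w) < r" using that r by (simp add: norm_mult)
    then show ?thesis unfolding S_def using Tlt by blast
  qed
  ultimately have S: "norm w < 1 \<Longrightarrow> norm (S w) \<le> norm w" "norm (deriv S 0) \<le> 1" for w
    using Schwarz_Lemma(1)[of S w] Schwarz_Lemma(2)[of S 0] by auto
  have "(S has_field_derivative (H 0 / h 0) * of_real r) (at 0)"
    unfolding S_def using DERIV_chain2[of T "H 0 / h 0" "\<lambda>w. of_real r * w" 0 "of_real r" UNIV] T(2)
    by (auto intro!: derivative_eq_intros)
  then have "norm (deriv S 0) = norm (H 0) * r / norm (h 0)"
    using r by (simp add: DERIV_imp_deriv norm_mult norm_divide)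
  then show "r * norm (H 0) \<le> norm (h 0)" using S(2) h(2) by (simp add: pos_divide_le_eq mult.commute)
  fix w :: complex assume w: "w \<noteq> 0" "norm w < r"
  have "norm (S (w / of_real r)) \<le> norm (w / of_real r)"
    by (rule S(1)) (use w r in \<open>simp add: norm_divide\<close>)
  then show "norm (F (h w / w)) \<le> norm w / r"
    using w r by (simp add: S_def T_def norm_divide)
qed

section \<open>Convergence of exterior Riemann maps\<close>

lemma tendsto_closed_bounded_subseq:
  fixes z :: "nat \<Rightarrow> complex"
  assumes "\<And>n. norm (z n) \<le> R"
  obtains l r where "strict_mono (r :: nat \<Rightarrow> nat)" "(\<lambda>n. z (r n)) \<longlonglongrightarrow> l"
proof -
  have "\<forall>n. z n \<in> cball 0 R" using assms by simp
  then obtain l r where "strict_mono (r :: nat \<Rightarrow> nat)" "(z \<circ> r) \<longlonglongrightarrow> l"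
    using compact_imp_seq_compact[OF compact_cball] by (metis seq_compactE)
  then show ?thesis using that by (simp add: comp_def)
qed

text \<open>Hurwitz's theorem for \<open>Hs (s k) w - zs k * w\<close>, which has no zeros because
  the inverse maps omit the continua. The limit is zero-free or constant, and its value at 0 is
  \<open>h 0\<close>. The case \<open>h 0 = 0\<close> is the degenerate one, in which the continua
  shrink to a point.\<close>

lemma exterior_limit_omits:
  assumes E: "\<And>k. exterior_map (Cs k) (Fs k) (Hs k)"
    and h: "h holomorphic_on ball 0 1"
    and lim: "\<And>L. compact L \<Longrightarrow> L \<subseteq> ball 0 1 \<Longrightarrow> uniform_limit L Hs h sequentially"
    and s: "strict_mono (s :: nat \<Rightarrow> nat)" and z: "\<And>k. zs k \<in> Cs (s k)" "zs \<longlonglongrightarrow> z"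
    and w: "norm w < 1"
  shows "if h 0 = 0 then h w = z * w else h w \<noteq> z * w"
proof -
  define g where "g = (\<lambda>w. h w - z * w)"
  define G where "G = (\<lambda>k w. Hs (s k) w - zs k * w)"
  have holg: "g holomorphic_on ball 0 1" unfolding g_def using h by (intro holomorphic_intros)
  have ulG: "uniform_limit L G g sequentially" if L: "compact L" "L \<subseteq> ball 0 1" for L
  proof -
    have "uniform_limit L (Hs \<circ> s) h sequentially" by (rule tendsto_subseq_uniform_limit[OF lim[OF L] s])
    moreover have "uniform_limit L (\<lambda>k w. zs k * w) (\<lambda>w. z * w) sequentially"
    proof (rule uniform_lim_mult)
      show "uniform_limit L (\<lambda>k w. zs k) (\<lambda>w. z) sequentially"
        using z(2) by (auto simp: uniform_limit_iff tendsto_iff elim!: eventually_mono)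
      show "bounded ((\<lambda>w. w) ` L)" using compact_imp_bounded[OF L(1)] by simp
      show "bounded ((\<lambda>w. z) ` L)" by (rule bounded_subset[of "{z}"]) auto
    qed (simp add: uniform_limit_const)
    ultimately show ?thesis unfolding G_def g_def by (intro uniform_limit_minus) (auto simp: comp_def)
  qed
  have nz: "G k w \<noteq> 0" if "w \<in> ball 0 1" for k w
  proof
    assume "G k w = 0"
    then have eq: "Hs (s k) w = zs k * w" by (simp add: G_def)
    show False
    proof (cases "w = 0")
      case True then show False using eq exterior_mapD(8)[OF E] by auto
    next
      case False
      then have "Hs (s k) w / w = zs k" using eq by simp
      then show False using exterior_mapD(6)[OF E False, of "s k"] that z(1) by auto
    qed
  qed
  have nc: "g w \<noteq> 0" if "\<not> g constant_on ball 0 1" "norm w < 1" for w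
    by (rule Hurwitz_no_zeros[OF open_ball connected_ball _ holg ulG that(1) nz])
       (use that in \<open>auto simp: G_def intro!: holomorphic_intros exterior_mapD(2)[OF E]\<close>)
  show ?thesis
  proof (cases "g constant_on ball 0 1")
    case True
    then have "g w = g 0" using w unfolding constant_on_def by (metis centre_in_ball mem_ball_0 zero_less_one)
    then show ?thesis by (auto simp: g_def)
  next
    case False
    then show ?thesis using nc[OF False, of 0] nc[OF False w] by (auto simp: g_def)
  qed
qed

text \<open>A closed subset of \<open>V\<close> that met \<open>Cs k\<close> for infinitely many k
  would contain a limit of points of these sets, by boundedness. So only such limits have to be
  tested.\<close>

lemma kernel_candI:
  assumes V: "infty_domain V" and R: "\<forall>\<^sub>F k in sequentially. Cs k \<subseteq> ball 0 R"
    and avoid: "\<And>s zs z. strict_mono (s :: nat \<Rightarrow> nat) \<Longrightarrow> (\<And>k. zs k \<in> Cs (s k)) \<Longrightarrow> zs \<longlonglongrightarrow> z \<Longrightarrow> z \<notin> V"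
  shows "kernel_cand (\<lambda>k. - Cs k) V"
  unfolding kernel_cand_def
proof (intro conjI V allI impI, elim conjE)
  fix K assume K: "closed K" "K \<subseteq> V"
  show "\<forall>\<^sub>F k in sequentially. K \<subseteq> - Cs k"
  proof (rule ccontr)
    assume "\<not> ?thesis"
    then have "\<exists>\<^sub>F k in sequentially. \<exists>x. x \<in> K \<and> x \<in> Cs k"
      unfolding not_eventually by (rule frequently_elim1) auto
    from frequently_eventually_frequently[OF this R]
    obtain q where q: "strict_mono (q :: nat \<Rightarrow> nat)"
      "\<And>k. (\<exists>x. x \<in> K \<and> x \<in> Cs (q k)) \<and> Cs (q k) \<subseteq> ball 0 R"
      using frequently_subseq by blast
    obtain zs where zs: "\<And>k. zs k \<in> K" "\<And>k. zs k \<in> Cs (q k)" using q(2) by metis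
    have "norm (zs k) \<le> R" for k using zs(2)[of k] q(2)[of k] by auto
    then obtain l r where r: "strict_mono (r :: nat \<Rightarrow> nat)" "(\<lambda>n. zs (r n)) \<longlonglongrightarrow> l"
      using tendsto_closed_bounded_subseq by blast
    have "l \<notin> V"
      by (rule avoid[of "q \<circ> r" "\<lambda>n. zs (r n)"]) (use q(1) r zs in \<open>auto intro: strict_mono_o\<close>)
    moreover have "l \<in> K" using closed_sequentially[OF K(1) _ r(2)] zs(1) by blast
    ultimately show False using K(2) by blast
  qed
qed

text \<open>The kernel supplies inclusions in both directions, so Schwarz's lemma applies in both
  directions; equality of the leading coefficients then forces the maps to coincide.\<close>

lemma exterior_limit_unique:
  assumes C: "full_continuum C" and Cs: "\<And>k. full_continuum (Cs k)"
    and E: "exterior_map C F H" and Es: "\<And>k. exterior_map (Cs k) (Fs k) (Hs k)"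
    and R: "\<And>k. Cs k \<subseteq> ball 0 R"
    and conv: "is_kernel (\<lambda>k. - Cs k) (- C)"
    and h: "h holomorphic_on ball 0 1"
    and lim: "\<And>L. compact L \<Longrightarrow> L \<subseteq> ball 0 1 \<Longrightarrow> uniform_limit L Hs h sequentially"
    and w: "norm w < 1"
  shows "h w = H w"
proof -
  have cC: "closed C" "closed (Cs k)" for k
    using C Cs by (auto simp: full_continuum_def compact_imp_closed)
  have in_kernel: "\<forall>\<^sub>F k in sequentially. K \<subseteq> - Cs k" if "closed K" "K \<subseteq> - C" for K
    using conv that unfolding is_kernel_def kernel_cand_def by blast
  have maximal: "V \<subseteq> - C" if "infty_domain V"
    "\<And>s zs z. strict_mono (s :: nat \<Rightarrow> nat) \<Longrightarrow> (\<And>k. zs k \<in> Cs (s k)) \<Longrightarrow> zs \<longlonglongrightarrow> z \<Longrightarrow> z \<notin> V" for V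
  proof -
    have "kernel_cand (\<lambda>k. - Cs k) V" by (rule kernel_candI[OF that(1) always_eventually[OF allI[OF R]]]) (rule that(2))
    then show ?thesis using conv unfolding is_kernel_def by blast
  qed
  note omit = exterior_limit_omits[where Cs = Cs and Fs = Fs and Hs = Hs, OF Es h lim]
  \<comment> \<open>Otherwise all limits of points of the \<open>Cs k\<close> equal
    \<open>a\<close>, the plane punctured at \<open>a\<close> is a kernel candidate, and
    \<open>C\<close> has at most one point.\<close>
  have h0: "h 0 \<noteq> 0"
  proof
    assume z: "h 0 = 0"
    define a where "a = 2 * h (1/2)"
    have "- {a} \<subseteq> - C"
    proof (rule maximal)
      have "connected (- {a})" by (rule connected_punctured_universe) simp
      then show "infty_domain (- {a})" by (auto simp: infty_domain_def)
      fix s :: "nat \<Rightarrow> nat" and zs z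
      assume a1: "strict_mono s" "\<And>k. zs k \<in> Cs (s k)" "zs \<longlonglongrightarrow> z"
      have "h (1/2) = z * (1/2)" using omit[OF _ _ a1, of "1/2"] z by (simp add: norm_divide)
      then have "z = a" by (simp add: a_def mult.commute)
      then show "z \<notin> - {a}" by simp
    qed
    then have "C = {a} \<or> C = {}" by blast
    then show False using C by (auto simp: full_continuum_def)
  qed
  \<comment> \<open>The image \<open>V\<close> of \<open>h w / w\<close> contains no limit of points
    of the \<open>Cs k\<close>, so it is a kernel candidate, and maximality of the kernel puts it
    outside \<open>C\<close>.\<close>
  have avoid: "h v / v \<notin> C" if v: "v \<noteq> 0" "norm v < 1" for v
  proof -
    define V where "V = (\<lambda>w. h w / w) ` (ball 0 1 - {0})"
    obtain M where M: "M > 0" "\<And>z. norm z > M \<Longrightarrow> z \<in> V"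
      using image_near_infinity[OF h h0, of 1] unfolding V_def by force
    have hol: "(\<lambda>w. h w / w) holomorphic_on ball 0 1 - {0}"
      by (intro holomorphic_intros holomorphic_on_subset[OF h]) auto
    have con: "connected (ball 0 1 - {0::complex})"
      by (rule connected_open_delete) (auto simp: connected_ball)
    have op: "open (ball 0 1 - {0::complex})" by (simp add: open_delete)
    have nc: "\<not> (\<lambda>w. h w / w) constant_on ball 0 1 - {0}"
    proof
      assume "(\<lambda>w. h w / w) constant_on ball 0 1 - {0}"
      then obtain c where c: "V \<subseteq> {c}" unfolding constant_on_def V_def by auto
      have "of_real (M + 1) \<in> V" "of_real (M + 2) \<in> V"
        using M(1) by (intro M(2); simp del: of_real_add)+
      then have "complex_of_real (M + 1) = of_real (M + 2)" using c by blast
      then show False unfolding of_real_eq_iff by simp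
    qed
    have "V \<subseteq> - C"
    proof (rule maximal)
      have "open V" unfolding V_def by (rule open_mapping_thm[OF hol op con op _ nc]) auto
      moreover have "connected V" unfolding V_def
        by (rule connected_continuous_image[OF holomorphic_on_imp_continuous_on[OF hol] con])
      moreover have "bounded (- V)"
        using M(2) by (intro boundedI[of _ M]) (metis ComplD not_le)
      ultimately show "infty_domain V" by (simp add: infty_domain_def)
      fix s :: "nat \<Rightarrow> nat" and zs z
      assume a1: "strict_mono s" "\<And>k. zs k \<in> Cs (s k)" "zs \<longlonglongrightarrow> z"
      show "z \<notin> V"
      proof
        assume "z \<in> V"
        then obtain w where w: "w \<in> ball 0 1 - {0}" "z = h w / w" unfolding V_def by blast
        then have "h w \<noteq> z * w" using omit[OF _ _ a1, of w] h0 by simp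
        then show False using w by simp
      qed
    qed
    moreover have "h v / v \<in> V" unfolding V_def using v by (intro imageI) auto
    ultimately show ?thesis by blast
  qed
  have hk0: "(\<lambda>k. norm (Hs k 0)) \<longlonglongrightarrow> norm (h 0)"
    by (intro tendsto_norm tendsto_uniform_limitI[OF lim[of "{0}"]]) auto
  \<comment> \<open>For large k the closed level set of \<open>F\<close> at \<open>s\<close> avoids
    \<open>Cs k\<close>, so \<open>H\<close> on the disc of radius \<open>s\<close> can be compared
    with \<open>Hs k\<close>. Here k tends to infinity; afterwards s tends to 1.\<close>
  have upper: "s * norm (h 0) \<le> norm (H 0)" if s: "0 < s" "s < 1" for s
  proof -
    have "\<forall>\<^sub>F k in sequentially. {z. z \<notin> C \<and> norm (F z) \<le> s} \<subseteq> - Cs k"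
      using in_kernel[OF closed_level_set[OF E s(2)]] by auto
    then have "\<forall>\<^sub>F k in sequentially. s * norm (Hs k 0) \<le> norm (H 0)"
    proof eventually_elim
      case (elim k)
      show ?case
      proof (rule exterior_map_Schwarz(1)[where h = H and r = s,
            OF Es[of k] cC(2) _ exterior_mapD(8)[OF E] s(1)])
        show "H holomorphic_on ball 0 s"
          by (rule holomorphic_on_subset[OF exterior_mapD(2)[OF E]]) (use s in auto)
        fix w :: complex assume w: "w \<noteq> 0" "norm w < s"
        then show "H w / w \<notin> Cs k"
          using elim exterior_mapD(6,7)[OF E w(1)] s by force
      qed
    qed
    then show ?thesis
      by (intro tendsto_upperbound[OF tendsto_mult_left[OF hk0]]) auto
  qed
  have "norm (h 0) \<le> norm (H 0)"
  proof (rule field_le_mult_one_interval)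
    show "s * norm (h 0) \<le> norm (H 0)" if "0 < s" "s < 1" for s using upper that by blast
  qed
  moreover have "1 * norm (H 0) \<le> norm (h 0)"
    by (rule exterior_map_Schwarz(1)[OF E cC(1) h h0]) (use avoid in auto)
  ultimately have eq: "norm (h 0) = norm (H 0)" by simp
  have "h 0 = of_real (norm (h 0))"
  proof -
    have "(\<lambda>k. complex_of_real (norm (Hs k 0))) \<longlonglongrightarrow> of_real (norm (h 0))"
      by (intro tendsto_of_real hk0)
    moreover have "complex_of_real (norm (Hs k 0)) = Hs k 0" for k
    proof -
      obtain c where "c > 0" "Hs k 0 = complex_of_real c" using Es[of k] unfolding exterior_map_def by blast
      then show ?thesis by simp
    qed
    moreover have "(\<lambda>k. Hs k 0) \<longlonglongrightarrow> h 0" by (intro tendsto_uniform_limitI[OF lim[of "{0}"]]) auto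
    ultimately show ?thesis using LIMSEQ_unique by simp
  qed
  moreover have "H 0 = of_real (norm (H 0))"
  proof -
    obtain c where "c > 0" "H 0 = complex_of_real c" using E unfolding exterior_map_def by blast
    then show ?thesis by simp
  qed
  ultimately have eq0: "h 0 = H 0" using eq by simp
  \<comment> \<open>Equal leading coefficients give \<open>T\<close> the derivative 1 at 0, the
    equality case of Schwarz's lemma, so \<open>T\<close> is the identity.\<close>
  define T where "T = (\<lambda>w. if w = 0 then 0 else F (h w / w))"
  note T = exterior_map_compose[OF E cC(1) h h0 zero_less_one avoid, folded T_def]
  have T1: "norm (T v) < 1" if "norm v < 1" for v
    using exterior_map_compose(3)[OF E cC(1) h h0 zero_less_one avoid that] by (simp add: T_def)
  have dT: "deriv T 0 = 1" using DERIV_imp_deriv[OF T(2)] eq0 h0 by simp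
  obtain u where u: "\<And>z. norm z < 1 \<Longrightarrow> T z = u * z"
    using Schwarz_Lemma(3)[OF T(1) _ T1, of 0] dT by (auto simp: T_def)
  have "(T has_field_derivative u) (at 0)"
  proof (rule has_field_derivative_transform_within_open[of "\<lambda>z. u * z" _ _ "ball 0 1"])
    show "((\<lambda>z. u * z) has_field_derivative u) (at 0)" by (rule DERIV_cmult_Id)
  qed (use u in auto)
  then have "u = 1" using dT DERIV_imp_deriv by blast
  show "h w = H w"
  proof (cases "w = 0")
    case False
    then have "F (h w / w) = w" using u[OF w] \<open>u = 1\<close> by (simp add: T_def)
    then have "H w = (h w / w) * w" using exterior_mapD(5)[OF E avoid[OF False w]] by simp
    then show ?thesis using False by simp
  qed (use eq0 in simp)
qed

text \<open>Caratheodory's kernel theorem for exterior domains. The maps form a normal family, and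
  every subsequential limit is \<open>H\<close>, because \<open>cara_conv\<close> fixes the kernel
  of each subsequence.\<close>

theorem exterior_maps_converge:
  assumes C: "full_continuum C" and Cs: "\<And>k. full_continuum (Cs k)"
    and E: "exterior_map C F H" and Es: "\<And>k. exterior_map (Cs k) (Fs k) (Hs k)"
    and R: "\<And>k. Cs k \<subseteq> ball 0 R"
    and conv: "cara_conv (\<lambda>k. - Cs k) (- C)"
    and L: "compact L" "L \<subseteq> ball 0 1"
  shows "uniform_limit L Hs H sequentially"
proof (rule ccontr)
  assume "\<not> ?thesis"
  then obtain e where e: "e > 0" "\<exists>\<^sub>F k in sequentially. \<not> (\<forall>w\<in>L. dist (Hs k w) (H w) < e)"
    unfolding uniform_limit_iff not_eventually[symmetric] by blast
  obtain q where q: "strict_mono (q :: nat \<Rightarrow> nat)" "\<And>k. \<not> (\<forall>w\<in>L. dist (Hs (q k) w) (H w) < e)"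
    using frequently_subseq[OF e(2)] by blast
  obtain h r where hr: "h holomorphic_on ball 0 1" "strict_mono (r :: nat \<Rightarrow> nat)"
    "\<And>K. compact K \<Longrightarrow> K \<subseteq> ball 0 1 \<Longrightarrow> uniform_limit K ((Hs \<circ> q) \<circ> r) h sequentially"
  proof (rule Montel_exhausting[of "ball (0::complex) 1" "\<lambda>_. ball 0 1" "Hs \<circ> q" R])
    show "(Hs \<circ> q) k holomorphic_on ball 0 1" for k using exterior_mapD(2)[OF Es] by simp
    show "norm ((Hs \<circ> q) k z) \<le> R" if "z \<in> ball 0 1" for k z
      using exterior_map_bound[OF Es R, of z "q k"] that by simp
  qed auto
  have qr: "strict_mono (q \<circ> r)" using q(1) hr(2) by (rule strict_mono_o)
  then have ker: "is_kernel (\<lambda>k. - Cs ((q \<circ> r) k)) (- C)"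
    using conv unfolding cara_conv_def by (auto simp: comp_def)
  have "h w = H w" if "norm w < 1" for w
    by (rule exterior_limit_unique[OF C Cs E Es R ker hr(1) _ that])
       (use hr(3) in \<open>simp add: comp_def\<close>)
  moreover obtain k where "\<forall>w\<in>L. dist (Hs (q (r k)) w) (h w) < e"
    using hr(3)[OF L] e(1) unfolding uniform_limit_iff eventually_sequentially comp_def by blast
  ultimately have "\<forall>w\<in>L. dist (Hs (q (r k)) w) (H w) < e" using L(2) by force
  then show False using q(2) by blast
qed

lemma uniform_limit_along_sequence:
  fixes f :: "nat \<Rightarrow> 'a::metric_space \<Rightarrow> 'b::metric_space"
  assumes "uniform_limit L f g sequentially" "continuous_on L g"
    and "\<And>k. x k \<in> L" "x \<longlonglongrightarrow> l" "l \<in> L"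
  shows "(\<lambda>k. f k (x k)) \<longlonglongrightarrow> g l"
proof (rule tendstoI)
  fix e :: real assume "e > 0"
  have "(\<lambda>k. g (x k)) \<longlonglongrightarrow> g l"
    using assms by (intro continuous_on_tendsto_compose[OF assms(2)]) auto
  then have "\<forall>\<^sub>F k in sequentially. dist (g (x k)) (g l) < e / 2"
    using \<open>e > 0\<close> by (intro tendstoD) auto
  moreover have "\<forall>\<^sub>F k in sequentially. \<forall>y\<in>L. dist (f k y) (g y) < e / 2"
    using assms(1) \<open>e > 0\<close> unfolding uniform_limit_iff by (meson half_gt_zero)
  ultimately show "\<forall>\<^sub>F k in sequentially. dist (f k (x k)) (g l) < e"
  proof eventually_elim
    case (elim k)
    then have "dist (f k (x k)) (g (x k)) < e / 2" using assms(3) by blast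
    then show ?case using elim(1) dist_triangle[of "f k (x k)" "g l" "g (x k)"] by linarith
  qed
qed

section \<open>Uniform consequences for exterior maps and their level sets\<close>

locale exterior_convergence =
  fixes C :: "complex set" and Cs :: "nat \<Rightarrow> complex set"
    and F H :: "complex \<Rightarrow> complex" and Fs Hs :: "nat \<Rightarrow> complex \<Rightarrow> complex" and R :: real
  assumes C: "full_continuum C" and Cs: "\<And>k. full_continuum (Cs k)"
    and E: "exterior_map C F H" and Es: "\<And>k. exterior_map (Cs k) (Fs k) (Hs k)"
    and R: "\<And>k. Cs k \<subseteq> ball 0 R"
    and conv: "cara_conv (\<lambda>k. - Cs k) (- C)"
begin

lemma closed_C: "closed C" "closed (Cs k)"
  using C Cs by (auto simp: full_continuum_def compact_imp_closed)

lemma eventually_avoids: "closed K \<Longrightarrow> K \<inter> C = {} \<Longrightarrow> \<forall>\<^sub>F k in sequentially. K \<inter> Cs k = {}"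
proof -
  assume K: "closed K" "K \<inter> C = {}"
  have "is_kernel ((\<lambda>k. - Cs k) \<circ> id) (- C)"
    using conv strict_mono_id unfolding cara_conv_def by blast
  then have "\<forall>\<^sub>F k in sequentially. K \<subseteq> - Cs k"
    using K unfolding is_kernel_def kernel_cand_def by (auto simp: comp_def)
  then show ?thesis by eventually_elim auto
qed

text \<open>The points may run to infinity, so no limit of \<open>zs\<close> is claimed; the product
  \<open>z * Fs k z\<close>, which is \<open>Hs k (Fs k z)\<close>, converges in any case.\<close>

lemma inverse_values_converge:
  assumes q: "strict_mono (q :: nat \<Rightarrow> nat)" and z: "\<And>k. zs k \<notin> Cs (q k)"
    and s: "\<And>k. norm (Fs (q k) (zs k)) \<le> s" "s < 1"
  obtains r w where "strict_mono (r :: nat \<Rightarrow> nat)" "norm w \<le> s"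
    "(\<lambda>k. Fs (q (r k)) (zs (r k))) \<longlonglongrightarrow> w"
    "(\<lambda>k. zs (r k) * Fs (q (r k)) (zs (r k))) \<longlonglongrightarrow> H w"
proof -
  obtain w r where r: "strict_mono (r :: nat \<Rightarrow> nat)" "(\<lambda>k. Fs (q (r k)) (zs (r k))) \<longlonglongrightarrow> w"
    using tendsto_closed_bounded_subseq[of "\<lambda>k. Fs (q k) (zs k)"] s(1) by blast
  have w: "norm w \<le> s"
    by (rule LIMSEQ_le_const2[OF tendsto_norm[OF r(2)]]) (use s in auto)
  have "uniform_limit (cball 0 s) Hs H sequentially"
    by (rule exterior_maps_converge[OF C Cs E Es R conv]) (use s in auto)
  then have ul: "uniform_limit (cball 0 s) (Hs \<circ> (q \<circ> r)) H sequentially"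
    by (rule tendsto_subseq_uniform_limit) (use q r in \<open>auto intro: strict_mono_o\<close>)
  have "(\<lambda>k. (Hs \<circ> (q \<circ> r)) k (Fs (q (r k)) (zs (r k)))) \<longlonglongrightarrow> H w"
    by (rule uniform_limit_along_sequence[OF ul])
       (use s w r in \<open>auto intro!: holomorphic_on_imp_continuous_on holomorphic_on_subset[OF exterior_mapD(2)[OF E]]\<close>)
  moreover have "(Hs \<circ> (q \<circ> r)) k (Fs (q (r k)) (zs (r k))) = zs (r k) * Fs (q (r k)) (zs (r k))" for k
    using exterior_mapD(5)[OF Es z[of "r k"]] by simp
  ultimately show ?thesis using that[OF r(1) w r(2)] by simp
qed

text \<open>Used in contrapositive form: points at or near \<open>C\<close> have
  \<open>norm (Fs k z) > t\<close> as soon as they lie outside \<open>Cs k\<close>.\<close>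

lemma level_sets_converge:
  assumes s: "0 < t" "t < s" "s < 1"
  shows "\<forall>\<^sub>F k in sequentially. \<forall>z. z \<notin> Cs k \<longrightarrow> norm (Fs k z) \<le> t \<longrightarrow> z \<notin> C \<and> norm (F z) < s"
proof (rule ccontr)
  assume "\<not> ?thesis"
  then have "\<exists>\<^sub>F k in sequentially. \<exists>z. z \<notin> Cs k \<and> norm (Fs k z) \<le> t \<and> \<not> (z \<notin> C \<and> norm (F z) < s)"
    unfolding not_eventually by (rule frequently_elim1) blast
  then obtain q where q: "strict_mono (q :: nat \<Rightarrow> nat)"
      "\<And>k. \<exists>z. z \<notin> Cs (q k) \<and> norm (Fs (q k) z) \<le> t \<and> \<not> (z \<notin> C \<and> norm (F z) < s)"
    using frequently_subseq by blast
  obtain zs where zs: "\<And>k. zs k \<notin> Cs (q k)" "\<And>k. norm (Fs (q k) (zs k)) \<le> t"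
      "\<And>k. \<not> (zs k \<notin> C \<and> norm (F (zs k)) < s)" using q(2) by metis
  have t1: "t < 1" using s by simp
  obtain r w where r: "strict_mono (r :: nat \<Rightarrow> nat)" "norm w \<le> t"
    "(\<lambda>k. Fs (q (r k)) (zs (r k))) \<longlonglongrightarrow> w" "(\<lambda>k. zs (r k) * Fs (q (r k)) (zs (r k))) \<longlonglongrightarrow> H w"
    using inverse_values_converge[OF q(1) zs(1,2) t1] by blast
  show False
  proof (cases "w = 0")
    \<comment> \<open>The limit 0 is possible only for points running to infinity, but those would
      satisfy the claim because \<open>F\<close> is small there.\<close>
    case True
    obtain M where M: "M > 0" "\<And>z. norm z > M \<Longrightarrow> z \<notin> C \<and> norm (F z) < s"
      using exterior_map_small_near_infinity[OF E, of s] s by auto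
    have bd: "norm (zs k) \<le> M" for k using M(2)[of "zs k"] zs(3)[of k] by force
    have "(\<lambda>k. zs (r k) * Fs (q (r k)) (zs (r k))) \<longlonglongrightarrow> 0"
      by (rule Lim_null_comparison[where g = "\<lambda>k. M * norm (Fs (q (r k)) (zs (r k)))"])
         (use bd r(3) True in \<open>auto simp: norm_mult intro!: always_eventually mult_right_mono tendsto_mult_right_zero tendsto_norm_zero\<close>)
    then have "H 0 = 0" using r(4) True LIMSEQ_unique by blast
    then show False using exterior_mapD(8)[OF E] by blast
  next
    case False
    define z where "z = H w / w"
    have w1: "norm w < 1" using r(2) t1 by simp
    have "(\<lambda>k. (zs (r k) * Fs (q (r k)) (zs (r k))) / Fs (q (r k)) (zs (r k))) \<longlonglongrightarrow> z"
      unfolding z_def by (rule tendsto_divide[OF r(4,3) False])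
    then have zlim: "(\<lambda>k. zs (r k)) \<longlonglongrightarrow> z"
      using exterior_mapD(3)[OF Es zs(1)] by simp
    have zC: "z \<notin> C" and Fz: "F z = w" using exterior_mapD(6,7)[OF E False w1] by (auto simp: z_def)
    have "z \<in> {z. z \<notin> C \<and> norm (F z) < s}" using zC Fz r(2) s by simp
    then have "\<forall>\<^sub>F k in sequentially. zs (r k) \<in> {z. z \<notin> C \<and> norm (F z) < s}"
      by (rule topological_tendstoD[OF zlim open_level_set[OF E closed_C(1)]])
    then show False using zs(3) by (auto simp: eventually_sequentially)
  qed
qed

lemma exterior_maps_bounded:
  assumes K: "closed K" "K \<inter> C = {}"
  obtains s where "0 < s" "s < 1"
    "\<forall>\<^sub>F k in sequentially. \<forall>z\<in>K. z \<notin> Cs k \<and> norm (Fs k z) \<le> s"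
proof -
  obtain s1 where s1: "0 < s1" "s1 < 1" "\<And>z. z \<in> K \<Longrightarrow> norm (F z) \<le> s1"
    using exterior_map_bound_closed[OF E K] by blast
  \<comment> \<open>Subordination on the disc of radius \<open>s2\<close> loses the factor
    \<open>1 / s2\<close>; the bound \<open>s1 / s2\<close> is still below 1.\<close>
  obtain s2 where s2: "s1 < s2" "s2 < 1" using dense[OF s1(2)] by blast
  have "\<forall>\<^sub>F k in sequentially. {z. z \<notin> C \<and> norm (F z) \<le> s2} \<inter> Cs k = {}"
    using eventually_avoids[OF closed_level_set[OF E s2(2)]] by auto
  then have "\<forall>\<^sub>F k in sequentially. \<forall>z\<in>K. z \<notin> Cs k \<and> norm (Fs k z) \<le> s1 / s2"
  proof eventually_elim
    case (elim k)
    show ?case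
    proof
      fix z assume z: "z \<in> K"
      then have zC: "z \<notin> C" using K by blast
      then have nz: "F z \<noteq> 0" and z_eq: "H (F z) / F z = z"
        using exterior_mapD(3,5)[OF E zC] by auto
      have Fz: "norm (F z) \<le> s1" using s1(3)[OF z] .
      have "norm (Fs k (H (F z) / F z)) \<le> norm (F z) / s2"
      proof (rule exterior_map_Schwarz(2)[where h = H and r = s2,
            OF Es[of k] closed_C(2) _ exterior_mapD(8)[OF E] _ _ nz])
        show "H holomorphic_on ball 0 s2"
          by (rule holomorphic_on_subset[OF exterior_mapD(2)[OF E]]) (use s2 in auto)
        fix w :: complex assume w: "w \<noteq> 0" "norm w < s2"
        then show "H w / w \<notin> Cs k" using elim exterior_mapD(6,7)[OF E w(1)] s2 by force
      qed (use s1 s2 Fz in auto)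
      also have "\<dots> \<le> s1 / s2" using Fz s1 s2 by (intro divide_right_mono) auto
      finally show "z \<notin> Cs k \<and> norm (Fs k z) \<le> s1 / s2"
        using elim zC Fz s2 z_eq by auto
    qed
  qed
  then show ?thesis using that[of "s1 / s2"] s1 s2 by simp
qed

text \<open>Convergence of the inverse maps suffices: a limit w of values at points tending to z
  satisfies \<open>z * w = H w\<close>, which leaves only \<open>w = F z\<close>.\<close>

lemma exterior_maps_converge_outside:
  assumes K: "compact K" "K \<inter> C = {}" and e: "e > 0"
  shows "\<forall>\<^sub>F k in sequentially. \<forall>z\<in>K. z \<notin> Cs k \<and> dist (Fs k z) (F z) < e"
proof (rule ccontr)
  assume "\<not> ?thesis"
  then have fr: "\<exists>\<^sub>F k in sequentially. \<exists>z\<in>K. \<not> (z \<notin> Cs k \<and> dist (Fs k z) (F z) < e)"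
    unfolding not_eventually by (rule frequently_elim1) blast
  obtain s where s: "0 < s" "s < 1"
    "\<forall>\<^sub>F k in sequentially. \<forall>z\<in>K. z \<notin> Cs k \<and> norm (Fs k z) \<le> s"
    using exterior_maps_bounded[OF compact_imp_closed[OF K(1)] K(2)] by blast
  from frequently_eventually_frequently[OF fr s(3)]
  obtain q where q: "strict_mono (q :: nat \<Rightarrow> nat)"
    "\<And>k. (\<exists>z\<in>K. \<not> (z \<notin> Cs (q k) \<and> dist (Fs (q k) z) (F z) < e))
      \<and> (\<forall>z\<in>K. z \<notin> Cs (q k) \<and> norm (Fs (q k) z) \<le> s)"
    using frequently_subseq by blast
  then have "\<exists>z. z \<in> K \<and> dist (Fs (q k) z) (F z) \<ge> e" for k by (meson not_le)
  then obtain zs where zs: "\<And>k. zs k \<in> K" "\<And>k. dist (Fs (q k) (zs k)) (F (zs k)) \<ge> e" by metis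
  have zs': "zs k \<notin> Cs (q k)" "norm (Fs (q k) (zs k)) \<le> s" for k using q(2) zs(1) by blast+
  obtain r w where r: "strict_mono (r :: nat \<Rightarrow> nat)" "norm w \<le> s"
    "(\<lambda>k. Fs (q (r k)) (zs (r k))) \<longlonglongrightarrow> w" "(\<lambda>k. zs (r k) * Fs (q (r k)) (zs (r k))) \<longlonglongrightarrow> H w"
    using inverse_values_converge[OF q(1) zs'(1,2) s(2)] by blast
  have "seq_compact K" using K(1) compact_imp_seq_compact by blast
  then obtain z p where p: "z \<in> K" "strict_mono (p :: nat \<Rightarrow> nat)" "((\<lambda>k. zs (r k)) \<circ> p) \<longlonglongrightarrow> z"
    using seq_compactE[of K "\<lambda>k. zs (r k)"] zs(1) by metis
  have p3: "(\<lambda>k. zs (r (p k))) \<longlonglongrightarrow> z" using p(3) by (simp add: comp_def)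
  note r3 = LIMSEQ_subseq_LIMSEQ[OF r(3) p(2), unfolded comp_def]
  note r4 = LIMSEQ_subseq_LIMSEQ[OF r(4) p(2), unfolded comp_def]
  have eq: "z * w = H w" using LIMSEQ_unique[OF tendsto_mult[OF p3 r3] r4] .
  then have w0: "w \<noteq> 0" using exterior_mapD(8)[OF E] by auto
  then have z_eq: "z = H w / w" using eq by (simp add: field_simps)
  then have "F z = w" using exterior_mapD(7)[OF E w0] r(2) s(2) by simp
  have "continuous_on K F"
    by (rule continuous_on_subset[OF holomorphic_on_imp_continuous_on[OF exterior_mapD(1)[OF E]]]) (use K in auto)
  then have "(\<lambda>k. F (zs (r (p k)))) \<longlonglongrightarrow> F z"
    by (rule continuous_on_tendsto_compose[OF _ p3 p(1)]) (use zs in auto)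
  then have "(\<lambda>k. dist (Fs (q (r (p k))) (zs (r (p k)))) (F (zs (r (p k))))) \<longlonglongrightarrow> dist w w"
    unfolding \<open>F z = w\<close> by (rule tendsto_dist[OF r3])
  then have "e \<le> dist w w" by (rule LIMSEQ_le_const) (use zs(2) in auto)
  then show False using e by simp
qed

end

section \<open>Splitting a function on an annulus\<close>

text \<open>Differentiation under the integral sign, carried out on balls because the Leibniz rule
  asks for convex sets; holomorphy on an open set is local.\<close>

lemma Cauchy_type_integral_holomorphic:
  fixes p g :: "real \<Rightarrow> complex"
  assumes p: "continuous_on {0..1} p" and g: "continuous_on {0..1} g" and S: "open S"
    and ne: "\<And>z t. z \<in> S \<Longrightarrow> t \<in> {0..1} \<Longrightarrow> g t \<noteq> z"
  shows "(\<lambda>z. integral {0..1} (\<lambda>t. p t / (g t - z))) holomorphic_on S"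
proof -
  have "(\<lambda>z. integral {0..1} (\<lambda>t. p t / (g t - z))) holomorphic_on ball x d"
    if x: "ball x d \<subseteq> S" for x d
    unfolding box_real(2)[symmetric]
  proof (rule leibniz_rule_holomorphic[where fx = "\<lambda>z t. p t / (g t - z)\<^sup>2"])
    fix z t assume z: "z \<in> ball x d" and t: "t \<in> cbox 0 (1::real)"
    then have "g t - z \<noteq> 0" using ne[of z t] x by auto
    then show "((\<lambda>z. p t / (g t - z)) has_field_derivative p t / (g t - z)\<^sup>2) (at z within ball x d)"
      by (auto intro!: derivative_eq_intros simp: power2_eq_square)
  next
    fix z assume z: "z \<in> ball x d"
    then have "z \<in> S" using x by blast
    then have "\<forall>t\<in>{0..1}. g t - z \<noteq> 0" using ne[of z] by simp
    then have "continuous_on {0..1} (\<lambda>t. p t / (g t - z))"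
      by (intro continuous_on_divide continuous_on_diff continuous_on_const p g)
    then show "(\<lambda>t. p t / (g t - z)) integrable_on cbox 0 1" by (simp add: integrable_continuous_interval)
  next
    have "continuous_on (ball x d \<times> {0..1}) (\<lambda>y. p (snd y) / (g (snd y) - fst y)\<^sup>2)"
    proof (intro continuous_intros continuous_on_compose2[OF p continuous_on_snd] continuous_on_compose2[OF g continuous_on_snd])
      show "\<forall>y\<in>ball x d \<times> {0..1}. (g (snd y) - fst y)\<^sup>2 \<noteq> 0"
        using ne x by force
    qed auto
    then show "continuous_on (ball x d \<times> cbox 0 1) (\<lambda>(z, t). p t / (g t - z)\<^sup>2)"
      by (simp add: case_prod_beta)
  qed (rule convex_ball)
  note hol = this
  show ?thesis
    unfolding holomorphic_on_def
  proof (rule ballI, rule field_differentiable_at_within)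
    fix x assume "x \<in> S"
    obtain d where "d > 0" "ball x d \<subseteq> S" by (rule openE[OF S \<open>x \<in> S\<close>])
    then show "(\<lambda>z. integral {0..1} (\<lambda>t. p t / (g t - z))) field_differentiable at x"
      using holomorphic_on_imp_differentiable_at[OF hol[of x d] open_ball] by simp
  qed
qed

text \<open>The difference quotient \<open>q\<close> is holomorphic at \<open>w\<close> too, so its
  integrals over the two homotopic circles cancel. What remains is \<open>p w / (v - w)\<close>,
  with winding number 1 on the outer and 0 on the inner circle.\<close>

lemma annulus_Cauchy_formula:
  assumes p: "p holomorphic_on {w. r0 < norm w \<and> norm w < r3}"
    and r: "0 < r0" "r0 < r1" "r1 < norm w" "norm w < r2" "r2 < r3"
  shows "contour_integral (circlepath 0 r2) (\<lambda>v. p v / (v - w))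
       - contour_integral (circlepath 0 r1) (\<lambda>v. p v / (v - w)) = 2 * of_real pi * \<i> * p w"
proof -
  define A where "A = {w::complex. r0 < norm w \<and> norm w < r3}"
  have opA: "open A"
    unfolding A_def by (intro open_Collect_conj open_Collect_less continuous_intros)
  define q where "q = (\<lambda>v. if v = w then deriv p w else (p v - p w) / (v - w))"
  have holq: "q holomorphic_on A" unfolding q_def using pole_lemma_open[of p A w] p opA by (simp add: A_def)
  have "homotopic_loops A (circlepath 0 r2) (circlepath 0 r1)"
  proof (rule homotopic_loops_linear)
    fix t :: real assume t: "t \<in> {0..1}"
    show "closed_segment (circlepath 0 r2 t) (circlepath 0 r1 t) \<subseteq> A"
    proof
      fix x assume "x \<in> closed_segment (circlepath 0 r2 t) (circlepath 0 r1 t)"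
      then obtain u where u: "0 \<le> u" "u \<le> 1"
          "x = (1 - u) *\<^sub>R circlepath 0 r2 t + u *\<^sub>R circlepath 0 r1 t"
        by (auto simp: in_segment)
      have "x = of_real ((1 - u) * r2 + u * r1) * exp (2 * of_real pi * \<i> * of_real t)"
        unfolding u(3) circlepath by (simp add: scaleR_conv_of_real algebra_simps)
      moreover have "norm (exp (2 * of_real pi * \<i> * of_real t)) = 1"
        by (simp add: norm_exp_eq_Re)
      ultimately have nx: "norm x = \<bar>(1 - u) * r2 + u * r1\<bar>" by (simp add: norm_mult del: of_real_add of_real_mult)
      define X where "X = (1 - u) * (r2 - r1)"
      have "(1 - u) * r2 + u * r1 = r1 + X" by (simp add: X_def algebra_simps)
      moreover have "0 \<le> X" using u r by (simp add: X_def)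
      moreover have "X \<le> 1 * (r2 - r1)" unfolding X_def using u r by (intro mult_right_mono) auto
      ultimately have "r0 < norm x" "norm x < r3" using nx r by auto
      then show "x \<in> A" by (simp add: A_def)
    qed
  qed auto
  then have eq: "contour_integral (circlepath 0 r2) q = contour_integral (circlepath 0 r1) q"
    by (rule Cauchy_theorem_homotopic_loops[OF _ opA holq]) auto
  have one: "((\<lambda>v. 1 / (v - w)) has_contour_integral 2 * of_real pi * \<i>) (circlepath 0 r2)"
    using Cauchy_integral_circlepath_simple[of "\<lambda>_. 1" 0 r2 w] r by auto
  have zero: "((\<lambda>v. 1 / (v - w)) has_contour_integral 0) (circlepath 0 r1)"
    by (rule Cauchy_theorem_disc_simple[of _ 0 "norm w"])
       (use r in \<open>auto intro!: holomorphic_intros\<close>)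
  have intq: "q contour_integrable_on circlepath 0 s" if "s = r1 \<or> s = r2" for s
  proof (rule contour_integrable_holomorphic_simple[OF holq opA])
    show "path_image (circlepath 0 s) \<subseteq> A" using that r by (auto simp: A_def)
  qed auto
  have "contour_integral (circlepath 0 s) (\<lambda>v. p v / (v - w)) = contour_integral (circlepath 0 s) q + p w * I"
    if s: "s = r1 \<or> s = r2" and I: "((\<lambda>v. 1 / (v - w)) has_contour_integral I) (circlepath 0 s)" for s I
  proof (rule contour_integral_unique)
    have "((\<lambda>v. q v + p w * (1 / (v - w))) has_contour_integral contour_integral (circlepath 0 s) q + p w * I) (circlepath 0 s)"
      by (intro has_contour_integral_add has_contour_integral_lmul I has_contour_integral_integral intq s)
    then show "((\<lambda>v. p v / (v - w)) has_contour_integral contour_integral (circlepath 0 s) q + p w * I) (circlepath 0 s)"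
    proof (rule has_contour_integral_eq)
      fix v assume "v \<in> path_image (circlepath 0 s)"
      then have "v \<noteq> w" using s r by auto
      then show "q v + p w * (1 / (v - w)) = p v / (v - w)" by (simp add: q_def diff_divide_distrib)
    qed
  qed
  from this[OF _ one] this[OF _ zero] show ?thesis using eq by simp
qed

lemma contour_integral_circlepath_0:
  "contour_integral (circlepath 0 r) f =
     2 * of_real pi * \<i> * integral {0..1} (\<lambda>t. f (circlepath 0 r t) * circlepath 0 r t)"
proof -
  have "contour_integral (circlepath 0 r) f =
      integral {0..1} (\<lambda>t. (2 * of_real pi * \<i>) * (f (circlepath 0 r t) * circlepath 0 r t))"
    unfolding contour_integral_integral vector_derivative_circlepath
    by (intro integral_cong) (simp add: circlepath mult_ac)
  then show ?thesis by simp
qed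

text \<open>\<open>J s\<close> is the normalised Cauchy integral over the curve \<open>G\<close> of
  the circle, pulled back to the circle: the factor \<open>circlepath 0 s t\<close> is the
  derivative of the path divided by 2 pi i. The kernel differs from \<open>1 / (v - w)\<close> by
  the holomorphic factor \<open>deriv G v / k v\<close>, whose value at \<open>w\<close> is
  1.\<close>

lemma annulus_Cauchy_formula_conformal:
  assumes e: "e holomorphic_on {w. r0 < norm w \<and> norm w < r3}"
    and G: "G holomorphic_on {w. r0 < norm w \<and> norm w < r3}" "inj_on G {w. r0 < norm w \<and> norm w < r3}"
    and r: "0 < r0" "r0 < r1" "r1 < norm w" "norm w < r2" "r2 < r3"
  defines "J \<equiv> \<lambda>s. integral {0..1} (\<lambda>t. e (circlepath 0 s t) * deriv G (circlepath 0 s t) * circlepath 0 s t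
                       / (G (circlepath 0 s t) - G w))"
  shows "J r2 - J r1 = e w"
proof -
  define A where "A = {w::complex. r0 < norm w \<and> norm w < r3}"
  have opA: "open A"
    unfolding A_def by (intro open_Collect_conj open_Collect_less continuous_intros)
  note e = e[folded A_def] and G = G[folded A_def]
  have wA: "w \<in> A" using r by (simp add: A_def)
  define k where "k = (\<lambda>v. if v = w then deriv G w else (G v - G w) / (v - w))"
  have holk: "k holomorphic_on A" unfolding k_def by (rule pole_lemma_open[OF G(1) opA])
  have knz: "k v \<noteq> 0" if "v \<in> A" for v
    using holomorphic_injective_imp_regular[OF G(1) opA G(2) wA] inj_onD[OF G(2) _ that wA]
    by (auto simp: k_def)
  define p where "p = (\<lambda>v. e v * deriv G v / k v)"
  have holp: "p holomorphic_on A"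
    unfolding p_def using knz by (intro holomorphic_intros e holk G(1) opA) auto
  have pw: "p w = e w" using knz[OF wA] by (simp add: p_def k_def)
  have J: "2 * of_real pi * \<i> * J s = contour_integral (circlepath 0 s) (\<lambda>v. p v / (v - w))"
    if s: "s = r1 \<or> s = r2" for s
    unfolding contour_integral_circlepath_0 J_def
  proof (intro arg_cong[where f = "\<lambda>x. 2 * of_real pi * \<i> * x"] integral_cong)
    fix t :: real
    define v where "v = circlepath 0 s t"
    have "norm v = s" using s r by (auto simp: v_def circlepath norm_mult norm_exp_eq_Re)
    then have "v \<noteq> w" "v \<in> A" using s r by (auto simp: A_def)
    moreover from this have "k v \<noteq> 0" using knz by blast
    ultimately have "p v / (v - w) = e v * deriv G v / (G v - G w)" by (simp add: p_def k_def)
    then show "e (circlepath 0 s t) * deriv G (circlepath 0 s t) * circlepath 0 s t / (G (circlepath 0 s t) - G w)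
        = p (circlepath 0 s t) / (circlepath 0 s t - w) * circlepath 0 s t"
      by (simp add: v_def)
  qed
  have "2 * of_real pi * \<i> * (J r2 - J r1) = 2 * of_real pi * \<i> * e w"
    using annulus_Cauchy_formula[OF holp[unfolded A_def] r] J by (simp add: algebra_simps pw)
  then show ?thesis by simp
qed

text \<open>Laurent splitting along level curves of \<open>F\<close>. A large
  \<open>norm (F z)\<close> means close to \<open>C\<close>, so the curve of level \<open>r2\<close>
  gives the part \<open>a\<close> that extends to infinity. \<open>M\<close> precedes
  \<open>e\<close> and \<open>d\<close>: it depends on the curves only.\<close>

lemma annulus_splitting:
  assumes E: "exterior_map C F H" and C: "closed C"
    and r: "0 < r0" "r0 < r1" "r1 < s1" "s1 < s2" "s2 < r2" "r2 < r3" "r3 < 1"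
  obtains M where "M > 0"
   "\<And>e d. e holomorphic_on {w. r0 < norm w \<and> norm w < r3} \<Longrightarrow>
      (\<And>w. norm w = r1 \<or> norm w = r2 \<Longrightarrow> norm (e w) \<le> d) \<Longrightarrow>
      \<exists>a b. a holomorphic_on {z. z \<notin> C \<and> norm (F z) < s2} \<and>
            b holomorphic_on - {z. z \<notin> C \<and> norm (F z) \<le> s1} \<and>
            (\<forall>z. z \<notin> C \<and> norm (F z) < s2 \<longrightarrow> norm (a z) \<le> M * d) \<and>
            (\<forall>z. \<not> (z \<notin> C \<and> norm (F z) \<le> s1) \<longrightarrow> norm (b z) \<le> M * d) \<and>
            (\<forall>z. z \<notin> C \<and> s1 < norm (F z) \<and> norm (F z) < s2 \<longrightarrow> a z - b z = e (F z))"
proof -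
  define A where "A = {w::complex. r0 < norm w \<and> norm w < r3}"
  define G where "G = (\<lambda>w. H w / w)"
  have holG: "G holomorphic_on A"
    unfolding G_def by (intro holomorphic_intros holomorphic_on_subset[OF exterior_mapD(2)[OF E]])
      (use r in \<open>auto simp: A_def\<close>)
  have opA: "open A"
    unfolding A_def by (intro open_Collect_conj open_Collect_less continuous_intros)
  have FG: "G w \<notin> C" "F (G w) = w" if "w \<in> A" for w
  proof -
    have "w \<noteq> 0" "norm w < 1" using that r by (auto simp: A_def)
    then show "G w \<notin> C" "F (G w) = w" using exterior_mapD(6,7)[OF E, of w] by (auto simp: G_def)
  qed
  have GF: "G (F z) = z" if "z \<notin> C" for z
    using exterior_mapD(3,5)[OF E that] by (simp add: G_def)
  have inj: "inj_on G A" by (rule inj_on_inverseI[where g = F]) (rule FG(2))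
  have sA: "sphere 0 s \<subseteq> A" if "s = r1 \<or> s = r2" for s using that r by (auto simp: A_def)
  have cp: "circlepath 0 s t \<in> sphere 0 s" if "s = r1 \<or> s = r2" for s t
    using that r by (auto simp: circlepath norm_mult norm_exp_eq_Re)
  have bounds: "\<exists>B D. B > 0 \<and> D > 0 \<and> (\<forall>w\<in>sphere 0 s. norm (deriv G w) \<le> B) \<and>
      (\<forall>w\<in>sphere 0 s. \<forall>z\<in>T. D \<le> dist (G w) z)"
    if s: "s = r1 \<or> s = r2" and T: "closed T" "T \<inter> G ` sphere 0 s = {}" for s T
  proof -
    have "continuous_on (sphere 0 s) (deriv G)"
      by (intro holomorphic_on_imp_continuous_on holomorphic_on_subset[OF holomorphic_deriv[OF holG opA] sA[OF s]])
    then have "compact (deriv G ` sphere 0 s)" by (rule compact_continuous_image) simp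
    then obtain B where B: "B > 0" "\<forall>x\<in>deriv G ` sphere 0 s. norm x \<le> B"
      using compact_imp_bounded bounded_pos by metis
    have "continuous_on (sphere 0 s) G"
      by (intro holomorphic_on_imp_continuous_on holomorphic_on_subset[OF holG sA[OF s]])
    then have "compact (G ` sphere 0 s)" by (rule compact_continuous_image) simp
    then obtain D where "D > 0" "\<forall>x\<in>G ` sphere 0 s. \<forall>y\<in>T. D \<le> dist x y"
      using separate_compact_closed[OF _ T(1)] T(2) by blast
    then show ?thesis using B by (intro exI[of _ B] exI[of _ D]) auto
  qed
  define P where "P = {z. z \<notin> C \<and> norm (F z) < s2}"
  define Q where "Q = - {z. z \<notin> C \<and> norm (F z) \<le> s1}"
  have opP: "open P" unfolding P_def by (rule open_level_set[OF E C])
  have opQ: "open Q" unfolding Q_def using closed_level_set[OF E, of s1] r by (simp add: open_Compl)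
  have Gsph: "G w \<notin> C" "F (G w) = w" "w \<in> A" if "w \<in> sphere 0 s" "s = r1 \<or> s = r2" for w s
    using FG sA that by blast+
  obtain B2 D2 where b2: "B2 > 0" "D2 > 0" "\<And>w. w\<in>sphere 0 r2 \<Longrightarrow> norm (deriv G w) \<le> B2"
      "\<And>w z. w \<in> sphere 0 r2 \<Longrightarrow> z \<in> P \<Longrightarrow> D2 \<le> dist (G w) z"
  proof -
    have "{z. z \<notin> C \<and> norm (F z) \<le> s2} \<inter> G ` sphere 0 r2 = {}"
      using Gsph[of _ r2] r by auto
    from bounds[OF _ closed_level_set[OF E, of s2] this] r
    obtain B D where "B > 0 \<and> D > 0 \<and> (\<forall>w\<in>sphere 0 r2. norm (deriv G w) \<le> B) \<and>
      (\<forall>w\<in>sphere 0 r2. \<forall>z\<in>{z. z \<notin> C \<and> norm (F z) \<le> s2}. D \<le> dist (G w) z)" by auto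
    then show ?thesis using that[of B D] unfolding P_def by auto
  qed
  obtain B1 D1 where b1: "B1 > 0" "D1 > 0" "\<And>w. w\<in>sphere 0 r1 \<Longrightarrow> norm (deriv G w) \<le> B1"
      "\<And>w z. w \<in> sphere 0 r1 \<Longrightarrow> z \<in> Q \<Longrightarrow> D1 \<le> dist (G w) z"
  proof -
    have disj: "- {z. z \<notin> C \<and> norm (F z) < s1} \<inter> G ` sphere 0 r1 = {}"
      using Gsph[of _ r1] r by auto
    have cl: "closed (- {z. z \<notin> C \<and> norm (F z) < s1})"
      using open_level_set[OF E C] by (simp add: closed_Compl)
    have "r1 = r1 \<or> r1 = r2" by simp
    from bounds[OF this cl disj] obtain B D where BD: "B > 0 \<and> D > 0 \<and> (\<forall>w\<in>sphere 0 r1. norm (deriv G w) \<le> B) \<and>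
      (\<forall>w\<in>sphere 0 r1. \<forall>z\<in>- {z. z \<notin> C \<and> norm (F z) < s1}. D \<le> dist (G w) z)"
      by (elim exE) (rule that)
    have Qsub: "Q \<subseteq> - {z. z \<notin> C \<and> norm (F z) < s1}" unfolding Q_def by auto
    show ?thesis
    proof (rule that[of B D])
      fix w z :: complex assume "w \<in> sphere 0 r1" "z \<in> Q"
      then show "D \<le> dist (G w) z" using BD Qsub by blast
    qed (use BD in blast)+
  qed
  \<comment> \<open>For each curve, a bound of the derivative of \<open>G\<close> divided by the
    distance from the region where the integral is used. The gaps between \<open>r1\<close> and
    \<open>s1\<close> and between \<open>s2\<close> and \<open>r2\<close> make these distances
    positive.\<close>
  define M where "M = B1 / D1 + B2 / D2"
  have M: "M > 0" "B1 / D1 \<le> M" "B2 / D2 \<le> M" using b1 b2 by (auto simp: M_def add_pos_pos)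
  show ?thesis
  proof (rule that[OF M(1)])
    fix e d assume e: "e holomorphic_on {w. r0 < norm w \<and> norm w < r3}"
      and d: "\<And>w. norm w = r1 \<or> norm w = r2 \<Longrightarrow> norm (e w) \<le> d"
    have "norm (complex_of_real r1) = r1" using r by simp
    then have d0: "d \<ge> 0" using order_trans[OF norm_ge_zero d[of "of_real r1"]] by simp
    define J where "J = (\<lambda>s z. integral {0..1} (\<lambda>t. e (circlepath 0 s t) * deriv G (circlepath 0 s t) * circlepath 0 s t
                       / (G (circlepath 0 s t) - z)))"
    have contcp: "continuous_on {0..1} (circlepath 0 s)" for s
      using path_circlepath unfolding path_def by blast
    have contf: "continuous_on {0..1} (\<lambda>t. f (circlepath 0 s t))"
      if "f holomorphic_on A" "s = r1 \<or> s = r2" for f s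
      by (rule continuous_on_compose2[OF holomorphic_on_imp_continuous_on[OF that(1)] contcp])
         (use cp[OF that(2)] sA[OF that(2)] in blast)
    have contp: "continuous_on {0..1} (\<lambda>t. e (circlepath 0 s t) * deriv G (circlepath 0 s t) * circlepath 0 s t)"
      if "s = r1 \<or> s = r2" for s
      by (intro continuous_on_mult contf contcp that e[folded A_def] holomorphic_deriv holG opA)
    have holJ: "J s holomorphic_on T" if "s = r1 \<or> s = r2" "open T" "T \<inter> G ` sphere 0 s = {}" for s T
      unfolding J_def
      by (rule Cauchy_type_integral_holomorphic[OF contp[OF that(1)] contf[OF holG that(1)] that(2)])
         (use cp[OF that(1)] that(3) in blast)
    have bdJ: "norm (J s z) \<le> B / D * d" if s: "s = r1 \<or> s = r2" and "B > 0" "D > 0"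
      "\<And>w. w \<in> sphere 0 s \<Longrightarrow> norm (deriv G w) \<le> B" "\<And>w. w \<in> sphere 0 s \<Longrightarrow> D \<le> dist (G w) z" for s z B D
    proof -
      have "norm (J s z) \<le> B / D * d * (1 - 0)"
        unfolding J_def
      proof (rule integral_bound)
        have gz: "G (circlepath 0 s t) - z \<noteq> 0" for t
          using that(5)[OF cp[OF s, of t]] that(3) by auto
        show "continuous_on {0..1} (\<lambda>t. e (circlepath 0 s t) * deriv G (circlepath 0 s t) * circlepath 0 s t / (G (circlepath 0 s t) - z))"
          by (intro continuous_on_divide contp s continuous_on_diff contf holG continuous_on_const) (use gz in blast)
        fix t :: real
        define v where "v = circlepath 0 s t"
        have v: "v \<in> sphere 0 s" using cp[OF s] by (simp add: v_def)
        then have "norm (e v) \<le> d" "norm v \<le> 1" using d s r by auto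
        then have "norm (e v) * norm (deriv G v) * norm v \<le> d * B * 1"
          using that(2) that(4)[OF v] d0 by (intro mult_mono) auto
        moreover have "D \<le> norm (G v - z)" using that(5)[OF v] by (simp add: dist_norm)
        ultimately have "norm (e v) * norm (deriv G v) * norm v / norm (G v - z) \<le> (d * B * 1) / D"
          using that(2,3) d0 by (intro frac_le) auto
        then show "norm (e (circlepath 0 s t) * deriv G (circlepath 0 s t) * circlepath 0 s t / (G (circlepath 0 s t) - z)) \<le> B / D * d"
          by (simp add: v_def norm_mult norm_divide mult_ac)
      qed auto
      then show ?thesis by simp
    qed
    have "J r2 holomorphic_on P"
      by (rule holJ[OF _ opP]) (use Gsph[of _ r2] r in \<open>auto simp: P_def\<close>)
    moreover have "J r1 holomorphic_on Q"
      by (rule holJ[OF _ opQ]) (use Gsph[of _ r1] r in \<open>auto simp: Q_def\<close>)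
    moreover have "norm (J r2 z) \<le> M * d" if "z \<in> P" for z
      using bdJ[of r2 B2 D2 z] b2 that mult_right_mono[OF M(3) d0] by fastforce
    moreover have "norm (J r1 z) \<le> M * d" if "z \<in> Q" for z
      using bdJ[of r1 B1 D1 z] b1 that mult_right_mono[OF M(2) d0] by fastforce
    moreover have "J r2 z - J r1 z = e (F z)" if "z \<notin> C" "s1 < norm (F z)" "norm (F z) < s2" for z
      using annulus_Cauchy_formula_conformal[OF e, of G r1 "F z" r2] holG inj r that GF[OF that(1)]
      by (simp add: J_def A_def)
    ultimately show "\<exists>a b. a holomorphic_on {z. z \<notin> C \<and> norm (F z) < s2} \<and>
            b holomorphic_on - {z. z \<notin> C \<and> norm (F z) \<le> s1} \<and>
            (\<forall>z. z \<notin> C \<and> norm (F z) < s2 \<longrightarrow> norm (a z) \<le> M * d) \<and>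
            (\<forall>z. \<not> (z \<notin> C \<and> norm (F z) \<le> s1) \<longrightarrow> norm (b z) \<le> M * d) \<and>
            (\<forall>z. z \<notin> C \<and> s1 < norm (F z) \<and> norm (F z) < s2 \<longrightarrow> a z - b z = e (F z))"
      unfolding P_def Q_def by (intro exI[of _ "J r2"] exI[of _ "J r1"]) auto
  qed
qed

section \<open>Transplantation\<close>

text \<open>A Cousin datum: \<open>f + u\<close> on \<open>P\<close> and \<open>v\<close> on
  \<open>Q - K\<close> agree on the overlap, so together they continue \<open>f\<close> up to
  \<open>K\<close> at cost \<open>e\<close>. On \<open>P\<close> only the correction
  \<open>u\<close> is recorded, because the corrections of several components are added to the same
  \<open>f\<close>.\<close>

definition patches ::
  "(complex \<Rightarrow> complex) \<Rightarrow> complex set \<Rightarrow> complex set \<Rightarrow> complex set \<Rightarrow> real \<Rightarrow>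
    (complex \<Rightarrow> complex) \<Rightarrow> (complex \<Rightarrow> complex) \<Rightarrow> bool" where
  "patches f K P Q e u v \<longleftrightarrow> K \<inter> P = {} \<and> u holomorphic_on P \<and> v holomorphic_on Q - K \<and>
     (\<forall>z\<in>P. norm (u z) \<le> e) \<and> (\<forall>z\<in>Q - K. norm (v z) \<le> 1 + e) \<and> (\<forall>z\<in>P \<inter> Q. v z = f z + u z)"

text \<open>Near \<open>C\<close> the function \<open>f\<close> is replaced by \<open>f\<close> composed with the conformal map from the
exterior of \<open>Cs k\<close> to the exterior of \<open>C\<close>. On an annulus around \<open>C\<close> this map is close to the
identity, so the resulting small discrepancy splits into the corrections \<open>u\<close> and \<open>v\<close>.\<close>

lemma (in exterior_convergence) local_transplant:
  assumes N: "open N" "C \<subseteq> N" and f: "f holomorphic_on N - C"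
    and fb: "\<And>z. z \<in> N - C \<Longrightarrow> norm (f z) \<le> 1"
  obtains P Q where "open P" "open Q" "P \<union> Q = UNIV" "P \<inter> C = {}" "- N \<subseteq> P" "C \<subseteq> Q" "Q \<subseteq> N"
    "\<And>e. e > 0 \<Longrightarrow> \<forall>\<^sub>F k in sequentially. \<exists>u v. patches f (Cs k) P Q e u v"
proof -
  obtain r where r: "0 < r" "r < 1" "\<And>z. z \<in> - N \<Longrightarrow> norm (F z) \<le> r"
    using exterior_map_bound_closed[OF E, of "- N"] N by (auto simp: closed_Compl)
  \<comment> \<open>The levels increase towards \<open>C\<close>. \<open>r\<close> bounds
    \<open>F\<close> off \<open>N\<close>; the gap to \<open>r0\<close> pays for passing from
    \<open>F\<close> to \<open>Fs k\<close>; the circles \<open>r1\<close> and \<open>r2\<close>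
    carry the Cauchy integrals; \<open>s1\<close> and \<open>s2\<close> bound the overlap of
    \<open>P\<close> and \<open>Q\<close>; \<open>Cs k\<close> stays beyond
    \<open>r3\<close>.\<close>
  obtain r0 where r0: "r < r0" "r0 < 1" using dense[OF r(2)] by blast
  obtain r1 where r1: "r0 < r1" "r1 < 1" using dense[OF r0(2)] by blast
  obtain s1 where s1: "r1 < s1" "s1 < 1" using dense[OF r1(2)] by blast
  obtain s2 where s2: "s1 < s2" "s2 < 1" using dense[OF s1(2)] by blast
  obtain r2 where r2: "s2 < r2" "r2 < 1" using dense[OF s2(2)] by blast
  obtain r3 where r3: "r2 < r3" "r3 < 1" using dense[OF r2(2)] by blast
  have r00: "0 < r0" using r r0 by simp
  note rr = r(1,2) r0 r1 s1 s2 r2 r3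
  define P where "P = {z. z \<notin> C \<and> norm (F z) < s2}"
  define Q where "Q = - {z. z \<notin> C \<and> norm (F z) \<le> s1}"
  have opP: "open P" unfolding P_def by (rule open_level_set[OF E closed_C(1)])
  have opQ: "open Q" unfolding Q_def using closed_level_set[OF E s1(2)] by (simp add: open_Compl)
  have PQ: "P \<union> Q = UNIV" "P \<inter> C = {}" "C \<subseteq> Q" using s2 by (auto simp: P_def Q_def)
  have NP: "- N \<subseteq> P"
  proof
    fix z assume z: "z \<in> - N"
    then show "z \<in> P" using r(3)[OF z] N(2) rr by (auto simp: P_def)
  qed
  have QN: "Q \<subseteq> N"
  proof
    fix z assume z: "z \<in> Q"
    show "z \<in> N"
    proof (rule ccontr)
      assume "z \<notin> N"
      then show False using r(3)[of z] N(2) rr z by (auto simp: Q_def)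
    qed
  qed
  define G where "G = (\<lambda>w. H w / w)"
  have FG: "G w \<notin> C" "F (G w) = w" if "w \<noteq> 0" "norm w < 1" for w
    using exterior_mapD(6,7)[OF E that] by (auto simp: G_def)
  have GF: "G (F z) = z" if "z \<notin> C" for z
    using exterior_mapD(3,5)[OF E that] by (simp add: G_def)
  define A where "A = {w::complex. r < norm w \<and> norm w < 1}"
  have A0: "w \<noteq> 0" "norm w < 1" if "w \<in> A" for w using that r by (auto simp: A_def)
  have GA: "G w \<in> N - C" if "w \<in> A" for w
  proof -
    have "norm (F (G w)) > r" using FG(2)[OF A0[OF that]] that by (simp add: A_def)
    then show ?thesis using r(3)[of "G w"] FG(1)[OF A0[OF that]] by force
  qed
  \<comment> \<open>\<open>f\<close> in the disc coordinate: \<open>fh (Fs k z)\<close> is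
    \<open>f\<close> after the conformal map from the exterior of \<open>Cs k\<close> to that of
    \<open>C\<close>.\<close>
  define fh where "fh = (\<lambda>w. f (G w))"
  have holG: "G holomorphic_on ball 0 1 - {0}"
    unfolding G_def by (intro holomorphic_intros holomorphic_on_subset[OF exterior_mapD(2)[OF E]]) auto
  have holfh: "fh holomorphic_on A"
  proof -
    have "(f \<circ> G) holomorphic_on A"
      by (rule holomorphic_on_compose_gen[OF holomorphic_on_subset[OF holG] f]) (use A0 GA in auto)
    then show ?thesis by (simp add: fh_def comp_def)
  qed
  have bfh: "norm (fh w) \<le> 1" if "w \<in> A" for w unfolding fh_def by (rule fb[OF GA[OF that]])
  define L where "L = cball (0::complex) r3 - ball 0 r0"
  have comL: "compact L" unfolding L_def by (intro compact_diff compact_cball open_ball)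
  have LA: "L \<subseteq> A" using rr by (auto simp: L_def A_def)
  have ucont: "uniformly_continuous_on L fh"
    by (intro compact_uniformly_continuous comL holomorphic_on_imp_continuous_on holomorphic_on_subset[OF holfh LA])
  define S where "S = sphere 0 r1 \<union> sphere (0::complex) r2"
  have S0: "w \<noteq> 0" "norm w < 1" if "w \<in> S" for w using that rr r00 by (auto simp: S_def)
  have comGS: "compact (G ` S)"
  proof (rule compact_continuous_image)
    show "continuous_on S G"
      by (intro holomorphic_on_imp_continuous_on holomorphic_on_subset[OF holG]) (use S0 in auto)
  qed (auto simp: S_def intro: compact_Un)
  have disGS: "G ` S \<inter> C = {}" using FG(1) S0 by blast
  obtain M where M: "M > 0"
   "\<And>e d. e holomorphic_on {w. r0 < norm w \<and> norm w < r3} \<Longrightarrow>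
      (\<And>w. norm w = r1 \<or> norm w = r2 \<Longrightarrow> norm (e w) \<le> d) \<Longrightarrow>
      \<exists>a b. a holomorphic_on {z. z \<notin> C \<and> norm (F z) < s2} \<and>
            b holomorphic_on - {z. z \<notin> C \<and> norm (F z) \<le> s1} \<and>
            (\<forall>z. z \<notin> C \<and> norm (F z) < s2 \<longrightarrow> norm (a z) \<le> M * d) \<and>
            (\<forall>z. \<not> (z \<notin> C \<and> norm (F z) \<le> s1) \<longrightarrow> norm (b z) \<le> M * d) \<and>
            (\<forall>z. z \<notin> C \<and> s1 < norm (F z) \<and> norm (F z) < s2 \<longrightarrow> a z - b z = e (F z))"
  proof (rule annulus_splitting[OF E closed_C(1) r00 r1(1) s1(1) s2(1) r2(1) r3(1) r3(2)], goal_cases)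
    case (1 M)
    show ?case by (rule 1(1)[OF 1(2)]) (rule 1(3), blast+)
  qed
  show ?thesis
  proof (rule that[OF opP opQ PQ(1,2) NP PQ(3) QN])
    fix e :: real assume e: "e > 0"
    define d where "d = e / M"
    have d: "d > 0" "M * d = e" using e M(1) by (auto simp: d_def)
    obtain h where h: "h > 0" "\<And>w w'. w \<in> L \<Longrightarrow> w' \<in> L \<Longrightarrow> dist w' w < h \<Longrightarrow> dist (fh w') (fh w) < d"
      using ucont d(1) unfolding uniformly_continuous_on_def by meson
    \<comment> \<open>A point of either circle moved by less than \<open>h'\<close> stays in
      \<open>L\<close>, where the uniform continuity of \<open>fh\<close> applies.\<close>
    define h' where "h' = min h (min (r1 - r0) (r3 - r2))"
    have h': "h' > 0" "h' \<le> h" "h' \<le> r1 - r0" "h' \<le> r3 - r2" using h rr by (auto simp: h'_def)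
    have ev1: "\<forall>\<^sub>F k in sequentially. {z. z \<notin> C \<and> norm (F z) \<le> r3} \<inter> Cs k = {}"
      by (rule eventually_avoids[OF closed_level_set[OF E r3(2)]]) auto
    have ev2: "\<forall>\<^sub>F k in sequentially. \<forall>z. z \<notin> Cs k \<longrightarrow> norm (Fs k z) \<le> r \<longrightarrow> z \<notin> C \<and> norm (F z) < r0"
      by (rule level_sets_converge[OF r(1) r0])
    have ev3: "\<forall>\<^sub>F k in sequentially. \<forall>z\<in>G ` S. z \<notin> Cs k \<and> dist (Fs k z) (F z) < h'"
      by (rule exterior_maps_converge_outside[OF comGS disGS h'(1)])
    from ev1 ev2 ev3 show "\<forall>\<^sub>F k in sequentially. \<exists>u v. patches f (Cs k) P Q e u v"
    proof eventually_elim
      case (elim k)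
      have FsA: "Fs k z \<in> A" if "z \<notin> Cs k" "\<not> (z \<notin> C \<and> norm (F z) < r0)" for z
        using elim(2) that exterior_mapD(4)[OF Es that(1)] by (force simp: A_def not_le)
      define A' where "A' = {w::complex. r0 < norm w \<and> norm w < r3}"
      have A': "w \<noteq> 0" "norm w < 1" "w \<in> A" if "w \<in> A'" for w using that rr r00 by (auto simp: A'_def A_def)
      have GCs: "G w \<notin> Cs k" if "w \<in> A'" for w
      proof -
        have "norm (F (G w)) \<le> r3" using FG(2)[OF A'(1,2)[OF that]] that by (simp add: A'_def)
        then show ?thesis using elim(1) FG(1)[OF A'(1,2)[OF that]] by blast
      qed
      have FsG: "Fs k (G w) \<in> A" if "w \<in> A'" for w
        using FsA[OF GCs[OF that]] FG(2)[OF A'(1,2)[OF that]] that by (auto simp: A'_def)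
      \<comment> \<open>The discrepancy in the disc coordinate. It is holomorphic on the whole
        annulus but has to be small on two circles only, which form a compact set off
        \<open>C\<close>.\<close>
      define err where "err = (\<lambda>w. fh (Fs k (G w)) - fh w)"
      have "err holomorphic_on A'"
      proof -
        have "(Fs k \<circ> G) holomorphic_on A'"
          by (rule holomorphic_on_compose_gen[OF holomorphic_on_subset[OF holG] exterior_mapD(1)[OF Es]])
             (use A' GCs in auto)
        then have "(fh \<circ> (Fs k \<circ> G)) holomorphic_on A'"
          by (rule holomorphic_on_compose_gen[OF _ holfh]) (use FsG in auto)
        moreover have "fh holomorphic_on A'" by (rule holomorphic_on_subset[OF holfh]) (use A' in auto)
        ultimately show ?thesis unfolding err_def by (intro holomorphic_on_diff) (simp_all add: comp_def)
      qed
      moreover have "norm (err w) \<le> d" if w: "norm w = r1 \<or> norm w = r2" for w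
      proof -
        have wS: "w \<in> S" using w by (auto simp: S_def)
        have "dist (Fs k (G w)) w < h'" using elim(3) FG(2)[OF S0[OF wS]] wS by auto
        moreover have "\<bar>norm (Fs k (G w)) - norm w\<bar> \<le> dist (Fs k (G w)) w"
          using norm_triangle_ineq3[of "Fs k (G w)" w] by (simp add: dist_norm)
        ultimately have "dist (Fs k (G w)) w < h" "Fs k (G w) \<in> L" "w \<in> L"
          using h' w rr by (auto simp: L_def)
        then have "dist (fh (Fs k (G w))) (fh w) < d" using h(2) by blast
        then show ?thesis by (simp add: err_def dist_norm)
      qed
      ultimately have "\<exists>a b. a holomorphic_on P \<and> b holomorphic_on Q \<and>
            (\<forall>z. z \<notin> C \<and> norm (F z) < s2 \<longrightarrow> norm (a z) \<le> M * d) \<and>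
            (\<forall>z. \<not> (z \<notin> C \<and> norm (F z) \<le> s1) \<longrightarrow> norm (b z) \<le> M * d) \<and>
            (\<forall>z. z \<notin> C \<and> s1 < norm (F z) \<and> norm (F z) < s2 \<longrightarrow> a z - b z = err (F z))"
        unfolding P_def Q_def A'_def by (rule M(2))
      then obtain a b where ab: "a holomorphic_on P" "b holomorphic_on Q"
          "\<forall>z. z \<notin> C \<and> norm (F z) < s2 \<longrightarrow> norm (a z) \<le> M * d"
          "\<forall>z. \<not> (z \<notin> C \<and> norm (F z) \<le> s1) \<longrightarrow> norm (b z) \<le> M * d"
          "\<forall>z. z \<notin> C \<and> s1 < norm (F z) \<and> norm (F z) < s2 \<longrightarrow> a z - b z = err (F z)"
        by (elim exE conjE) (rule that)
      have QA: "Fs k z \<in> A" if "z \<in> Q - Cs k" for z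
        by (rule FsA) (use that rr in \<open>auto simp: Q_def\<close>)
      define v where "v = (\<lambda>z. fh (Fs k z) + b z)"
      have "(fh \<circ> Fs k) holomorphic_on Q - Cs k"
        by (rule holomorphic_on_compose_gen[OF holomorphic_on_subset[OF exterior_mapD(1)[OF Es]] holfh])
           (use QA in auto)
      then have holv: "v holomorphic_on Q - Cs k"
        unfolding v_def by (intro holomorphic_on_add holomorphic_on_subset[OF ab(2)]) (auto simp: comp_def)
      have bv: "norm (v z) \<le> 1 + e" if z: "z \<in> Q - Cs k" for z
      proof -
        have "norm (b z) \<le> e" using ab(4) d(2) z by (auto simp: Q_def)
        then show ?thesis
          unfolding v_def using bfh[OF QA[OF z]] norm_triangle_ineq[of "fh (Fs k z)" "b z"] by linarith
      qed
      have eqv: "v z = f z + a z" if z: "z \<in> P \<inter> Q" for z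
      proof -
        have zC: "z \<notin> C" "s1 < norm (F z)" "norm (F z) < s2" using z by (auto simp: P_def Q_def)
        then have "a z - b z = fh (Fs k z) - f z"
          using ab(5) GF[OF zC(1)] by (simp add: err_def fh_def)
        then show ?thesis by (simp add: v_def algebra_simps)
      qed
      have "P \<inter> Cs k = {}" using elim(1) rr by (force simp: P_def)
      moreover have "\<forall>z\<in>P. norm (a z) \<le> e" using ab(3) d(2) by (auto simp: P_def)
      ultimately show ?case
        unfolding patches_def using ab(1) holv bv eqv by (intro exI[of _ a] exI[of _ v]) blast
    qed
  qed
qed

section \<open>Convergence of the complementary components\<close>

lemma infty_domain_Un:
  assumes U: "infty_domain U" and T: "open T" "connected T" "T \<inter> U \<noteq> {}"
  shows "infty_domain (U \<union> T)"
proof -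
  have "connected (U \<union> T)" using U T by (intro connected_Un) (auto simp: infty_domain_def)
  moreover have "bounded (- (U \<union> T))"
    by (rule bounded_subset[of "- U"]) (use U in \<open>auto simp: infty_domain_def\<close>)
  moreover have "open (U \<union> T)" using U T(1) by (auto simp: infty_domain_def)
  ultimately show ?thesis by (simp add: infty_domain_def)
qed

lemma kernel_eventually:
  "is_kernel Us U \<Longrightarrow> closed K \<Longrightarrow> K \<subseteq> U \<Longrightarrow> \<forall>\<^sub>F k in sequentially. K \<subseteq> Us k"
  unfolding is_kernel_def kernel_cand_def by blast

text \<open>Maximality of the kernel becomes a local test: near each point of \<open>T\<close> one
  ball must eventually lie in \<open>Us k\<close>. That \<open>T\<close> meets \<open>U\<close>
  keeps the union connected.\<close>

lemma kernel_enlarge: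
  assumes ker: "is_kernel Us U" and T: "open T" "connected T" "T \<inter> U \<noteq> {}"
    and loc: "\<And>x. x \<in> T \<Longrightarrow> \<exists>e>0. \<forall>\<^sub>F k in sequentially. ball x e \<subseteq> Us k"
  shows "T \<subseteq> U"
proof -
  have U: "infty_domain U" using ker by (simp add: is_kernel_def kernel_cand_def)
  obtain R where R: "R > 0" "- ball 0 R \<subseteq> U" using infty_domain_radius[OF U] .
  have locU: "\<exists>e>0. \<forall>\<^sub>F k in sequentially. ball x e \<subseteq> Us k" if "x \<in> U \<union> T" for x
  proof (cases "x \<in> T")
    case False
    then have "x \<in> U" "open U" using that U by (auto simp: infty_domain_def)
    then obtain e where e: "e > 0" "cball x e \<subseteq> U" using open_contains_cball by metis
    then have "\<forall>\<^sub>F k in sequentially. cball x e \<subseteq> Us k"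
      by (intro kernel_eventually[OF ker]) auto
    then have "\<forall>\<^sub>F k in sequentially. ball x e \<subseteq> Us k"
      by eventually_elim (use ball_subset_cball in blast)
    then show ?thesis using e by blast
  qed (use loc in blast)
  have "kernel_cand (\<lambda>k. - (- Us k)) (U \<union> T)"
  proof (rule kernel_candI[OF infty_domain_Un[OF U T]])
    have "\<forall>\<^sub>F k in sequentially. - ball 0 R \<subseteq> Us k"
      by (rule kernel_eventually[OF ker _ R(2)]) (simp add: closed_Compl)
    then show "\<forall>\<^sub>F k in sequentially. - Us k \<subseteq> ball 0 R" by eventually_elim blast
    fix s :: "nat \<Rightarrow> nat" and zs z
    assume s: "strict_mono s" "\<And>k. zs k \<in> - Us (s k)" "zs \<longlonglongrightarrow> z"
    show "z \<notin> U \<union> T"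
    proof
      assume "z \<in> U \<union> T"
      then obtain e where e: "e > 0" "\<forall>\<^sub>F k in sequentially. ball z e \<subseteq> Us k" using locU by blast
      have "\<forall>\<^sub>F k in sequentially. zs k \<in> ball z e"
        by (rule topological_tendstoD[OF s(3)]) (use e in auto)
      moreover have "\<forall>\<^sub>F k in sequentially. ball z e \<subseteq> Us (s k)"
        by (rule eventually_subseq_sequentially[OF e(2) s(1)])
      ultimately have "\<forall>\<^sub>F k in sequentially. False"
        by eventually_elim (use s(2) in blast)
      then show False by simp
    qed
  qed
  then have "kernel_cand Us (U \<union> T)" by simp
  then have "U \<union> T \<subseteq> U" using ker unfolding is_kernel_def by blast
  then show ?thesis by blast
qed

lemma component_full_continuum:
  assumes U: "infty_domain U" and C: "C \<in> components (- U)" and nd: "\<And>z. C \<noteq> {z}"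
  shows "full_continuum C"
proof -
  have "closed (- U)" "bounded (- U)" "connected U" using U by (auto simp: infty_domain_def closed_Compl)
  then have "compact C"
    using C closed_components in_components_subset bounded_subset compact_eq_bounded_closed by metis
  moreover have "connected (- C)"
    using component_complement_connected[OF \<open>connected U\<close> C] .
  ultimately show ?thesis
    using C nd in_components_connected in_components_nonempty unfolding full_continuum_def by blast
qed

lemma connected_neighbourhood:
  fixes C :: "'a::real_normed_vector set"
  assumes "connected C" "d > 0"
  shows "connected (\<Union>x\<in>C. ball x d)"
proof -
  have "connected (C \<union> \<Union>((\<lambda>x. ball x d) ` C))"
  proof (rule connected_Un_UN[OF assms(1)])
    fix X assume "X \<in> (\<lambda>x. ball x d) ` C"
    then obtain x where "x \<in> C" "X = ball x d" by blast
    then show "connected X" "C \<inter> X \<noteq> {}" using assms(2) by auto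
  qed
  moreover have "C \<union> \<Union>((\<lambda>x. ball x d) ` C) = (\<Union>x\<in>C. ball x d)" using assms(2) by auto
  ultimately show ?thesis by simp
qed

lemma separate_finite_compact:
  fixes J :: "'a::heine_borel set set"
  assumes J: "finite J" "\<And>C. C \<in> J \<Longrightarrow> compact C" "\<And>C D. C \<in> J \<Longrightarrow> D \<in> J \<Longrightarrow> C \<noteq> D \<Longrightarrow> C \<inter> D = {}"
  obtains d where "d > 0"
    "\<And>C D x y. C \<in> J \<Longrightarrow> D \<in> J \<Longrightarrow> C \<noteq> D \<Longrightarrow> x \<in> C \<Longrightarrow> y \<in> D \<Longrightarrow> d \<le> dist x y"
proof -
  have "\<exists>d>0. fst p \<noteq> snd p \<longrightarrow> (\<forall>x\<in>fst p. \<forall>y\<in>snd p. d \<le> dist x y)" if p: "p \<in> J \<times> J" for p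
  proof (cases "fst p = snd p")
    case False
    have "fst p \<in> J" "snd p \<in> J" using p by auto
    then obtain d where "d > 0" "\<forall>x\<in>fst p. \<forall>y\<in>snd p. d \<le> dist x y"
      using separate_compact_closed[OF J(2) compact_imp_closed[OF J(2)] J(3)] False by metis
    then show ?thesis by blast
  qed (auto intro: exI[of _ 1])
  then obtain f where f: "\<And>p. p \<in> J \<times> J \<Longrightarrow> f p > 0"
     "\<And>p. p \<in> J \<times> J \<Longrightarrow> fst p \<noteq> snd p \<Longrightarrow> (\<forall>x\<in>fst p. \<forall>y\<in>snd p. f p \<le> dist x y)" by metis
  \<comment> \<open>The inserted 1 covers the case of an empty \<open>J\<close>.\<close>
  define d where "d = Min (insert (1::real) (f ` (J \<times> J)))"
  have fin: "finite (insert (1::real) (f ` (J \<times> J)))" using J(1) by simp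
  have "d > 0" unfolding d_def using fin f(1) by (subst Min_gr_iff) auto
  moreover have "d \<le> dist x y" if "C \<in> J" "D \<in> J" "C \<noteq> D" "x \<in> C" "y \<in> D" for C D x y
  proof -
    have "d \<le> f (C, D)" unfolding d_def using fin that by (intro Min_le) auto
    also have "\<dots> \<le> dist x y" using f(2)[of "(C, D)"] that by auto
    finally show ?thesis .
  qed
  ultimately show ?thesis using that by blast
qed

section \<open>Matching the components of the complements\<close>

locale nconn_convergence =
  fixes n :: nat and U :: "complex set" and Us :: "nat \<Rightarrow> complex set"
  assumes U: "nondeg_nconn n U" and Us: "\<And>k. nondeg_nconn n (Us k)" and conv: "cara_conv Us U"
begin

lemma infty_domain_U: "infty_domain U" "infty_domain (Us k)"
  using U Us by (auto simp: nondeg_nconn_def)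

lemma open_U: "open U" "open (Us k)"
  using infty_domain_U by (auto simp: infty_domain_def)

lemma kernel_subseq: "strict_mono r \<Longrightarrow> is_kernel (\<lambda>k. Us (r k)) U"
  using conv unfolding cara_conv_def by (simp add: comp_def)

lemma kernel: "is_kernel Us U"
  using kernel_subseq[OF strict_mono_id] by simp

text \<open>These neighbourhoods do not depend on \<open>k\<close>. They label the components of
  \<open>- Us k\<close> by those of \<open>- U\<close>: the one belonging to \<open>C\<close> is
  \<open>- Us k \<inter> N C\<close>.\<close>

definition separating :: "(complex set \<Rightarrow> complex set) \<Rightarrow> bool" where
  "separating N \<longleftrightarrow>
     (\<forall>C\<in>components (- U). open (N C) \<and> connected (N C) \<and> C \<subseteq> N C \<and> bounded (N C)) \<and>
     (\<forall>C\<in>components (- U). \<forall>D\<in>components (- U). C \<noteq> D \<longrightarrow> N C \<inter> N D = {})"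

lemma separatingD:
  assumes "separating N"
  shows "C \<in> components (- U) \<Longrightarrow> open (N C) \<and> connected (N C) \<and> C \<subseteq> N C \<and> bounded (N C)"
    "C \<in> components (- U) \<Longrightarrow> D \<in> components (- U) \<Longrightarrow> C \<noteq> D \<Longrightarrow> N C \<inter> N D = {}"
  using assms unfolding separating_def by blast+

lemma separating_exists: "\<exists>N. separating N"
proof -
  let ?J = "components (- U)"
  have fin: "finite ?J" using U by (simp add: nondeg_nconn_def)
  have full: "full_continuum C" if "C \<in> ?J" for C
    by (rule component_full_continuum[OF infty_domain_U(1) that]) (use U that in \<open>auto simp: nondeg_nconn_def\<close>)
  have comp: "compact C" if "C \<in> ?J" for C using full[OF that] by (simp add: full_continuum_def)
  obtain d where d: "d > 0"
    "\<And>C D x y. C \<in> ?J \<Longrightarrow> D \<in> ?J \<Longrightarrow> C \<noteq> D \<Longrightarrow> x \<in> C \<Longrightarrow> y \<in> D \<Longrightarrow> d \<le> dist x y"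
    using separate_finite_compact[OF fin comp] components_eq by blast
  define N where "N = (\<lambda>C. \<Union>x\<in>C. ball (x::complex) (d / 2))"
  have "separating N"
    unfolding separating_def
  proof (intro conjI ballI impI)
    fix C assume C: "C \<in> ?J"
    have "connected (N C)" unfolding N_def
      by (rule connected_neighbourhood) (use d full[OF C] in \<open>auto simp: full_continuum_def\<close>)
    moreover have "C \<subseteq> N C" using d(1) by (auto simp: N_def)
    moreover have "bounded (N C)"
    proof -
      obtain B where B: "\<And>x. x \<in> C \<Longrightarrow> norm x \<le> B"
        using compact_imp_bounded[OF comp[OF C]] bounded_iff by metis
      show ?thesis
      proof (rule boundedI[of _ "B + d / 2"])
        fix y assume "y \<in> N C"
        then obtain x where "x \<in> C" "norm (x - y) < d / 2" by (auto simp: N_def dist_norm)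
        then show "norm y \<le> B + d / 2" using B[of x] norm_triangle_ineq4[of x "x - y"] by simp
      qed
    qed
    ultimately show "open (N C)" "connected (N C)" "C \<subseteq> N C" "bounded (N C)"
      by (auto simp: N_def)
  next
    fix C D assume CD: "C \<in> ?J" "D \<in> ?J" "C \<noteq> D"
    show "N C \<inter> N D = {}"
    proof (rule ccontr)
      assume "N C \<inter> N D \<noteq> {}"
      then obtain z x y where "x \<in> C" "y \<in> D" "dist x z < d / 2" "dist y z < d / 2" by (auto simp: N_def)
      moreover have "dist x y \<le> dist x z + dist y z" by (rule dist_triangle2)
      ultimately show False using d(2)[OF CD, of x y] by linarith
    qed
  qed
  then show ?thesis by blast
qed

text \<open>For large \<open>k\<close> every \<open>N C\<close> meets \<open>- Us k\<close>, since otherwise \<open>U \<union> N C\<close> would be a larger kernel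
of a subsequence. As both complements have \<open>n\<close> components, each \<open>N C\<close> contains exactly one.\<close>

lemma eventually_single_component:
  assumes sep: "separating N"
  shows "\<forall>\<^sub>F k in sequentially. - Us k \<subseteq> (\<Union>C\<in>components (- U). N C) \<and>
           (\<forall>C\<in>components (- U). - Us k \<inter> N C \<in> components (- Us k))"
proof -
  let ?J = "components (- U)"
  note N = separatingD(1)[OF sep] and disj = separatingD(2)[OF sep]
  have fin: "finite ?J" "card ?J = n" "finite (components (- Us k))" "card (components (- Us k)) = n" for k
    using U Us[of k] by (auto simp: nondeg_nconn_def)
  have opN: "open (\<Union>C\<in>?J. N C)" using N by blast
  have sub: "- (\<Union>C\<in>?J. N C) \<subseteq> U"
  proof
    fix z assume z: "z \<in> - (\<Union>C\<in>?J. N C)"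
    show "z \<in> U"
    proof (rule ccontr)
      assume "z \<notin> U"
      then have "z \<in> \<Union>?J" using Union_components[of "- U"] by auto
      then show False using z N by blast
    qed
  qed
  have ev1: "\<forall>\<^sub>F k in sequentially. - (\<Union>C\<in>?J. N C) \<subseteq> Us k"
    by (rule kernel_eventually[OF kernel closed_Compl[OF opN] sub])
  \<comment> \<open>Otherwise \<open>N C\<close> equals \<open>C\<close>, a nonempty bounded clopen
    subset of the plane.\<close>
  have meets: "N C \<inter> U \<noteq> {}" if C: "C \<in> ?J" for C
  proof
    assume "N C \<inter> U = {}"
    then have "N C \<subseteq> - U" by blast
    then have "N C \<subseteq> C"
      using components_maximal[OF C, of "N C"] N[OF C] in_components_nonempty[OF C] by blast
    then have eq: "N C = C" using N[OF C] by blast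
    have "closed C" using C closed_components[of "- U"] open_U(1) by (simp add: closed_Compl)
    then have "C = {} \<or> C = UNIV" using clopen[of C] N[OF C] eq by auto
    moreover have "bounded C" using N[OF C] eq by auto
    ultimately show False using in_components_nonempty[OF C] not_bounded_UNIV by auto
  qed
  have nonempty: "\<forall>\<^sub>F k in sequentially. - Us k \<inter> N C \<noteq> {}" if C: "C \<in> ?J" for C
  proof (rule ccontr)
    assume "\<not> ?thesis"
    then have "\<exists>\<^sub>F k in sequentially. N C \<subseteq> Us k"
      unfolding not_eventually by (rule frequently_elim1) blast
    then obtain q where q: "strict_mono (q :: nat \<Rightarrow> nat)" "\<And>k. N C \<subseteq> Us (q k)"
      using frequently_subseq by blast
    have "N C \<subseteq> U"
    proof (rule kernel_enlarge[OF kernel_subseq[OF q(1)]])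
      fix x assume "x \<in> N C"
      then obtain e where "e > 0" "ball x e \<subseteq> N C" using N[OF C] openE by metis
      then show "\<exists>e>0. \<forall>\<^sub>F k in sequentially. ball x e \<subseteq> Us (q k)"
        using q(2) by (intro exI[of _ e]) (auto intro!: always_eventually)
    qed (use N[OF C] meets[OF C] in auto)
    then show False using N[OF C] in_components_nonempty[OF C] in_components_subset[OF C] by blast
  qed
  have ev2: "\<forall>\<^sub>F k in sequentially. \<forall>C\<in>?J. - Us k \<inter> N C \<noteq> {}"
    using nonempty fin(1) by (intro eventually_ball_finite) auto
  from ev1 ev2 show ?thesis
  proof eventually_elim
    case (elim k)
    have cover: "- Us k \<subseteq> (\<Union>C\<in>?J. N C)" using elim(1) by blast
    have ex: "\<exists>C\<in>?J. D \<subseteq> N C" if D: "D \<in> components (- Us k)" for D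
    proof -
      obtain x where x: "x \<in> D" using in_components_nonempty[OF D] by blast
      have DU: "D \<subseteq> (\<Union>C\<in>?J. N C)" using in_components_subset[OF D] cover by blast
      then obtain C where C: "C \<in> ?J" "x \<in> N C" using x by blast
      have "N C \<inter> D = {} \<or> (\<Union>C'\<in>?J - {C}. N C') \<inter> D = {}"
      proof (rule connectedD)
        show "connected D" using in_components_connected[OF D] .
        show "open (N C)" using N[OF C(1)] by blast
        show "open (\<Union>C'\<in>?J - {C}. N C')" using N by blast
        show "N C \<inter> (\<Union>C'\<in>?J - {C}. N C') \<inter> D = {}" using disj C(1) by blast
        show "D \<subseteq> N C \<union> (\<Union>C'\<in>?J - {C}. N C')" using DU by blast
      qed
      then have "D \<subseteq> N C" using x C DU by blast
      then show ?thesis using C(1) by blast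
    qed
    then obtain f where f: "\<And>D. D \<in> components (- Us k) \<Longrightarrow> f D \<in> ?J \<and> D \<subseteq> N (f D)" by metis
    have pick: "\<exists>D\<in>components (- Us k). x \<in> D \<and> f D = C" if C: "C \<in> ?J" and x: "x \<in> - Us k \<inter> N C" for C x
    proof -
      have "x \<in> \<Union>(components (- Us k))" using x Union_components[of "- Us k"] by auto
      then obtain D where D: "D \<in> components (- Us k)" "x \<in> D" by blast
      then have "x \<in> N (f D)" "f D \<in> ?J" using f by blast+
      then have "f D = C" using disj[of "f D" C] C x by blast
      then show ?thesis using D by blast
    qed
    have "f ` components (- Us k) = ?J"
    proof
      show "f ` components (- Us k) \<subseteq> ?J" using f by blast
      show "?J \<subseteq> f ` components (- Us k)"
      proof
        fix C assume C: "C \<in> ?J"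
        obtain x where "x \<in> - Us k \<inter> N C" using elim(2) C by blast
        then show "C \<in> f ` components (- Us k)" using pick[OF C] by blast
      qed
    qed
    \<comment> \<open>A surjection between finite sets of the same size \<open>n\<close> is
      injective.\<close>
    then have inj: "inj_on f (components (- Us k))"
      using fin by (intro eq_card_imp_inj_on) auto
    have "- Us k \<inter> N C \<in> components (- Us k)" if C: "C \<in> ?J" for C
    proof -
      obtain y where "y \<in> - Us k \<inter> N C" using elim(2) C by blast
      then obtain D where D: "D \<in> components (- Us k)" "f D = C" using pick[OF C] by blast
      have "- Us k \<inter> N C = D"
      proof
        show "D \<subseteq> - Us k \<inter> N C" using f[OF D(1)] in_components_subset[OF D(1)] D(2) by blast
        show "- Us k \<inter> N C \<subseteq> D"
        proof
          fix x assume "x \<in> - Us k \<inter> N C"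
          then obtain D' where "D' \<in> components (- Us k)" "x \<in> D'" "f D' = C" using pick[OF C] by blast
          then show "x \<in> D" using inj_onD[OF inj, of D' D] D by blast
        qed
      qed
      then show ?thesis using D(1) by simp
    qed
    then show ?case using cover by blast
  qed
qed

text \<open>The disjoint sets \<open>N D\<close> fence off the other components, so only
  \<open>N C\<close> matters. For maximality, a candidate that reached \<open>C\<close> would
  enlarge the kernel \<open>U\<close> itself.\<close>

lemma component_converges:
  assumes sep: "separating N" and C: "C \<in> components (- U)"
  shows "cara_conv (\<lambda>k. - (- Us k \<inter> N C)) (- C)"
  unfolding cara_conv_def
proof (intro allI impI)
  let ?J = "components (- U)"
  note N = separatingD(1)[OF sep] and disj = separatingD(2)[OF sep]
  fix r :: "nat \<Rightarrow> nat" assume r: "strict_mono r"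
  note ker = kernel_subseq[OF r]
  have fullC: "full_continuum C"
    by (rule component_full_continuum[OF infty_domain_U(1) C]) (use U C in \<open>auto simp: nondeg_nconn_def\<close>)
  have NC: "z \<in> C" if "z \<in> N C" "z \<notin> U" for z
  proof -
    have "z \<in> \<Union>?J" using that(2) Union_components[of "- U"] by auto
    then obtain D where "D \<in> ?J" "z \<in> D" by blast
    then show ?thesis using N[of D] disj[of C D] that(1) C by blast
  qed
  have CU: "C \<subseteq> - U" using in_components_subset[OF C] .
  show "is_kernel ((\<lambda>k. - (- Us k \<inter> N C)) \<circ> r) (- C)"
    unfolding is_kernel_def comp_def
  proof (intro conjI allI impI)
    show "kernel_cand (\<lambda>k. - (- Us (r k) \<inter> N C)) (- C)"
      unfolding kernel_cand_def
    proof (intro conjI allI impI)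
      show "infty_domain (- C)"
        using fullC by (auto simp: infty_domain_def full_continuum_def compact_imp_closed compact_imp_bounded open_Compl)
      fix K assume K: "closed K \<and> K \<subseteq> - C"
      \<comment> \<open>Removing the other neighbourhoods leaves a closed subset of \<open>U\<close>
        that still contains all points of \<open>K\<close> in \<open>N C\<close>.\<close>
      define K' where "K' = K - (\<Union>D\<in>?J - {C}. N D)"
      have "closed K'" unfolding K'_def using K N by (intro closed_Diff) auto
      moreover have "K' \<subseteq> U"
      proof
        fix z assume z: "z \<in> K'"
        show "z \<in> U"
        proof (rule ccontr)
          assume "z \<notin> U"
          then have "z \<in> \<Union>?J" using Union_components[of "- U"] by auto
          then obtain D where "D \<in> ?J" "z \<in> D" by blast
          then show False using z K N[of D] unfolding K'_def by blast
        qed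
      qed
      ultimately have "\<forall>\<^sub>F k in sequentially. K' \<subseteq> Us (r k)" by (rule kernel_eventually[OF ker])
      then show "\<forall>\<^sub>F k in sequentially. K \<subseteq> - (- Us (r k) \<inter> N C)"
      proof eventually_elim
        case (elim k)
        have "x \<in> K'" if "x \<in> K" "x \<in> N C" for x using that disj[OF C] unfolding K'_def by blast
        then show ?case using elim by blast
      qed
    qed
    fix V assume V: "kernel_cand (\<lambda>k. - (- Us (r k) \<inter> N C)) V"
    show "V \<subseteq> - C"
    proof
      fix p assume p: "p \<in> V"
      show "p \<in> - C"
      proof
        assume pC: "p \<in> C"
        have Vd: "open V" "connected V" "bounded (- V)" using V by (auto simp: kernel_cand_def infty_domain_def)
        define T where "T = connected_component_set (V \<inter> N C) p"
        have opVN: "open (V \<inter> N C)" using Vd N[OF C] by blast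
        have T: "open T" "connected T" "p \<in> T" "T \<subseteq> V \<inter> N C"
          using open_connected_component[OF opVN] p pC N[OF C]
            connected_component_subset[of "V \<inter> N C" p]
          by (auto simp: T_def)
        \<comment> \<open>If \<open>T\<close> missed \<open>U\<close> it would lie in the closed set
          \<open>C\<close>, hence be clopen in \<open>V\<close> and equal to \<open>V\<close>; but
          \<open>V\<close> contains a neighbourhood of infinity and \<open>C\<close> is
          bounded.\<close>
        have meets: "T \<inter> U \<noteq> {}"
        proof
          assume "T \<inter> U = {}"
          then have TC: "T \<subseteq> C" using NC T(4) by blast
          have "closedin (top_of_set V) T"
          proof -
            have "V \<inter> closure T \<subseteq> T"
            proof
              fix x assume x: "x \<in> V \<inter> closure T"
              have "closure T \<subseteq> C"
                using TC fullC by (simp add: closure_minimal full_continuum_def compact_imp_closed)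
              then have xN: "x \<in> V \<inter> N C" using x N[OF C] by blast
              have "connected (insert x T)"
                by (rule connected_intermediate_closure[OF T(2)]) (use x closure_subset in auto)
              then have "insert x T \<subseteq> T"
                unfolding T_def
                by (intro connected_component_maximal) (use xN T(3,4) in \<open>auto simp: T_def\<close>)
              then show "x \<in> T" by blast
            qed
            then have "T = V \<inter> closure T" using T(4) closure_subset by blast
            then show ?thesis by (metis closed_closure closedin_closed_Int)
          qed
          moreover have "openin (top_of_set V) T" using T(1,4) by (simp add: open_subset)
          ultimately have "T = V" using Vd(2) connected_clopen T(3) by blast
          then have "bounded V" using TC fullC by (meson bounded_subset compact_imp_bounded full_continuum_def)
          then have "bounded (V \<union> - V)" using Vd(3) by (simp only: bounded_Un)
          then show False using not_bounded_UNIV by simp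
        qed
        have "T \<subseteq> U"
        proof (rule kernel_enlarge[OF ker T(1,2) meets])
          fix x assume "x \<in> T"
          then obtain e where e: "e > 0" "cball x e \<subseteq> V \<inter> N C"
            using T(4) opVN open_contains_cball by (metis subsetD)
          then have "\<forall>\<^sub>F k in sequentially. cball x e \<subseteq> - (- Us (r k) \<inter> N C)"
            using V unfolding kernel_cand_def by blast
          then have "\<forall>\<^sub>F k in sequentially. ball x e \<subseteq> Us (r k)"
          proof eventually_elim
            case (elim k)
            have "ball x e \<subseteq> cball x e" by (rule ball_subset_cball)
            then show ?case using elim e(2) by blast
          qed
          then show "\<exists>e>0. \<forall>\<^sub>F k in sequentially. ball x e \<subseteq> Us (r k)" using e(1) by blast
        qed
        then show False using T(3) pC CU by blast
      qed
    qed
  qed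
qed

end

section \<open>Lower semicontinuity of the analytic capacity\<close>

text \<open>Away from the \<open>K C\<close> the function is \<open>f\<close> plus all corrections;
  on \<open>Q C\<close> the part \<open>f + u C\<close> is replaced by \<open>v C\<close>, which
  continues up to \<open>K C\<close>. As \<open>Q C\<close> lies in every other \<open>P D\<close>,
  the remaining corrections are defined there.\<close>

lemma glue_holomorphic:
  fixes P Q K :: "'i \<Rightarrow> complex set" and u v :: "'i \<Rightarrow> complex \<Rightarrow> complex" and e :: real
  assumes J: "finite J"
    and op: "\<And>C. C \<in> J \<Longrightarrow> open (P C) \<and> open (Q C) \<and> closed (K C)"
    and PQ: "\<And>C. C \<in> J \<Longrightarrow> P C \<union> Q C = UNIV \<and> P C \<inter> K C = {}"
    and disj: "\<And>C D. C \<in> J \<Longrightarrow> D \<in> J \<Longrightarrow> C \<noteq> D \<Longrightarrow> Q C \<subseteq> P D"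
    and f: "f holomorphic_on (\<Inter>C\<in>J. P C)" "\<And>z. z \<in> (\<Inter>C\<in>J. P C) \<Longrightarrow> norm (f z) \<le> B"
    and hol: "\<And>C. C \<in> J \<Longrightarrow> u C holomorphic_on P C \<and> v C holomorphic_on Q C - K C"
    and u: "\<And>C z. C \<in> J \<Longrightarrow> z \<in> P C \<Longrightarrow> norm (u C z) \<le> e"
    and v: "\<And>C z. C \<in> J \<Longrightarrow> z \<in> Q C - K C \<Longrightarrow> norm (v C z) \<le> B'"
    and eq: "\<And>C z. C \<in> J \<Longrightarrow> z \<in> P C \<inter> Q C \<Longrightarrow> v C z = f z + u C z"
    and B: "B \<le> B'" and e: "e \<ge> 0"
  obtains h where "h holomorphic_on - (\<Union>C\<in>J. K C)"
    "\<And>z. z \<notin> (\<Union>C\<in>J. K C) \<Longrightarrow> norm (h z) \<le> B' + card J * e"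
    "\<And>z. z \<in> (\<Inter>C\<in>J. P C) \<Longrightarrow> norm (h z - f z) \<le> card J * e"
proof -
  \<comment> \<open>At most one \<open>C\<close> has \<open>z\<close> outside \<open>P C\<close>,
    since such a point lies in \<open>Q C\<close> and hence in all other \<open>P D\<close>.\<close>
  define pick where "pick = (\<lambda>z. SOME C. C \<in> J \<and> z \<notin> P C)"
  define h where "h = (\<lambda>z. if z \<in> (\<Inter>C\<in>J. P C) then f z + (\<Sum>C\<in>J. u C z)
       else v (pick z) z + (\<Sum>C\<in>J - {pick z}. u C z))"
  have unique: "pick z = C" if "C \<in> J" "z \<notin> P C" for C z
  proof -
    have "pick z \<in> J \<and> z \<notin> P (pick z)" unfolding pick_def by (rule someI[of _ C]) (use that in blast)
    then show ?thesis using disj[of C "pick z"] PQ[of C] that by blast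
  qed
  have h1: "h z = f z + (\<Sum>C\<in>J. u C z)" if "z \<in> (\<Inter>C\<in>J. P C)" for z
    using that by (simp add: h_def)
  have h2: "h z = v C z + (\<Sum>C\<in>J - {C}. u C z)" if C: "C \<in> J" "z \<in> Q C" for C z
  proof (cases "z \<in> P C")
    case True
    then have "z \<in> (\<Inter>C\<in>J. P C)" using disj[OF C(1)] C by blast
    then show ?thesis
      using h1[of z] eq[OF C(1), of z] True C(2) by (simp add: sum.remove[OF J C(1)])
  next
    case False
    then have "z \<notin> (\<Inter>C\<in>J. P C)" using C by blast
    then show ?thesis using unique[OF C(1) False] unfolding h_def by (simp only: if_False)
  qed
  have sum_le: "norm (\<Sum>C\<in>I. u C z) \<le> card J * e" if "I \<subseteq> J" "\<And>C. C \<in> I \<Longrightarrow> z \<in> P C" for I z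
  proof -
    have "norm (\<Sum>C\<in>I. u C z) \<le> (\<Sum>C\<in>I. e)" by (rule sum_norm_le) (use that u in blast)
    also have "\<dots> = card I * e" by simp
    also have "\<dots> \<le> card J * e" using card_mono[OF J that(1)] e by (intro mult_right_mono) auto
    finally show ?thesis .
  qed
  have cases: "z \<in> (\<Inter>C\<in>J. P C) \<or> (\<exists>C\<in>J. z \<in> Q C)" for z using PQ by blast
  have opP: "open (\<Inter>C\<in>J. P C)" using J op by (intro open_INT) auto
  have loc: "\<exists>W. open W \<and> z \<in> W \<and> h holomorphic_on W" if z: "z \<notin> (\<Union>C\<in>J. K C)" for z
  proof (cases "\<exists>C\<in>J. z \<in> Q C")
    case True
    then obtain C where C: "C \<in> J" "z \<in> Q C" by blast
    have "(\<lambda>z. v C z + (\<Sum>C\<in>J - {C}. u C z)) holomorphic_on Q C - K C"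
    proof (intro holomorphic_on_add holomorphic_on_sum)
      fix D assume D: "D \<in> J - {C}"
      show "u D holomorphic_on Q C - K C"
        by (rule holomorphic_on_subset[of _ "P D"]) (use hol[of D] disj[OF C(1), of D] D in blast)+
    qed (use hol[OF C(1)] in blast)
    then have "h holomorphic_on Q C - K C"
      by (rule holomorphic_transform) (use h2[OF C(1)] in auto)
    moreover have "open (Q C - K C)" using op[OF C(1)] by (simp add: open_Diff)
    moreover have "z \<in> Q C - K C" using C z by blast
    ultimately show ?thesis by blast
  next
    case False
    have "(\<lambda>z. f z + (\<Sum>C\<in>J. u C z)) holomorphic_on (\<Inter>C\<in>J. P C)"
    proof (intro holomorphic_on_add holomorphic_on_sum f)
      fix D assume D: "D \<in> J"
      show "u D holomorphic_on (\<Inter>C\<in>J. P C)"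
        by (rule holomorphic_on_subset[of _ "P D"]) (use hol[OF D] D in blast)+
    qed
    then have "h holomorphic_on (\<Inter>C\<in>J. P C)"
      by (rule holomorphic_transform) (use h1 in auto)
    then show ?thesis using opP cases[of z] False by blast
  qed
  show ?thesis
  proof (rule that[of h])
    show "h holomorphic_on - (\<Union>C\<in>J. K C)"
      unfolding holomorphic_on_def
    proof (rule ballI, rule field_differentiable_at_within)
      fix z assume "z \<in> - (\<Union>C\<in>J. K C)"
      then obtain W where "open W" "z \<in> W" "h holomorphic_on W" using loc[of z] by blast
      then show "h field_differentiable at z" using holomorphic_on_imp_differentiable_at by blast
    qed
  next
    fix z assume z: "z \<notin> (\<Union>C\<in>J. K C)"
    show "norm (h z) \<le> B' + card J * e"
    proof (cases "\<exists>C\<in>J. z \<in> Q C")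
      case True
      then obtain C where C: "C \<in> J" "z \<in> Q C" by blast
      have "norm (\<Sum>C\<in>J - {C}. u C z) \<le> card J * e"
        by (rule sum_le) (use disj[OF C(1)] C(2) in blast)+
      moreover have "norm (v C z) \<le> B'" using v[OF C(1)] C z by blast
      ultimately show ?thesis unfolding h2[OF C]
        using norm_triangle_ineq[of "v C z" "\<Sum>C\<in>J - {C}. u C z"] by linarith
    next
      case False
      then have zP: "z \<in> (\<Inter>C\<in>J. P C)" using cases by blast
      have "norm (\<Sum>C\<in>J. u C z) \<le> card J * e" by (rule sum_le) (use zP in blast)+
      then show ?thesis unfolding h1[OF zP]
        using norm_triangle_ineq[of "f z" "\<Sum>C\<in>J. u C z"] f(2)[OF zP] B by linarith
    qed
  next
    fix z assume zP: "z \<in> (\<Inter>C\<in>J. P C)"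
    have "norm (\<Sum>C\<in>J. u C z) \<le> card J * e" by (rule sum_le) (use zP in blast)+
    then show "norm (h z - f z) \<le> card J * e" unfolding h1[OF zP] by simp
  qed
qed

lemma cara_conv_shift:
  assumes "cara_conv X Y"
  shows "cara_conv (\<lambda>k. X (k + m)) Y"
  unfolding cara_conv_def
proof (intro allI impI)
  fix r :: "nat \<Rightarrow> nat" assume "strict_mono r"
  then have "strict_mono (\<lambda>k. r k + m)" by (simp add: strict_mono_def)
  then have "is_kernel (X \<circ> (\<lambda>k. r k + m)) Y" using assms unfolding cara_conv_def by blast
  then show "is_kernel ((\<lambda>k. X (k + m)) \<circ> r) Y" by (simp add: comp_def)
qed

lemma deriv_infty_diff:
  assumes "holo_on_X U g" "holo_on_X V h"
  shows "deriv_infty (\<lambda>z. g z - h z) = deriv_infty g - deriv_infty h"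
proof (rule deriv_infty_eq)
  note g = holo_on_X_limits[OF assms(1)] and h = holo_on_X_limits[OF assms(2)]
  show "((\<lambda>z. g z - h z) \<longlongrightarrow> val_infty g - val_infty h) at_infinity"
    by (intro tendsto_diff g h)
  have "((\<lambda>z. z * (g z - val_infty g) - z * (h z - val_infty h)) \<longlongrightarrow> deriv_infty g - deriv_infty h) at_infinity"
    by (intro tendsto_diff g h)
  then show "((\<lambda>z. z * (g z - h z - (val_infty g - val_infty h))) \<longlongrightarrow> deriv_infty g - deriv_infty h) at_infinity"
    by (simp add: algebra_simps)
qed

context nconn_convergence
begin

lemma transplant_component:
  assumes sep: "separating N" and CJ: "C \<in> components (- U)"
    and f: "f holomorphic_on U" "\<And>z. z \<in> U \<Longrightarrow> norm (f z) \<le> 1"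
  shows "\<exists>P Q. open P \<and> open Q \<and> P \<union> Q = UNIV \<and> P \<inter> C = {} \<and> - N C \<subseteq> P \<and> Q \<subseteq> N C \<and>
    (\<forall>e>0. \<forall>\<^sub>F k in sequentially. \<exists>u v. patches f (- Us k \<inter> N C) P Q e u v)"
proof -
  note N = separatingD(1)[OF sep] and disj = separatingD(2)[OF sep]
  obtain R where R: "R > 0" "- ball 0 R \<subseteq> U" using infty_domain_radius[OF infty_domain_U(1)] .
  have "\<forall>\<^sub>F k in sequentially. - ball 0 R \<subseteq> Us k"
    by (rule kernel_eventually[OF kernel _ R(2)]) (simp add: closed_Compl)
  with eventually_single_component[OF sep]
  have "\<forall>\<^sub>F k in sequentially. - Us k \<inter> N C \<in> components (- Us k) \<and> - Us k \<subseteq> ball 0 R"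
    by eventually_elim (use CJ in blast)
  then obtain m where m: "\<And>k. k \<ge> m \<Longrightarrow> - Us k \<inter> N C \<in> components (- Us k) \<and> - Us k \<subseteq> ball 0 R"
    unfolding eventually_sequentially by blast
  \<comment> \<open>The first \<open>m\<close> indices are dropped because
    \<open>exterior_convergence\<close> asks for continua in a common ball at every index.\<close>
  define Cs where "Cs = (\<lambda>k. - Us (k + m) \<inter> N C)"
  have fullC: "full_continuum C"
    by (rule component_full_continuum[OF infty_domain_U(1) CJ]) (use U CJ in \<open>auto simp: nondeg_nconn_def\<close>)
  have full: "full_continuum (Cs k)" for k
  proof (rule component_full_continuum[OF infty_domain_U(2)])
    show "Cs k \<in> components (- Us (k + m))" using m[of "k + m"] by (simp add: Cs_def)
    then show "Cs k \<noteq> {z}" for z using Us[of "k + m"] unfolding nondeg_nconn_def by blast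
  qed
  obtain F H where FH: "exterior_map C F H" using exterior_map_exists[OF fullC] .
  have "\<exists>F H. exterior_map (Cs k) F H" for k using exterior_map_exists[OF full[of k]] by metis
  then obtain Fs Hs where FHs: "\<And>k. exterior_map (Cs k) (Fs k) (Hs k)" by metis
  interpret exterior_convergence C Cs F H Fs Hs R
  proof
    show "Cs k \<subseteq> ball 0 R" for k using m[of "k + m"] by (auto simp: Cs_def)
    show "cara_conv (\<lambda>k. - Cs k) (- C)"
      unfolding Cs_def by (rule cara_conv_shift[OF component_converges[OF sep CJ]])
  qed (fact fullC full FH FHs)+
  have sub: "N C - C \<subseteq> U"
  proof
    fix z assume z: "z \<in> N C - C"
    show "z \<in> U"
    proof (rule ccontr)
      assume "z \<notin> U"
      then have "z \<in> \<Union>(components (- U))" using Union_components[of "- U"] by auto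
      then obtain D where "D \<in> components (- U)" "z \<in> D" by blast
      have "D = C"
      proof (rule ccontr)
        assume "D \<noteq> C"
        then have "N C \<inter> N D = {}" using disj[OF CJ \<open>D \<in> components (- U)\<close>] by simp
        then show False using z N[OF \<open>D \<in> components (- U)\<close>] \<open>z \<in> D\<close> by blast
      qed
      then show False using z \<open>z \<in> D\<close> by blast
    qed
  qed
  have fN: "norm (f z) \<le> 1" if "z \<in> N C - C" for z using f(2) sub that by blast
  obtain P Q where PQ: "open P" "open Q" "P \<union> Q = UNIV" "P \<inter> C = {}" "- N C \<subseteq> P" "C \<subseteq> Q" "Q \<subseteq> N C"
    "\<And>e. e > 0 \<Longrightarrow> \<forall>\<^sub>F k in sequentially. \<exists>u v. patches f (Cs k) P Q e u v"
  proof (rule local_transplant[of "N C" f], goal_cases)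
    case 3
    show ?case by (rule holomorphic_on_subset[OF f(1) sub])
  next
    case (4 z)
    show ?case by (rule fN[OF 4(2)])
  next
    case (5 P Q)
    show ?case by (rule 5(1)[OF 5(2-8)]) (rule 5(9))
  qed (use N[OF CJ] in blast)+
  have "\<forall>\<^sub>F k in sequentially. \<exists>u v. patches f (- Us k \<inter> N C) P Q e u v" if e: "e > 0" for e
    using PQ(8)[OF e] unfolding Cs_def by (subst (asm) eventually_sequentially_seg)
  then show ?thesis using PQ(1-5,7) by blast
qed

text \<open>The glued function is a competitor on \<open>Us k\<close> up to the factor
  \<open>1 + e\<close>. It is close to \<open>f\<close> on a large circle, so its derivative at
  infinity is close to that of \<open>f\<close>.\<close>

theorem anal_cap_lower_semicontinuous:
  assumes f: "holo_on_X U f" "\<And>z. z \<in> U \<Longrightarrow> norm (f z) \<le> 1" and e: "e > 0"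
  shows "\<forall>\<^sub>F k in sequentially. norm (deriv_infty f) \<le> (1 + e) * anal_cap (Us k) + e"
proof -
  let ?J = "components (- U)"
  obtain N where sep: "separating N" using separating_exists by blast
  note N = separatingD(1)[OF sep] and disj = separatingD(2)[OF sep]
  have J: "finite ?J" "card ?J = n" using U by (auto simp: nondeg_nconn_def)
  have holf: "f holomorphic_on U" using f(1) by (simp add: holo_on_X_def)
  define good where "good = (\<lambda>C P Q. open P \<and> open Q \<and> P \<union> Q = UNIV \<and> P \<inter> C = {} \<and> - N C \<subseteq> P \<and> Q \<subseteq> N C \<and>
      (\<forall>e>0. \<forall>\<^sub>F k in sequentially. \<exists>u v. patches f (- Us k \<inter> N C) P Q e u v))"
  have "\<forall>C\<in>?J. \<exists>P Q. good C P Q"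
    unfolding good_def using transplant_component[OF sep _ holf f(2)] by (intro ballI) simp
  then obtain P Q where "\<forall>C\<in>?J. good C (P C) (Q C)" by metis
  then have PQ: "open (P C)" "open (Q C)" "P C \<union> Q C = UNIV" "P C \<inter> C = {}" "- N C \<subseteq> P C" "Q C \<subseteq> N C"
      "\<And>e. e > 0 \<Longrightarrow> \<forall>\<^sub>F k in sequentially. \<exists>u v. patches f (- Us k \<inter> N C) (P C) (Q C) e u v"
    if "C \<in> ?J" for C
    using that unfolding good_def by simp_all
  have "bounded (\<Union>C\<in>?J. N C)" using J(1) N by blast
  then obtain R where R: "R > 0" "(\<Union>C\<in>?J. N C) \<subseteq> ball 0 R" using bounded_subset_ballD by blast
  have INT_U: "(\<Inter>C\<in>?J. P C) \<subseteq> U"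
  proof
    fix z assume z: "z \<in> (\<Inter>C\<in>?J. P C)"
    show "z \<in> U"
    proof (rule ccontr)
      assume "z \<notin> U"
      then have "z \<in> \<Union>?J" using Union_components[of "- U"] by auto
      then show False using z PQ(4) by blast
    qed
  qed
  have out_INT: "- ball 0 R \<subseteq> (\<Inter>C\<in>?J. P C)" using R(2) PQ(5) by blast
  \<comment> \<open>Chosen so that both the excess \<open>(n + 1) * t\<close> over the bound 1 and
    the derivative error \<open>2 * R * n * t\<close> are at most \<open>e\<close>.\<close>
  define t where "t = e / ((real n + 1) * (1 + 2 * R))"
  have n1: "real n + 1 > 0" and R1: "1 + 2 * R > 0" using R by auto
  have t: "t > 0" unfolding t_def using e n1 R1 by simp
  have "t * ((real n + 1) * (1 + 2 * R)) = e" unfolding t_def using n1 R1 by simp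
  then have te: "(real n + 1) * t + 2 * R * ((real n + 1) * t) = e" by (simp add: algebra_simps)
  have nt: "(real n + 1) * t \<ge> 0" "2 * R * ((real n + 1) * t) \<ge> 0" using t R by auto
  have "2 * R * (real n * t) \<le> 2 * R * ((real n + 1) * t)" using R t by (intro mult_left_mono mult_right_mono) auto
  then have t2: "2 * R * (real n * t) \<le> e" using te nt by linarith
  have t1: "1 + t + real n * t \<le> 1 + e" using te nt by (simp add: algebra_simps)
  have "\<forall>\<^sub>F k in sequentially. \<forall>C\<in>?J. \<exists>u v. patches f (- Us k \<inter> N C) (P C) (Q C) t u v"
    by (rule eventually_ball_finite[OF J(1)]) (use PQ(7) t in blast)
  with eventually_single_component[OF sep] show ?thesis
  proof eventually_elim
    case (elim k)
    define K where "K = (\<lambda>C. - Us k \<inter> N C)"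
    have Us_eq: "- (\<Union>C\<in>?J. K C) = Us k" using elim(1) unfolding K_def by blast
    have clK: "closed (K C)" if "C \<in> ?J" for C
      using elim(1) that closed_components[of "- Us k" "K C"] open_U(2)[of k]
      by (auto simp: K_def closed_Compl)
    have "\<forall>C\<in>?J. \<exists>u v. patches f (K C) (P C) (Q C) t u v" using elim(2) unfolding K_def .
    then obtain u v where "\<forall>C\<in>?J. patches f (K C) (P C) (Q C) t (u C) (v C)" by metis
    then have uv: "K C \<inter> P C = {} \<and>
       u C holomorphic_on P C \<and> v C holomorphic_on Q C - K C \<and> (\<forall>z\<in>P C. norm (u C z) \<le> t) \<and>
       (\<forall>z\<in>Q C - K C. norm (v C z) \<le> 1 + t) \<and> (\<forall>z\<in>P C \<inter> Q C. v C z = f z + u C z)" if "C \<in> ?J" for C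
      using that unfolding patches_def by blast
    obtain h where h: "h holomorphic_on - (\<Union>C\<in>?J. K C)"
      "\<And>z. z \<notin> (\<Union>C\<in>?J. K C) \<Longrightarrow> norm (h z) \<le> (1 + t) + card ?J * t"
      "\<And>z. z \<in> (\<Inter>C\<in>?J. P C) \<Longrightarrow> norm (h z - f z) \<le> card ?J * t"
    proof (rule glue_holomorphic[OF J(1), of P Q K f 1 u v t "1 + t"])
      show "f holomorphic_on (\<Inter>C\<in>?J. P C)" by (rule holomorphic_on_subset[OF holf INT_U])
      show "norm (f z) \<le> 1" if "z \<in> (\<Inter>C\<in>?J. P C)" for z using f(2) INT_U that by blast
      show "Q C \<subseteq> P D" if "C \<in> ?J" "D \<in> ?J" "C \<noteq> D" for C D
        using PQ(6)[OF that(1)] PQ(5)[OF that(2)] disj[OF that] by blast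
      show "open (P C) \<and> open (Q C) \<and> closed (K C)" if "C \<in> ?J" for C
        using PQ(1,2)[OF that] clK[OF that] by blast
      show "P C \<union> Q C = UNIV \<and> P C \<inter> K C = {}" if "C \<in> ?J" for C
        using PQ(3)[OF that] uv[OF that] by blast
      show "u C holomorphic_on P C \<and> v C holomorphic_on Q C - K C" if "C \<in> ?J" for C
        using uv[OF that] by blast
      show "norm (u C z) \<le> t" if "C \<in> ?J" "z \<in> P C" for C z using uv[OF that(1)] that(2) by blast
      show "norm (v C z) \<le> 1 + t" if "C \<in> ?J" "z \<in> Q C - K C" for C z using uv[OF that(1)] that(2) by blast
      show "v C z = f z + u C z" if "C \<in> ?J" "z \<in> P C \<inter> Q C" for C z using uv[OF that(1)] that(2) by blast
    qed (use t that in auto)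
    have hU: "h holomorphic_on Us k" using h(1) unfolding Us_eq .
    have hb: "norm (h z) \<le> 1 + e" if "z \<in> Us k" for z
      using h(2)[of z] that t1 Us_eq J(2) by force
    have out_Us: "- ball 0 R \<subseteq> Us k" unfolding Us_eq[symmetric] using R(2) by (auto simp: K_def)
    have hX: "holo_on_X (Us k) h"
      by (rule holo_on_X_if_bounded[OF hU out_Us, where B = "1 + e"]) (use hb subsetD[OF out_Us] in auto)
    have dh: "norm (deriv_infty h) \<le> (1 + e) * anal_cap (Us k)"
      by (rule deriv_infty_le_anal_cap_scaled[OF infty_domain_U(2) hX _ hb]) (use e in auto)
    have small: "norm (h z - f z) \<le> real n * t" if "norm z \<ge> R" for z
      using h(3)[of z] that subsetD[OF out_INT, of z] J(2) by auto
    have sub2: "- ball 0 R \<subseteq> U \<inter> Us k" using out_INT INT_U out_Us by blast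
    have "holo_on_X (U \<inter> Us k) (\<lambda>z. h z - f z)"
    proof (rule holo_on_X_if_bounded[OF _ sub2, where B = "real n * t"])
      show "(\<lambda>z. h z - f z) holomorphic_on U \<inter> Us k"
        by (intro holomorphic_on_diff holomorphic_on_subset[OF hU] holomorphic_on_subset[OF holf]) auto
    qed (use small in auto)
    then have "norm (deriv_infty (\<lambda>z. h z - f z)) \<le> 2 * R * (real n * t)"
      by (rule deriv_infty_bound[OF _ sub2]) (use open_U R small in auto)
    then have "norm (deriv_infty h - deriv_infty f) \<le> e"
      using t2 deriv_infty_diff[OF hX f(1)] by simp
    then show ?case using dh norm_triangle_ineq2[of "deriv_infty f" "deriv_infty h"]
      by (simp add: norm_minus_commute)
  qed
qed

end

section \<open>Convergence of the Ahlfors functions\<close>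

text \<open>The exterior map of one complementary component is a competitor. Its derivative is
  \<open>H 0\<close>, since \<open>z * F z = H (F z)\<close> tends to \<open>H 0\<close>.\<close>

lemma anal_cap_pos:
  assumes U: "infty_domain U" and C: "C \<in> components (- U)" "\<And>z. C \<noteq> {z}"
  shows "anal_cap U > 0"
proof -
  obtain F H where E: "exterior_map C F H"
    using exterior_map_exists[OF component_full_continuum[OF U C]] .
  have UC: "U \<subseteq> - C" using in_components_subset[OF C(1)] by blast
  obtain R where R: "R > 0" "- ball 0 R \<subseteq> U" using infty_domain_radius[OF U] .
  have hol: "F holomorphic_on U" by (rule holomorphic_on_subset[OF exterior_mapD(1)[OF E] UC])
  have b: "norm (F z) \<le> 1" if "z \<in> U" for z using exterior_mapD(4)[OF E, of z] that UC by force
  have X: "holo_on_X U F"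
    by (rule holo_on_X_if_bounded[OF hol R(2), where B = 1]) (use b subsetD[OF R(2)] in auto)
  have lim: "(F \<longlongrightarrow> 0) at_infinity"
  proof (rule tendstoI)
    fix e :: real assume "e > 0"
    then obtain M where "\<And>z. norm z > M \<Longrightarrow> z \<notin> C \<and> norm (F z) < e"
      using exterior_map_small_near_infinity[OF E] by blast
    then show "\<forall>\<^sub>F z in at_infinity. dist (F z) 0 < e"
      unfolding eventually_at_infinity by (intro exI[of _ "M + 1"]) auto
  qed
  have "isCont H 0"
    using exterior_mapD(2)[OF E] holomorphic_on_imp_differentiable_at
    by (metis centre_in_ball field_differentiable_imp_continuous_at open_ball zero_less_one)
  then have "((\<lambda>z. H (F z)) \<longlongrightarrow> H 0) at_infinity" using lim by (rule isCont_tendsto_compose)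
  then have "((\<lambda>z. z * (F z - 0)) \<longlongrightarrow> H 0) at_infinity"
  proof (rule Lim_transform_eventually)
    show "\<forall>\<^sub>F z in at_infinity. H (F z) = z * (F z - 0)"
      unfolding eventually_at_infinity
    proof (intro exI[of _ R] allI impI)
      fix z :: complex assume "norm z \<ge> R"
      then have "z \<notin> C" using subsetD[OF R(2), of z] UC by auto
      then show "H (F z) = z * (F z - 0)" using exterior_mapD(5)[OF E] by simp
    qed
  qed
  then have "deriv_infty F = H 0" by (rule deriv_infty_eq[OF lim])
  then have "norm (H 0) \<le> anal_cap U" using deriv_infty_le_anal_cap[OF U X b] by simp
  moreover have "norm (H 0) > 0" using exterior_mapD(8)[OF E] by simp
  ultimately show ?thesis by linarith
qed

text \<open>For \<open>n = 0\<close> the domain is the whole sphere: only constants compete, the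
  capacity is 0, and every constant of norm below 1 satisfies \<open>is_ahlfors\<close>.\<close>

lemma nondeg_nconn_anal_cap_pos:
  assumes "nondeg_nconn n U" "n \<ge> 1"
  shows "anal_cap U > 0"
proof -
  have "components (- U) \<noteq> {}" using assms by (auto simp: nondeg_nconn_def)
  then show ?thesis using assms(1) anal_cap_pos unfolding nondeg_nconn_def by blast
qed

text \<open>Everything at and near infinity is read off from one circle, a compact set on which
  normal families give uniform convergence.\<close>

lemma infinity_control:
  assumes U: "open U" "- ball 0 R \<subseteq> U" "R > 0" and V: "open V" "- ball 0 R \<subseteq> V"
    and g: "holo_on_X U g" and h: "holo_on_X V h"
    and e: "\<And>z. norm z = R \<Longrightarrow> norm (g z - h z) \<le> e"
  shows "\<And>z. norm z \<ge> R \<Longrightarrow> norm (g z - h z) \<le> e"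
    and "norm (val_infty g - val_infty h) \<le> e"
    and "norm (deriv_infty g - deriv_infty h) \<le> 2 * R * e"
proof -
  have W: "open (U \<inter> V)" "- ball 0 R \<subseteq> U \<inter> V" using U V by auto
  have hol: "(\<lambda>z. g z - h z) holomorphic_on U \<inter> V"
    using g h by (auto simp: holo_on_X_def intro: holomorphic_on_subset intro!: holomorphic_on_diff)
  have lim: "((\<lambda>z. g z - h z) \<longlongrightarrow> val_infty g - val_infty h) at_infinity"
    by (intro tendsto_diff holo_on_X_limits(1)[OF g] holo_on_X_limits(1)[OF h])
  show bd: "norm (g z - h z) \<le> e" if "norm z \<ge> R" for z
    by (rule maximum_modulus_infinity[OF hol W(2,1) U(3) lim e that])
  show "norm (val_infty g - val_infty h) \<le> e"
    by (rule norm_limit_at_infinity_le[OF lim bd])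
  have "holo_on_X (U \<inter> V) (\<lambda>z. g z - h z)"
    by (rule holo_on_X_if_bounded[OF hol W(2), where B = e]) (use bd in auto)
  then have "norm (deriv_infty (\<lambda>z. g z - h z)) \<le> 2 * R * e"
    by (rule deriv_infty_bound[OF _ W(2,1) U(3)]) (rule e)
  then show "norm (deriv_infty g - deriv_infty h) \<le> 2 * R * e"
    using deriv_infty_diff[OF g h] by simp
qed

lemma (in nconn_convergence) ahlfors_subsequence_limit:
  assumes n: "n \<ge> 1" and fs: "\<And>k. is_ahlfors (Us k) (fs k)" and f: "is_ahlfors U f"
    and r: "strict_mono (r :: nat \<Rightarrow> nat)"
  obtains q where "strict_mono (q :: nat \<Rightarrow> nat)"
    "\<And>K. closed K \<Longrightarrow> K \<subseteq> U \<Longrightarrow> uniform_limit K (\<lambda>k. fs (r (q k))) f sequentially"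
proof -
  have pos: "anal_cap U > 0" "anal_cap (Us k) > 0" for k
    using nondeg_nconn_anal_cap_pos U Us n by blast+
  have val0: "val_infty f = 0" "val_infty (fs k) = 0" for k
    using ahlfors_val_infty[OF infty_domain_U(1) f pos(1)] ahlfors_val_infty[OF infty_domain_U(2) fs pos(2)] by auto
  have fsX: "holo_on_X (Us k) (fs k)" "\<And>z. z \<in> Us k \<Longrightarrow> norm (fs k z) < 1"
      "deriv_infty (fs k) = of_real (anal_cap (Us k))" for k
    using fs by (auto simp: is_ahlfors_def)
  have fX: "holo_on_X U f" "\<And>z. z \<in> U \<Longrightarrow> norm (f z) < 1" "deriv_infty f = of_real (anal_cap U)"
    using f by (auto simp: is_ahlfors_def)
  have sub: "\<forall>\<^sub>F k in sequentially. K \<subseteq> Us (r k)" if "closed K" "K \<subseteq> U" for K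
    by (rule kernel_eventually[OF kernel_subseq[OF r] that])
  obtain g q where g: "g holomorphic_on U" "strict_mono (q :: nat \<Rightarrow> nat)"
    "\<And>K. compact K \<Longrightarrow> K \<subseteq> U \<Longrightarrow> uniform_limit K ((\<lambda>k. fs (r k)) \<circ> q) g sequentially"
  proof (rule Montel_exhausting[OF open_U(1), of "\<lambda>k. Us (r k)" "\<lambda>k. fs (r k)" 1])
    show "\<forall>\<^sub>F k in sequentially. K \<subseteq> Us (r k)" if "compact K" "K \<subseteq> U" for K
      using sub[OF compact_imp_closed] that by blast
    show "fs (r k) holomorphic_on Us (r k)" for k using fsX(1) by (simp add: holo_on_X_def)
    show "norm (fs (r k) z) \<le> 1" if "z \<in> Us (r k)" for k z using fsX(2)[OF that] by simp
  qed (use that in blast)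
  define p where "p = (\<lambda>k. r (q k))"
  have p: "strict_mono p" unfolding p_def using strict_mono_o[OF r g(2)] by (simp add: comp_def)
  have ul: "uniform_limit K (\<lambda>k. fs (p k)) g sequentially" if "compact K" "K \<subseteq> U" for K
    using g(3)[OF that] by (simp add: comp_def p_def)
  have subp: "\<forall>\<^sub>F k in sequentially. K \<subseteq> Us (p k)" if "closed K" "K \<subseteq> U" for K
    by (rule kernel_eventually[OF kernel_subseq[OF p] that])
  obtain R where R: "R > 0" "- ball 0 R \<subseteq> U" using infty_domain_radius[OF infty_domain_U(1)] .
  have gb: "norm (g z) \<le> 1" if z: "z \<in> U" for z
  proof (rule tendsto_upperbound[OF tendsto_norm])
    show "(\<lambda>k. fs (p k) z) \<longlonglongrightarrow> g z"
      by (rule tendsto_uniform_limitI[OF ul[of "{z}"]]) (use z in auto)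
    have "\<forall>\<^sub>F k in sequentially. {z} \<subseteq> Us (p k)" by (rule subp) (use z in auto)
    then show "\<forall>\<^sub>F k in sequentially. norm (fs (p k) z) \<le> 1"
      by eventually_elim (use fsX(2) less_imp_le in auto)
  qed simp
  have gX: "holo_on_X U g"
    by (rule holo_on_X_if_bounded[OF g(1) R(2), where B = 1]) (use gb subsetD[OF R(2)] in auto)
  have control: "\<forall>\<^sub>F k in sequentially. (\<forall>z. norm z \<ge> R \<longrightarrow> norm (fs (p k) z - g z) \<le> e) \<and>
      norm (val_infty (fs (p k)) - val_infty g) \<le> e \<and>
      norm (deriv_infty (fs (p k)) - deriv_infty g) \<le> 2 * R * e" if e: "e > 0" for e
  proof -
    have "sphere 0 R \<subseteq> U" using R(2) by auto
    then have "uniform_limit (sphere 0 R) (\<lambda>k. fs (p k)) g sequentially" by (intro ul) auto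
    then have ev: "\<forall>\<^sub>F k in sequentially. \<forall>z\<in>sphere 0 R. dist (fs (p k) z) (g z) < e"
      using e unfolding uniform_limit_iff by blast
    have "\<forall>\<^sub>F k in sequentially. - ball 0 R \<subseteq> Us (p k)"
      by (rule subp[OF _ R(2)]) (simp add: closed_Compl)
    with ev show ?thesis
    proof eventually_elim
      case (elim k)
      have "norm (fs (p k) z - g z) \<le> e" if "norm z = R" for z
        using elim(1) that by (auto simp: dist_norm intro: less_imp_le)
      from infinity_control[OF open_U(2) elim(2) R(1) open_U(1) R(2) fsX(1) gX this]
      show ?case by blast
    qed
  qed
  have vg: "val_infty g = 0"
  proof (rule ccontr)
    assume "val_infty g \<noteq> 0"
    then have "norm (val_infty g) / 2 > 0" by simp
    from eventually_happens'[OF sequentially_bot control[OF this]]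
    show False using \<open>val_infty g \<noteq> 0\<close> val0 by auto
  qed
  have cap_lim: "(\<lambda>k. complex_of_real (anal_cap (Us (p k)))) \<longlonglongrightarrow> deriv_infty g"
  proof (rule tendstoI)
    fix e :: real assume "e > 0"
    then have "e / (4 * R) > 0" using R by simp
    from control[OF this] show "\<forall>\<^sub>F k in sequentially. dist (complex_of_real (anal_cap (Us (p k)))) (deriv_infty g) < e"
    proof eventually_elim
      case (elim k)
      then have "norm (deriv_infty (fs (p k)) - deriv_infty g) \<le> e / 2" using R by simp
      then show ?case using \<open>e > 0\<close> fsX(3) by (simp add: dist_norm)
    qed
  qed
  \<comment> \<open>The limit of the capacities is real, being the limit of the real derivatives at
    infinity.\<close>
  define c where "c = Re (deriv_infty g)"
  have cap_c: "(\<lambda>k. anal_cap (Us (p k))) \<longlonglongrightarrow> c"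
    using tendsto_Re[OF cap_lim] by (simp add: c_def)
  have dg: "deriv_infty g = of_real c"
    using LIMSEQ_unique[OF cap_lim tendsto_of_real[OF cap_c]] .
  have "anal_cap U \<le> (1 + e) * c + e" if e: "e > 0" for e
  proof (rule tendsto_lowerbound)
    show "(\<lambda>k. (1 + e) * anal_cap (Us (p k)) + e) \<longlonglongrightarrow> (1 + e) * c + e"
      by (intro tendsto_intros cap_c)
    have "\<forall>\<^sub>F k in sequentially. norm (deriv_infty f) \<le> (1 + e) * anal_cap (Us k) + e"
      by (rule anal_cap_lower_semicontinuous[OF fX(1) _ e]) (use fX(2) less_imp_le in blast)
    then have "\<forall>\<^sub>F k in sequentially. norm (deriv_infty f) \<le> (1 + e) * anal_cap (Us (p k)) + e"
      using p by (rule eventually_subseq_sequentially)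
    then show "\<forall>\<^sub>F k in sequentially. anal_cap U \<le> (1 + e) * anal_cap (Us (p k)) + e"
      using pos(1) by (simp add: fX(3))
  qed simp
  note upper = this
  \<comment> \<open>\<open>g\<close> competes on \<open>U\<close>; with the previous bound for all
    \<open>e > 0\<close> this makes \<open>g\<close> extremal.\<close>
  have lower: "c \<le> anal_cap U"
    using deriv_infty_le_anal_cap[OF infty_domain_U(1) gX gb] dg by simp
  have "((\<lambda>e. (1 + e) * c + e) \<longlongrightarrow> (1 + 0) * c + 0) (at_right 0)"
    by (intro tendsto_intros)
  then have "anal_cap U \<le> (1 + 0) * c + 0"
    by (rule tendsto_lowerbound) (auto simp: eventually_at_right_less upper eventually_at_filter)
  then have dgU: "deriv_infty g = of_real (anal_cap U)" using lower dg by simp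
  have gf: "g z = f z" if "z \<in> U" for z
    by (rule ahlfors_unique[OF infty_domain_U(1) gX fX(1) gb _ vg val0(1) dgU fX(3) that])
       (use fX(2) less_imp_le in auto)
  \<comment> \<open>\<open>K\<close> may be unbounded: \<open>control\<close> covers
    \<open>norm z \<ge> R\<close>, uniform convergence on compact sets covers the rest.\<close>
  have "uniform_limit K (\<lambda>k. fs (p k)) f sequentially" if K: "closed K" "K \<subseteq> U" for K
    unfolding uniform_limit_iff
  proof (intro allI impI)
    fix e :: real assume e: "e > 0"
    have "uniform_limit (K \<inter> cball 0 R) (\<lambda>k. fs (p k)) g sequentially"
      by (rule ul) (use K in \<open>auto intro: closed_Int_compact\<close>)
    then have ev1: "\<forall>\<^sub>F k in sequentially. \<forall>z\<in>K \<inter> cball 0 R. dist (fs (p k) z) (g z) < e"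
      using e unfolding uniform_limit_iff by blast
    have "e / 2 > 0" using e by simp
    from control[OF this] ev1 show "\<forall>\<^sub>F k in sequentially. \<forall>z\<in>K. dist (fs (p k) z) (f z) < e"
    proof eventually_elim
      case (elim k)
      show ?case
      proof
        fix z assume z: "z \<in> K"
        have "dist (fs (p k) z) (g z) < e"
        proof (cases "norm z \<ge> R")
          case True
          then have "norm (fs (p k) z - g z) \<le> e / 2" using elim(1) by blast
          then show ?thesis using e by (simp add: dist_norm)
        qed (use elim(2) z in auto)
        then show "dist (fs (p k) z) (f z) < e" using gf z K by auto
      qed
    qed
  qed
  then show ?thesis using that[OF g(2)] by (simp add: p_def)
qed

theorem mainTheorem10:
  fixes n :: nat and U :: "complex set" and Us :: "nat \<Rightarrow> complex set"
    and f :: "complex \<Rightarrow> complex" and fs :: "nat \<Rightarrow> complex \<Rightarrow> complex"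
  assumes "n \<ge> 1"
    and "nondeg_nconn n U"
    and "\<forall>k. nondeg_nconn n (Us k)"
    and "cara_conv Us U"
    and "\<forall>k. is_ahlfors (Us k) (fs k)"
    and "is_ahlfors U f"
  shows "locunif_conv_X U fs f"
proof -
  interpret nconn_convergence n U Us
    using assms by unfold_locales auto
  have fs: "is_ahlfors (Us k) (fs k)" for k using assms(5) by blast
  \<comment> \<open>Subsequence principle: a subsequence that stays \<open>e\<close> away from
    \<open>f\<close> would itself contain one converging to \<open>f\<close>.\<close>
  have "uniform_limit K fs f sequentially" if K: "closed K" "K \<subseteq> U" for K
  proof (rule ccontr)
    assume "\<not> ?thesis"
    then obtain e where e: "e > 0" "\<exists>\<^sub>F k in sequentially. \<not> (\<forall>z\<in>K. dist (fs k z) (f z) < e)"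
      unfolding uniform_limit_iff not_eventually[symmetric] by blast
    obtain r where r: "strict_mono (r :: nat \<Rightarrow> nat)" "\<And>k. \<not> (\<forall>z\<in>K. dist (fs (r k) z) (f z) < e)"
      using frequently_subseq[OF e(2)] by blast
    obtain q where "strict_mono (q :: nat \<Rightarrow> nat)"
      "\<And>K. closed K \<Longrightarrow> K \<subseteq> U \<Longrightarrow> uniform_limit K (\<lambda>k. fs (r (q k))) f sequentially"
      using ahlfors_subsequence_limit[OF assms(1) fs assms(6) r(1)] by blast
    from this(2)[OF K] have "\<forall>\<^sub>F k in sequentially. \<forall>z\<in>K. dist (fs (r (q k)) z) (f z) < e"
      using e(1) unfolding uniform_limit_iff by blast
    then show False using r(2) by simp
  qed
  \<comment> \<open>All Ahlfors functions vanish at infinity, so convergence of the values there is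
    trivial.\<close>
  moreover have "val_infty f = 0" "val_infty (fs k) = 0" for k
    using ahlfors_val_infty[OF infty_domain_U(1) assms(6)] ahlfors_val_infty[OF infty_domain_U(2) fs]
      nondeg_nconn_anal_cap_pos[OF U assms(1)] nondeg_nconn_anal_cap_pos[OF Us assms(1)] by auto
  ultimately show ?thesis by (auto simp: locunif_conv_X_def)
qed

end
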